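(* Fix $\mu>0$. As $N\to\infty$, $$\frac{1}{\sqrt N}\left(C_1,\ldots,C_{\nu_{N,\lfloor\mu\sqrt N\rfloor}-1}\right)\ \longrightarrow\ \left(D_1,\ldots,D_{\nu(\mu)}\right)\quad\text{in distribution},$$ where $C_1<\cdots<C_{\nu_{N,k}-1}$ are the color-changing indices of the colored loop-erased walk from $N$ stopped on first hitting $[k]$, with $k=\lfloor\mu\sqrt N\rfloor$, where $D_1<D_2<\cdots$ are the points of an inhomogeneous Poisson point process with rate $\frac{1}{\mu+t}$ at time $t$, and where $\nu(\mu):=\sup\{i: D_i<R_{X_\mu}\}$. Here $(R_t)_{t\ge0}$ is the standard Rayleigh process and $X_\mu$ is independent of $(R_t)_{t\ge0}$ and has an exponential distribution with parameter $\mu$.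
   Context: Notation: $[m]=\{1,\ldots,m\}$. The walk: for integers $N\ge2$ and $1\le k\le N-1$, let $X_0=N$ and let $X_1,X_2,\ldots$ be independent and uniformly distributed on $[N]$; $\zeta_{N,k}$ is the first time $t$ with $X_t\in[k]$. With $k=\lfloor\mu\sqrt N\rfloor$, $N$ is taken large enough that $1\le k\le N-1$. Loop-erased walk: define finite sequences $\mathcal{L}_n=(Y_{n,0},\ldots,Y_{n,L_n})$ inductively. Set $\mathcal{L}_0=(X_0)$, $L_0=0$. If $X_n$ is not among the terms of $\mathcal{L}_{n-1}$, append $X_n$ to $\mathcal{L}_{n-1}$ to get $\mathcal{L}_n$, so $L_n=L_{n-1}+1$. If $X_n=Y_{n-1,j}$ for some $0\le j\le L_{n-1}$, then $\mathcal{L}_n=(Y_{n-1,0},\ldots,Y_{n-1,j})$ and $L_n=j$; in this case a loop is said to occur. The $i$-th edge of $\mathcal{L}_n$ is $(Y_{n,i-1},Y_{n,i})$, $1\le i\le L_n$. Coloring: there is an infinite palette of distinct colors. Edges of the walk are painted with a fixed color until a loop occurs; at that point the edges in the loop are erased, the remaining edges keep their colors, and subsequent edges are painted with a new color, distinct from all previous ones, until the next loop occurs, and so on. Let $\lambda_{N,k}=L_{\zeta_{N,k}}$ be the length of the loop-erased walk at time $\zeta_{N,k}$, and let $\nu_{N,k}$ be the number of different colors among the edges of $\mathcal{L}_{\zeta_{N,k}}$. Given $\lambda_{N,k}=j$, the color-changing indices $C_1<\cdots<C_{\nu_{N,k}-1}$ are those $i\in[j-1]$ for which the $i$-th and $(i+1)$-th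 edges of $\mathcal{L}_{\zeta_{N,k}}$ are colored differently. Standard Rayleigh process $(R_t)_{t\ge0}$: let $P_1<P_2<\cdots$ be the successive points of an inhomogeneous Poisson point process on $[0,\infty)$ with rate $t$ at time $t$, and let $P_0=0$. Let $R_0=0$; for $P_{i-1}<t<P_i$, $R_t$ grows at unit speed; at each time $P_i$, $R_{P_i}$ is selected uniformly within the interval $(0,R_{P_i-})$. The sequence $(D_1,\ldots,D_{\nu(\mu)})$ is called the sequence of ladder indices of the standard Rayleigh process up to time $X_\mu$: if at a jump time $P_i$ the process jumps down to some $Q_i$ uniformly chosen in $(0,R_{P_i-})$, then $(D_1,\ldots,D_{\nu(\mu)})$ is the subsequence $(Q_{i_1},\ldots,Q_{i_{\nu(\mu)}})$ of $(Q_1,Q_2,\ldots)$ up to time $X_\mu$ such that for each index $i_c$, $Q_{i_c}<Q_{i_c+m}$ for all $m=1,2,\ldots$.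
   Formalization: The standard Rayleigh process jumps at rate R_{t-} at time t, not at the points of a Poisson process of rate t (with which the claim fails, e.g. for small μ). The points D_i are taken independent of R and X_μ; the limit is also shown to be the law of the ladder indices. *)

theory Defs
  imports "HOL-Probability.Probability"
begin

subsection \<open>Convergence in distribution of finite sequences of random length\<close>

text \<open>Finite real sequences form the disjoint union of the spaces \<open>\<real>\<^sup>n\<close>, \<open>n = 0, 1, 2, \<dots>\<close>;
  the sequence \<open>(x 0, \<dots>, x (n - 1))\<close> is the point \<open>finite_seq n x\<close>. The padding by 0 is the one
  prescribed by \<^const>\<open>Euclidean_space\<close>.\<close>

definition finite_seqs :: "(nat \<times> (nat \<Rightarrow> real)) topology" where
  "finite_seqs = sum_topology Euclidean_space UNIV"

definition finite_seq :: "nat \<Rightarrow> (nat \<Rightarrow> real) \<Rightarrow> nat \<times> (nat \<Rightarrow> real)" where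
  "finite_seq n x = (n, \<lambda>i. if i < n then x i else 0)"

text \<open>The library's \<open>weak_conv\<close> only covers the real line. Measurability is demanded because
  the Bochner integral of a non-measurable function is 0 by convention.\<close>

definition converges_in_distribution ::
  "'s topology \<Rightarrow> (nat \<Rightarrow> 'a measure) \<Rightarrow> (nat \<Rightarrow> 'a \<Rightarrow> 's) \<Rightarrow> 'b measure \<Rightarrow> ('b \<Rightarrow> 's) \<Rightarrow> bool" where
  "converges_in_distribution T M Z M' Z' \<longleftrightarrow>
     (\<forall>f. continuous_map T euclideanreal f \<and> bounded (f ` topspace T) \<longrightarrow>
        (\<forall>\<^sub>F N in sequentially. (\<lambda>\<omega>. f (Z N \<omega>)) \<in> borel_measurable (M N)) \<and>
        (\<lambda>\<omega>. f (Z' \<omega>)) \<in> borel_measurable M' \<and>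
        (\<lambda>N. \<integral>\<omega>. f (Z N \<omega>) \<partial>M N) \<longlonglongrightarrow> (\<integral>\<omega>. f (Z' \<omega>) \<partial>M'))"


subsection \<open>The colored loop-erased walk\<close>

definition uniform_walk :: "'a measure \<Rightarrow> nat \<Rightarrow> (nat \<Rightarrow> 'a \<Rightarrow> nat) \<Rightarrow> bool" where
  "uniform_walk M N X \<longleftrightarrow>
     prob_space M \<and>
     (\<forall>\<omega>\<in>space M. X 0 \<omega> = N) \<and>
     prob_space.indep_vars M (\<lambda>_. count_space UNIV) X {1..} \<and>
     (\<forall>t\<ge>1. distr M (count_space UNIV) (X t) = measure_pmf (pmf_of_set {1..N}))"

text \<open>Junk value, on a null event, if the path never visits \<open>[k]\<close>.\<close>

definition hitting_time :: "nat \<Rightarrow> (nat \<Rightarrow> nat) \<Rightarrow> nat" where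
  "hitting_time k x = (LEAST t. x t \<in> {1..k})"

text \<open>A state \<open>(ys, cs, c)\<close> consists of the vertices \<open>Y\<^sub>0, \<dots>, Y\<^sub>L\<close>, the colors of the \<open>L\<close> edges
  (\<open>cs ! (i - 1)\<close> is the color of the \<open>i\<close>-th edge \<open>(Y\<^bsub>i-1\<^esub>, Y\<^sub>i)\<close>), and the color in current use. Colors
  are numbered by the number of loops that have occurred; staying at \<open>Y\<^sub>L\<close> is a loop.\<close>

fun lew_step :: "'v \<Rightarrow> 'v list \<times> nat list \<times> nat \<Rightarrow> 'v list \<times> nat list \<times> nat" where
  "lew_step v (ys, cs, c) =
     (if v \<in> set ys
      then let j = (LEAST j. j < length ys \<and> ys ! j = v) in (take (Suc j) ys, take j cs, Suc c)
      else (ys @ [v], cs @ [c], c))"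

primrec lew :: "(nat \<Rightarrow> 'v) \<Rightarrow> nat \<Rightarrow> 'v list \<times> nat list \<times> nat" where
  "lew x 0 = ([x 0], [], 0)"
| "lew x (Suc n) = lew_step (x (Suc n)) (lew x n)"

definition lew_length :: "(nat \<Rightarrow> 'v) \<Rightarrow> nat \<Rightarrow> nat" where
  "lew_length x n = length (fst (lew x n)) - 1"

definition edge_color :: "(nat \<Rightarrow> 'v) \<Rightarrow> nat \<Rightarrow> nat \<Rightarrow> nat" where
  "edge_color x n i = fst (snd (lew x n)) ! (i - 1)"

definition num_colors :: "(nat \<Rightarrow> 'v) \<Rightarrow> nat \<Rightarrow> nat" where
  "num_colors x n = card (edge_color x n ` {1..lew_length x n})"

definition color_changes :: "(nat \<Rightarrow> 'v) \<Rightarrow> nat \<Rightarrow> nat set" where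
  "color_changes x n =
     {i \<in> {1..lew_length x n - 1}. edge_color x n i \<noteq> edge_color x n (i + 1)}"

definition scaled_color_changes :: "nat \<Rightarrow> nat \<Rightarrow> (nat \<Rightarrow> nat) \<Rightarrow> nat \<times> (nat \<Rightarrow> real)" where
  "scaled_color_changes N k x =
     (let z = hitting_time k x in
      finite_seq (num_colors x z - 1)
        (\<lambda>i. real (sorted_list_of_set (color_changes x z) ! i) / sqrt (real N)))"


subsection \<open>The standard Rayleigh process\<close>

text \<open>The path with jump times \<open>P\<^sub>1 < P\<^sub>2 < \<dots>\<close> and post-jump values \<open>Q\<^sub>1, Q\<^sub>2, \<dots>\<close>
  (and \<open>P\<^sub>0 = Q\<^sub>0 = 0\<close>): \<open>R\<^sub>t = Q\<^sub>i + (t - P\<^sub>i)\<close> for \<open>P\<^sub>i \<le> t < P\<^bsub>i+1\<^esub>\<close>.\<close>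

definition rayleigh_path :: "(nat \<Rightarrow> real) \<Rightarrow> (nat \<Rightarrow> real) \<Rightarrow> real \<Rightarrow> real" where
  "rayleigh_path P Q t = (let i = (LEAST i. t < P (Suc i)) in Q i + (t - P i))"

text \<open>The left limit of the path at \<open>P\<^bsub>i+1\<^esub>\<close>.\<close>

definition pre_jump_value :: "(nat \<Rightarrow> real) \<Rightarrow> (nat \<Rightarrow> real) \<Rightarrow> nat \<Rightarrow> real" where
  "pre_jump_value P Q i = Q i + (P (Suc i) - P i)"

definition jump_hazard :: "(nat \<Rightarrow> real) \<Rightarrow> (nat \<Rightarrow> real) \<Rightarrow> nat \<Rightarrow> real" where
  "jump_hazard P Q i = integral {P i..P (Suc i)} (rayleigh_path P Q)"

text \<open>Jumps occur at rate \<open>R\<^bsub>t-\<^esub>\<close> at time \<open>t\<close> (so at rate \<open>t\<close> until the first jump), that is, the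
  hazards accumulated between successive jumps are independent standard exponentials; at \<open>P\<^sub>i\<close> the
  path drops to a uniform point of \<open>(0, R\<^bsub>P\<^sub>i-\<^esub>)\<close>. This is the Rayleigh process of Evans, Pitman and
  Winter. With rate \<open>t\<close> at all times one would have to thin the jumps, keeping one at time \<open>t\<close> with
  probability \<open>R\<^bsub>t-\<^esub> / t\<close>.\<close>

definition rayleigh_process ::
  "'b measure \<Rightarrow> (nat \<Rightarrow> 'b \<Rightarrow> real) \<Rightarrow> (nat \<Rightarrow> 'b \<Rightarrow> real) \<Rightarrow> bool" where
  "rayleigh_process M P Q \<longleftrightarrow>
     (\<forall>i. P i \<in> borel_measurable M \<and> Q i \<in> borel_measurable M) \<and>
     (AE \<omega> in M. P 0 \<omega> = 0 \<and> Q 0 \<omega> = 0 \<and> (\<forall>i. P i \<omega> < P (Suc i) \<omega>)) \<and>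
     (let E = (\<lambda>i \<omega>. jump_hazard (\<lambda>j. P j \<omega>) (\<lambda>j. Q j \<omega>) i);
          U = (\<lambda>i \<omega>. Q (Suc i) \<omega> / pre_jump_value (\<lambda>j. P j \<omega>) (\<lambda>j. Q j \<omega>) i)
      in prob_space.indep_vars M (\<lambda>_. borel) (case_sum E U) UNIV \<and>
         (\<forall>i. distributed M lborel (E i) (exponential_density 1)) \<and>
         (\<forall>i. distributed M lborel (U i) (indicator {0<..<1})))"

definition ladder_jumps :: "(nat \<Rightarrow> real) \<Rightarrow> (nat \<Rightarrow> real) \<Rightarrow> real \<Rightarrow> nat set" where
  "ladder_jumps P Q T =
     {i. 1 \<le> i \<and> P i \<le> T \<and> (\<forall>m\<ge>1. P (i + m) \<le> T \<longrightarrow> Q i < Q (i + m))}"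

definition ladder_indices ::
  "(nat \<Rightarrow> real) \<Rightarrow> (nat \<Rightarrow> real) \<Rightarrow> real \<Rightarrow> nat \<times> (nat \<Rightarrow> real)" where
  "ladder_indices P Q T =
     finite_seq (card (ladder_jumps P Q T))
       (\<lambda>c. Q (sorted_list_of_set (ladder_jumps P Q T) ! c))"


subsection \<open>Inhomogeneous Poisson points\<close>

text \<open>The points are \<open>D\<^sub>1 < D\<^sub>2 < \<dots>\<close>; \<open>D\<^sub>0\<close> is not used. Finiteness is explicit because the
  cardinality of an infinite set is 0.\<close>

definition poisson_points ::
  "'b measure \<Rightarrow> (real \<Rightarrow> real) \<Rightarrow> (nat \<Rightarrow> 'b \<Rightarrow> real) \<Rightarrow> bool" where
  "poisson_points M \<rho> D \<longleftrightarrow>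
     (\<forall>i\<ge>1. D i \<in> borel_measurable M) \<and>
     (AE \<omega> in M. 0 \<le> D 1 \<omega> \<and> (\<forall>i\<ge>1. D i \<omega> < D (Suc i) \<omega>)) \<and>
     (\<forall>n (B :: nat \<Rightarrow> real set) (m :: nat \<Rightarrow> nat).
        (\<forall>j<n. B j \<in> sets borel \<and> B j \<subseteq> {0..} \<and> set_integrable lborel (B j) \<rho>) \<and>
        disjoint_family_on B {..<n} \<longrightarrow>
        measure M {\<omega> \<in> space M. \<forall>j<n. finite {i. 1 \<le> i \<and> D i \<omega> \<in> B j} \<and>
                                      card {i. 1 \<le> i \<and> D i \<omega> \<in> B j} = m j} =
        (\<Prod>j<n. (LINT t:B j|lborel. \<rho> t) ^ m j / fact (m j) * exp (- (LINT t:B j|lborel. \<rho> t))))"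

text \<open>\<open>(D\<^sub>1, \<dots>, D\<^sub>\<nu>)\<close> with \<open>\<nu> = sup {i. D\<^sub>i < r}\<close>, where \<open>sup \<emptyset> = 0\<close>.\<close>

definition points_below :: "(nat \<Rightarrow> real) \<Rightarrow> real \<Rightarrow> nat \<times> (nat \<Rightarrow> real)" where
  "points_below D r = finite_seq (Sup {i. 1 \<le> i \<and> D i < r}) (\<lambda>i. D (Suc i))"


subsection \<open>Independence of random elements with different ranges\<close>

text \<open>The library's \<open>indep_var\<close> requires both random elements to have the same type.\<close>

definition independent_elements ::
  "'b measure \<Rightarrow> 's measure \<Rightarrow> ('b \<Rightarrow> 's) \<Rightarrow> 't measure \<Rightarrow> ('b \<Rightarrow> 't) \<Rightarrow> bool" where
  "independent_elements M S X T Y \<longleftrightarrow>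
     X \<in> measurable M S \<and> Y \<in> measurable M T \<and>
     prob_space.indep_set M (sets (vimage_algebra (space M) X S))
                            (sets (vimage_algebra (space M) Y T))"

abbreviation pair_seq_algebra :: "(nat \<Rightarrow> real \<times> real) measure" where
  "pair_seq_algebra \<equiv> PiM UNIV (\<lambda>_. borel \<Otimes>\<^sub>M borel)"

end

theory Submission
  imports Defs
begin

text \<open>Both sides of the limit are increasing lists of heights that grow and are cut. When the Rayleigh
  process jumps down to \<open>y\<close>, the ladder indices found so far that are at least \<open>y\<close> disappear and \<open>y\<close>
  becomes the last one. When the loop-erased walk closes a loop at position \<open>j\<close>, the color changes
  at or beyond \<open>j\<close> disappear and (for \<open>j > 0\<close>) \<open>j\<close> becomes a color change, because the next edge
  gets a new color. In both cases the list together with the current height is a Markov process: it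
  climbs at unit speed, from height \<open>v\<close> it jumps at rate \<open>v\<close> to a uniform lower point, and it is
  killed at rate \<open>\<mu>\<close>. For the walk this holds after rescaling by \<open>\<surd>N\<close>: from length \<open>l\<close> the loop
  closes at each of the positions \<open>0, \<dots>, l\<close> with probability \<open>1 / N\<close>, and \<open>[k]\<close> is hit with
  probability \<open>k / N\<close>.

  The proof rests on an explicit Green function. The expected time that the process of ladder
  indices spends at the list \<open>x\<^sub>1 < \<dots> < x\<^sub>n\<close> and height \<open>v\<close> is
  \<open>(\<Prod>i. dx\<^sub>i / (\<mu> + x\<^sub>i)) exp (- \<mu> v - v\<^sup>2 / 2) dv\<close>; it satisfies the balance equation because of
  the identity \<open>tail_plus\<close>: with \<open>s x = exp (- \<mu> x - x\<^sup>2 / 2)\<close>, the integral of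
  \<open>s x + s x / (\<mu> + x)\<^sup>2\<close> over \<open>x > a\<close> is \<open>s a / (\<mu> + a)\<close>. Killing at rate \<open>\<mu>\<close> puts the factor \<open>\<mu>\<close>
  in front, and the result \<open>ladder_law\<close> is the joint law of the ladder indices and of the height at
  the killing time. It also explains the other form of the limit: its last coordinate has density
  \<open>(\<mu> + v) s v\<close>, and given that it is \<open>v\<close>, the list consists of the points below \<open>v\<close> of a Poisson
  process of rate \<open>1 / (\<mu> + x)\<close>, since the probability that this process has no point below \<open>v\<close> is
  \<open>\<mu> / (\<mu> + v)\<close>. The walk has the same Green function with \<open>1 / (k + c)\<close> in place of \<open>1 / (\<mu> + x)\<close>
  and a product of probabilities \<open>1 - (k + i) / N\<close> in place of \<open>s\<close>.

  Only one-sided bounds are proved. A functional that satisfies \<open>F\<^sub>0 + G (K F) \<le> G F\<close> dominates the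
  expected occupation of a chain with transition \<open>K\<close> (\<open>suminf_iterates_le_supersolution\<close>), and so
  the law of the ladder indices is at most the one given by \<open>ladder_law\<close> (\<open>nn_integral_ladder_le\<close>),
  and the law of the color changes is at most its discrete version (\<open>nn_integral_changes_le\<close>). These
  majorants have total mass at most 1 (\<open>ladder_law_1_le\<close>, \<open>walk_Green_1_le\<close>), which turns an upper
  bound for a probability law into an equality. Discrete sums converge to iterated integrals at
  least in the sense of Fatou's lemma (\<open>grid_liminf_suminf\<close>): for continuous \<open>f \<ge> 0\<close> the limit
  inferior of the expectations for the walk is at least the corresponding integral against
  \<open>ladder_law\<close> (\<open>walk_lower_bound\<close>), and a partition into small cells gives the same lower bound for
  Poisson points (\<open>ladder_law_le_points\<close>). For bounded continuous \<open>\<phi>\<close> with \<open>|\<phi>| \<le> B\<close>, the bounds for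
  \<open>f = B + \<phi>\<close> and \<open>f = B - \<phi>\<close> add up to the total mass \<open>2 B\<close>, which forces convergence to one common
  limit.\<close>

section \<open>Series bounded by supersolutions\<close>

lemma ennreal_mult_divide_cancel:
  fixes c I :: ennreal
  assumes "c \<noteq> 0" "c \<noteq> top" shows "c * (I / c) = I"
  using assms by (subst ennreal_times_divide) (simp add: mult.commute[of c] mult_divide_eq_ennreal)

lemma suminf_le_of_atMost:
  fixes f :: "nat \<Rightarrow> ennreal"
  assumes "\<And>n. (\<Sum>m\<le>n. f m) \<le> c" shows "(\<Sum>m. f m) \<le> c"
proof (rule suminf_le_const)
  show "(\<Sum>m<n. f m) \<le> c" for n
    by (rule order_trans[OF sum_mono2 assms[of n]]) auto
qed auto

text \<open>If \<open>m n F\<close> is the expectation of \<open>F\<close> after \<open>n\<close> steps of a (killed) chain with transition operator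
  \<open>K\<close>, then the left side is the expected occupation and the Green functional is the least \<open>G\<close> with
  \<open>m 0 F + G (K F) = G F\<close>. The proof bounds the partial sums, by induction for all \<open>F\<close> at once.\<close>

lemma suminf_iterates_le_supersolution:
  fixes m :: "nat \<Rightarrow> 'f \<Rightarrow> ennreal"
  assumes step: "\<And>n F. A F \<Longrightarrow> m (Suc n) F = m n (K F)" and inv: "\<And>F. A F \<Longrightarrow> A (K F)"
    and super: "\<And>F. A F \<Longrightarrow> m 0 F + G (K F) \<le> G F" and F: "A F"
  shows "(\<Sum>n. m n F) \<le> G F"
proof (rule suminf_le_of_atMost)
  show "(\<Sum>i\<le>n. m i F) \<le> G F" for n
    using F
  proof (induction n arbitrary: F)
    case 0
    have "m 0 F \<le> m 0 F + G (K F)" by simp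
    also have "\<dots> \<le> G F" by (rule super[OF 0])
    finally show ?case by simp
  next
    case (Suc n)
    have "(\<Sum>i\<le>Suc n. m i F) = m 0 F + (\<Sum>i\<le>n. m i (K F))"
      using Suc.prems by (simp add: sum.atMost_Suc_shift step del: sum.atMost_Suc)
    also have "\<dots> \<le> m 0 F + G (K F)" by (intro add_left_mono Suc.IH inv Suc.prems)
    also have "\<dots> \<le> G F" by (rule super[OF Suc.prems])
    finally show ?case .
  qed
qed

text \<open>By the Borel--Cantelli lemma the events fail eventually; as the event number 0 occurs, there is a
  place where an occurrence is followed by a failure.\<close>

lemma (in prob_space) AE_last_success:
  assumes [measurable]: "\<And>n. Measurable.pred M (p n)"
    and fin: "(\<Sum>n. emeasure M {\<omega> \<in> space M. p n \<omega>}) < \<infinity>" and p0: "AE \<omega> in M. p 0 \<omega>"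
  shows "AE \<omega> in M. \<exists>n. p n \<omega> \<and> \<not> p (Suc n) \<omega>"
proof -
  have "AE \<omega> in M. \<forall>\<^sub>F n in sequentially. \<omega> \<in> space M - {\<omega> \<in> space M. p n \<omega>}"
  proof (rule borel_cantelli_AE1)
    show "summable (\<lambda>n. measure M {\<omega> \<in> space M. p n \<omega>})"
      by (rule summable_suminf_not_top) (use fin in \<open>auto simp: emeasure_eq_measure\<close>)
  qed (auto simp: emeasure_eq_measure)
  with p0 show ?thesis
  proof eventually_elim
    case (elim \<omega>)
    then obtain n where n: "\<not> p n \<omega>" by (auto simp: eventually_sequentially)
    show ?case
    proof (rule ccontr)
      assume "\<not> ?thesis"
      then have "p n \<omega>" by (induction n) (use elim(1) in auto)
      with n show False by simp
    qed
  qed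
qed

section \<open>Measurable functions of finite sequences\<close>

text \<open>The disjoint union of the Borel spaces \<open>\<real>\<^sup>n\<close>: the coarsest \<sigma>-algebra that makes the length and all
  entries measurable, where missing entries are read as 0.\<close>

definition list_borel :: "real list measure" where
  "list_borel = vimage_algebra UNIV (\<lambda>l. (length l, \<lambda>i. if i < length l then l ! i else 0))
     (count_space UNIV \<Otimes>\<^sub>M PiM UNIV (\<lambda>_. borel))"

lemma space_list_borel [simp]: "space list_borel = UNIV"
  by (simp add: list_borel_def)

lemma measurable_list_coding:
  "(\<lambda>l. (length l, \<lambda>i. if i < length l then l ! i else 0))
     \<in> list_borel \<rightarrow>\<^sub>M (count_space UNIV \<Otimes>\<^sub>M PiM UNIV (\<lambda>_. borel :: real measure))"
  unfolding list_borel_def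
  by (rule measurable_vimage_algebra1) (auto simp: space_pair_measure space_PiM)

lemma measurable_list_length [measurable]: "length \<in> list_borel \<rightarrow>\<^sub>M count_space UNIV"
  using measurable_compose[OF measurable_list_coding measurable_fst] by simp

lemma measurable_list_nth:
  "(\<lambda>l. if i < length l then l ! i else 0) \<in> borel_measurable list_borel"
  using measurable_compose[OF measurable_compose[OF measurable_list_coding measurable_snd]
      measurable_component_singleton[of i UNIV]] by simp

lemma measurable_list_borelI:
  fixes g :: "'a \<Rightarrow> real list"
  assumes [measurable]: "(\<lambda>x. length (g x)) \<in> M \<rightarrow>\<^sub>M count_space UNIV"
    and [measurable]: "\<And>i. (\<lambda>x. if i < length (g x) then g x ! i else 0) \<in> borel_measurable M"
  shows "g \<in> M \<rightarrow>\<^sub>M list_borel"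
  unfolding list_borel_def
  by (rule measurable_vimage_algebra2) (auto intro!: measurable_Pair measurable_PiM_single')

text \<open>Every list is recovered from its length and its padded sequence of entries, so it suffices to look
  at \<open>F\<close> in these coordinates.\<close>

lemma measurable_from_list_borelI:
  assumes "(\<lambda>(n, s). F (map s [0..<n])) \<in> (count_space UNIV \<Otimes>\<^sub>M PiM UNIV (\<lambda>_. borel)) \<rightarrow>\<^sub>M N"
  shows "F \<in> list_borel \<rightarrow>\<^sub>M N"
proof -
  have "F = (\<lambda>l. (\<lambda>(n, s). F (map s [0..<n])) (length l, \<lambda>i. if i < length l then l ! i else 0))"
  proof
    fix l :: "real list"
    have "map (\<lambda>i. if i < length l then l ! i else 0) [0..<length l] = l"
      by (intro nth_equalityI) auto
    then show "F l = (\<lambda>(n, s). F (map s [0..<n])) (length l, \<lambda>i. if i < length l then l ! i else 0)"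
      by simp
  qed
  with measurable_compose[OF measurable_list_coding assms] show ?thesis by simp
qed

lemma measurable_butlast [measurable]: "butlast \<in> list_borel \<rightarrow>\<^sub>M list_borel"
proof (rule measurable_list_borelI)
  fix i
  have [measurable]: "(\<lambda>l. if i < length l then l ! i else 0) \<in> borel_measurable list_borel"
    by (rule measurable_list_nth)
  have "(\<lambda>l::real list. if i < length (butlast l) then butlast l ! i else 0)
    = (\<lambda>l. if Suc i < length l then if i < length l then l ! i else 0 else 0)"
    by (auto simp: fun_eq_iff nth_butlast)
  also have "\<dots> \<in> borel_measurable list_borel" by measurable
  finally show "(\<lambda>l::real list. if i < length (butlast l) then butlast l ! i else 0) \<in> borel_measurable list_borel" .
qed simp

text \<open>The current height of a list of heights; the value 0 for the empty list is the starting height.\<close>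

definition upper :: "'a::zero list \<Rightarrow> 'a" where "upper l = last (0 # l)"

lemma upper_Nil [simp]: "upper [] = 0" and upper_snoc [simp]: "upper (l @ [x]) = x"
  by (simp_all add: upper_def)

lemma measurable_upper [measurable]: "upper \<in> borel_measurable list_borel"
proof -
  have "upper = (\<lambda>l::real list. if 0 < length l then
      (\<lambda>i l. if i < length l then l ! i else 0) (length l - 1) l else 0)"
    by (auto simp: fun_eq_iff upper_def last_conv_nth)
  also have "\<dots> \<in> borel_measurable list_borel"
    by (intro measurable_If measurable_const measurable_compose_countable[OF measurable_list_nth]) measurable
  finally show ?thesis .
qed

lemma measurable_snoc [measurable]:
  assumes [measurable]: "f \<in> M \<rightarrow>\<^sub>M list_borel" "g \<in> borel_measurable M"
  shows "(\<lambda>x. f x @ [g x]) \<in> M \<rightarrow>\<^sub>M list_borel"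
proof (rule measurable_list_borelI)
  have [measurable]: "(\<lambda>x. length (f x)) \<in> M \<rightarrow>\<^sub>M count_space UNIV"
    by (rule measurable_compose[OF assms(1) measurable_list_length])
  show "(\<lambda>x. length (f x @ [g x])) \<in> M \<rightarrow>\<^sub>M count_space UNIV" by simp measurable
  fix i
  have [measurable]: "(\<lambda>x. if i < length (f x) then f x ! i else 0) \<in> borel_measurable M"
    by (rule measurable_compose[OF assms(1) measurable_list_nth])
  have "(\<lambda>x. if i < length (f x @ [g x]) then (f x @ [g x]) ! i else 0) =
    (\<lambda>x. if i = length (f x) then g x else if i < length (f x) then f x ! i else 0)"
    by (auto simp: fun_eq_iff nth_append)
  also have "\<dots> \<in> borel_measurable M" by measurable
  finally show "(\<lambda>x. if i < length (f x @ [g x]) then (f x @ [g x]) ! i else 0) \<in> borel_measurable M" .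
qed

lemma length_takeWhile_ge_iff: 
  "n \<le> length (takeWhile P l) \<longleftrightarrow> n \<le> length l \<and> (\<forall>i<n. P (l ! i))"
proof
  assume a: "n \<le> length (takeWhile P l)"
  then have "n \<le> length l" using length_takeWhile_le order_trans by blast
  moreover have "P (l ! i)" if "i < n" for i
    using that a by (metis nth_mem order_less_le_trans set_takeWhileD takeWhile_nth)
  ultimately show "n \<le> length l \<and> (\<forall>i<n. P (l ! i))" by blast
next
  assume a: "n \<le> length l \<and> (\<forall>i<n. P (l ! i))"
  show "n \<le> length (takeWhile P l)"
    using a by (metis linorder_not_less nth_length_takeWhile order_less_le_trans)
qed

lemma measurable_takeWhile_less [measurable]:
  assumes [measurable]: "f \<in> M \<rightarrow>\<^sub>M list_borel" "g \<in> borel_measurable M"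
  shows "(\<lambda>x. takeWhile (\<lambda>z. z < g x) (f x)) \<in> M \<rightarrow>\<^sub>M list_borel"
proof (rule measurable_list_borelI)
  have [measurable]: "(\<lambda>x. length (f x)) \<in> M \<rightarrow>\<^sub>M count_space UNIV"
    by (rule measurable_compose[OF assms(1) measurable_list_length])
  have [measurable]: "(\<lambda>x. if i < length (f x) then f x ! i else 0) \<in> borel_measurable M" for i
    by (rule measurable_compose[OF assms(1) measurable_list_nth])
  have ge: "Measurable.pred M (\<lambda>x. n \<le> length (takeWhile (\<lambda>z. z < g x) (f x)))" for n
  proof -
    have "(\<lambda>x. n \<le> length (takeWhile (\<lambda>z. z < g x) (f x))) = (\<lambda>x. n \<le> length (f x) \<and>
       (\<forall>i<n. (if i < length (f x) then f x ! i else 0) < g x))"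
      by (auto simp: length_takeWhile_ge_iff fun_eq_iff)
    then show ?thesis by simp
  qed
  show *: "(\<lambda>x. length (takeWhile (\<lambda>z. z < g x) (f x))) \<in> M \<rightarrow>\<^sub>M count_space UNIV"
  proof (rule measurable_count_space_eq2_countable[THEN iffD2], safe)
    fix n
    have "(\<lambda>x. length (takeWhile (\<lambda>z. z < g x) (f x))) -` {n} \<inter> space M =
      {x \<in> space M. n \<le> length (takeWhile (\<lambda>z. z < g x) (f x)) \<and> \<not> Suc n \<le> length (takeWhile (\<lambda>z. z < g x) (f x))}"
      by auto
    also have "\<dots> \<in> sets M" using ge[of n] ge[of "Suc n"] by measurable
    finally show "(\<lambda>x. length (takeWhile (\<lambda>z. z < g x) (f x))) -` {n} \<inter> space M \<in> sets M" .
  qed auto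
  fix i
  have "(\<lambda>x. if i < length (takeWhile (\<lambda>z. z < g x) (f x)) then takeWhile (\<lambda>z. z < g x) (f x) ! i else 0) =
    (\<lambda>x. if i < length (takeWhile (\<lambda>z. z < g x) (f x)) then if i < length (f x) then f x ! i else 0 else 0)"
    by (auto simp: fun_eq_iff takeWhile_nth dest: order_less_le_trans[OF _ length_takeWhile_le])
  also have "\<dots> \<in> borel_measurable M" using * by measurable
  finally show "(\<lambda>x. if i < length (takeWhile (\<lambda>z. z < g x) (f x))
    then takeWhile (\<lambda>z. z < g x) (f x) ! i else 0) \<in> borel_measurable M" .
qed

lemma pred_mem_greaterThan [measurable (raw)]:
  fixes f g :: "'a \<Rightarrow> real"
  assumes [measurable]: "f \<in> borel_measurable M" "g \<in> borel_measurable M"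
  shows "Measurable.pred M (\<lambda>x. g x \<in> {f x<..})"
  unfolding greaterThan_iff by measurable

lemma pred_mem_lessThan [measurable (raw)]:
  fixes f g :: "'a \<Rightarrow> real"
  assumes [measurable]: "f \<in> borel_measurable M" "g \<in> borel_measurable M"
  shows "Measurable.pred M (\<lambda>x. g x \<in> {..<f x})"
  unfolding lessThan_iff by measurable

section \<open>Integration over increasing continuations\<close>

text \<open>One more entry above the last one, with intensity \<open>\<rho>\<close>. The iterate \<open>(extend \<rho> ^^ n) F l\<close> integrates
  \<open>F\<close> over all continuations of \<open>l\<close> by \<open>n\<close> increasing entries, with weight \<open>\<rho>\<close> for each of them.\<close>

definition extend :: "(real \<Rightarrow> ennreal) \<Rightarrow> (real list \<Rightarrow> ennreal) \<Rightarrow> real list \<Rightarrow> ennreal" where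
  "extend \<rho> F l = (\<integral>\<^sup>+x\<in>{upper l<..}. \<rho> x * F (l @ [x]) \<partial>lborel)"

lemma measurable_extend_param:
  assumes [measurable]: "(\<lambda>(y, x). \<rho> y x) \<in> borel_measurable (N \<Otimes>\<^sub>M borel)"
    and [measurable]: "(\<lambda>(y, l). F y l) \<in> borel_measurable (N \<Otimes>\<^sub>M list_borel)"
  shows "(\<lambda>(y, l). extend (\<rho> y) (F y) l) \<in> borel_measurable (N \<Otimes>\<^sub>M list_borel)"
  unfolding extend_def by measurable

lemma measurable_extend [measurable]:
  assumes [measurable]: "\<rho> \<in> borel_measurable borel" "F \<in> borel_measurable list_borel"
  shows "extend \<rho> F \<in> borel_measurable list_borel"
  unfolding extend_def[abs_def] by measurable

lemma measurable_extend_power_param: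
  assumes "(\<lambda>(y, x). \<rho> y x) \<in> borel_measurable (N \<Otimes>\<^sub>M borel)"
    and "(\<lambda>(y, l). F y l) \<in> borel_measurable (N \<Otimes>\<^sub>M list_borel)"
  shows "(\<lambda>(y, l). (extend (\<rho> y) ^^ n) (F y) l) \<in> borel_measurable (N \<Otimes>\<^sub>M list_borel)"
  by (induction n) (use assms measurable_extend_param in auto)

lemma measurable_extend_power_at:
  assumes "(\<lambda>(y, x). \<rho> y x) \<in> borel_measurable (N \<Otimes>\<^sub>M borel)"
    and "(\<lambda>(y, l). F y l) \<in> borel_measurable (N \<Otimes>\<^sub>M list_borel)"
  shows "(\<lambda>y. (extend (\<rho> y) ^^ n) (F y) l) \<in> borel_measurable N"
  using measurable_compose[OF measurable_Pair[OF measurable_ident measurable_const] measurable_extend_power_param[OF assms], of l]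
  by simp

lemma measurable_extend_power [measurable]:
  assumes [measurable]: "\<rho> \<in> borel_measurable borel" "F \<in> borel_measurable list_borel"
  shows "(extend \<rho> ^^ n) F \<in> borel_measurable list_borel"
  by (induction n) auto

lemma extend_mono:
  assumes "\<And>x. x > upper l \<Longrightarrow> \<rho> x \<noteq> 0 \<Longrightarrow> F (l @ [x]) \<le> G (l @ [x])"
  shows "extend \<rho> F l \<le> extend \<rho> G l"
  unfolding extend_def
proof (rule nn_integral_mono)
  fix x show "\<rho> x * F (l @ [x]) * indicator {upper l<..} x \<le> \<rho> x * G (l @ [x]) * indicator {upper l<..} x"
    using assms[of x] by (cases "\<rho> x = 0") (auto intro!: mult_left_mono split: split_indicator)
qed

lemma extend_cmult:
  assumes [measurable]: "\<rho> \<in> borel_measurable borel" "F \<in> borel_measurable list_borel"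
  shows "extend \<rho> (\<lambda>l. c * F l) l = c * extend \<rho> F l"
  unfolding extend_def
  by (subst nn_integral_cmult[symmetric]) (auto simp: algebra_simps intro!: nn_integral_cong)

lemma extend_sum:
  assumes [measurable]: "\<rho> \<in> borel_measurable borel" "\<And>i. F i \<in> borel_measurable list_borel"
  shows "extend \<rho> (\<lambda>l. \<Sum>i\<in>I. F i l) l = (\<Sum>i\<in>I. extend \<rho> (F i) l)"
  unfolding extend_def
  by (subst nn_integral_sum[symmetric]) (auto simp: sum_distrib_left sum_distrib_right intro!: nn_integral_cong)

text \<open>The series of the iterates is the least solution of \<open>u = F + extend \<rho> u\<close>. An inequality on the lists
  with \<open>upper l \<ge> a\<close> suffices because continuing a list raises its last entry.\<close>

lemma extend_power_sum_le_supersolution: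
  assumes [measurable]: "\<rho> \<in> borel_measurable borel" "F \<in> borel_measurable list_borel"
    and super: "\<And>l. upper l \<ge> a \<Longrightarrow> F l + extend \<rho> u l \<le> u l"
    and l: "upper l \<ge> a"
  shows "(\<Sum>m\<le>n. (extend \<rho> ^^ m) F l) \<le> u l"
  using l
proof (induction n arbitrary: l)
  case 0
  then show ?case using super[of l] by (auto intro: order_trans[rotated])
next
  case (Suc n)
  have "(\<Sum>m\<le>Suc n. (extend \<rho> ^^ m) F l) = F l + (\<Sum>m\<le>n. extend \<rho> ((extend \<rho> ^^ m) F) l)"
    by (simp add: sum.atMost_Suc_shift del: sum.atMost_Suc)
  also have "\<dots> = F l + extend \<rho> (\<lambda>l. \<Sum>m\<le>n. (extend \<rho> ^^ m) F l) l"
    by (subst extend_sum) auto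
  also have "\<dots> \<le> F l + extend \<rho> u l"
    using Suc by (intro add_left_mono extend_mono) auto
  also have "\<dots> \<le> u l" by (rule super[OF Suc.prems])
  finally show ?case .
qed

lemma extend_power_suminf_le_supersolution:
  assumes "\<rho> \<in> borel_measurable borel" "F \<in> borel_measurable list_borel"
    and "\<And>l. upper l \<ge> a \<Longrightarrow> F l + extend \<rho> u l \<le> u l"
    and "upper l \<ge> a"
  shows "(\<Sum>m. (extend \<rho> ^^ m) F l) \<le> u l"
  by (rule suminf_le_of_atMost) (rule extend_power_sum_le_supersolution[OF assms])

text \<open>The order of integration is reversed: the largest entry \<open>y\<close> is chosen first, and the other entries
  are then restricted to lie below it.\<close>

lemma extend_power_Fubini:
  assumes [measurable]: "\<rho> \<in> borel_measurable borel" "\<sigma> \<in> borel_measurable borel"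
    "\<Psi> \<in> borel_measurable list_borel"
  shows "(\<integral>\<^sup>+y\<in>{upper l<..}. \<sigma> y * (extend (\<lambda>x. \<rho> x * indicator {..<y} x) ^^ n) (\<lambda>l. \<Psi> (l @ [y])) l \<partial>lborel)
    = (extend \<rho> ^^ n) (extend \<sigma> \<Psi>) l"
proof (induction n arbitrary: l)
  case 0
  then show ?case by (simp add: extend_def)
next
  case (Suc n)
  define H where "H y l = (extend (\<lambda>x. \<rho> x * indicator {..<y} x) ^^ n) (\<lambda>l. \<Psi> (l @ [y])) l" for y l
  have H[measurable]: "(\<lambda>(y, l). H y l) \<in> borel_measurable (borel \<Otimes>\<^sub>M list_borel)"
    unfolding H_def
    by (rule measurable_extend_power_param) (unfold case_prod_beta, measurable)
  have [measurable]: "(\<lambda>(y, x). H y (l @ [x])) \<in> borel_measurable (borel \<Otimes>\<^sub>M borel)"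
    by measurable
  have "(\<integral>\<^sup>+y\<in>{upper l<..}. \<sigma> y * (extend (\<lambda>x. \<rho> x * indicator {..<y} x) ^^ Suc n) (\<lambda>l. \<Psi> (l @ [y])) l \<partial>lborel)
     = (\<integral>\<^sup>+y. (\<integral>\<^sup>+x. indicator {upper l<..} x * \<rho> x * (\<sigma> y * H y (l @ [x]) * indicator {x<..} y) \<partial>lborel) \<partial>lborel)"
  proof (rule nn_integral_cong)
    fix y :: real
    let ?g = "\<lambda>x. \<rho> x * indicator {..<y} x * H y (l @ [x]) * indicator {upper l<..} x"
    have "\<sigma> y * (extend (\<lambda>x. \<rho> x * indicator {..<y} x) ^^ Suc n) (\<lambda>l. \<Psi> (l @ [y])) l * indicator {upper l<..} y
      = \<sigma> y * indicator {upper l<..} y * (\<integral>\<^sup>+x. ?g x \<partial>lborel)"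
      by (simp add: extend_def[of _ _ l] H_def ac_simps)
    also have "\<dots> = (\<integral>\<^sup>+x. \<sigma> y * indicator {upper l<..} y * ?g x \<partial>lborel)"
      by (rule nn_integral_cmult[symmetric]) measurable
    also have "\<dots> = (\<integral>\<^sup>+x. indicator {upper l<..} x * \<rho> x * (\<sigma> y * H y (l @ [x]) * indicator {x<..} y) \<partial>lborel)"
      by (intro nn_integral_cong) (auto split: split_indicator simp: ac_simps)
    finally show "\<sigma> y * (extend (\<lambda>x. \<rho> x * indicator {..<y} x) ^^ Suc n) (\<lambda>l. \<Psi> (l @ [y])) l * indicator {upper l<..} y
      = (\<integral>\<^sup>+x. indicator {upper l<..} x * \<rho> x * (\<sigma> y * H y (l @ [x]) * indicator {x<..} y) \<partial>lborel)" .
  qed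
  also have "\<dots> = (\<integral>\<^sup>+x. (\<integral>\<^sup>+y. indicator {upper l<..} x * \<rho> x * (\<sigma> y * H y (l @ [x]) * indicator {x<..} y) \<partial>lborel) \<partial>lborel)"
    by (rule lborel_pair.Fubini') measurable
  also have "\<dots> = (\<integral>\<^sup>+x. indicator {upper l<..} x * \<rho> x * (\<integral>\<^sup>+y. \<sigma> y * H y (l @ [x]) * indicator {x<..} y \<partial>lborel) \<partial>lborel)"
    by (intro nn_integral_cong nn_integral_cmult) measurable
  also have "\<dots> = (\<integral>\<^sup>+x. indicator {upper l<..} x * \<rho> x * (extend \<rho> ^^ n) (extend \<sigma> \<Psi>) (l @ [x]) \<partial>lborel)"
    using Suc.IH[of "l @ [_]"] unfolding H_def by simp
  also have "\<dots> = (extend \<rho> ^^ Suc n) (extend \<sigma> \<Psi>) l"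
    by (auto simp: extend_def[of _ _ l] ac_simps intro!: nn_integral_cong)
  finally show ?case .
qed

lemma nn_integral_FTC_greaterThan:
  fixes f F :: "real \<Rightarrow> real"
  assumes "f \<in> borel_measurable borel"
    and "\<And>x. a \<le> x \<Longrightarrow> DERIV F x :> f x" "\<And>x. a \<le> x \<Longrightarrow> 0 \<le> f x"
    and "(F \<longlongrightarrow> T) at_top"
  shows "(\<integral>\<^sup>+x\<in>{a<..}. ennreal (f x) \<partial>lborel) = ennreal (T - F a)"
proof -
  have "(\<integral>\<^sup>+x\<in>{a<..}. ennreal (f x) \<partial>lborel) = (\<integral>\<^sup>+x\<in>{a..}. ennreal (f x) \<partial>lborel)"
    by (rule nn_integral_cong_AE, rule AE_mp[OF AE_lborel_singleton[of a]])
       (auto split: split_indicator)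
  also have "\<dots> = ennreal (T - F a)"
    by (rule nn_integral_FTC_atLeast) (use assms in auto)
  finally show ?thesis .
qed

lemma extend_power_cmult:
  assumes [measurable]: "\<rho> \<in> borel_measurable borel" "F \<in> borel_measurable list_borel"
  shows "(extend \<rho> ^^ n) (\<lambda>l. c * F l) = (\<lambda>l. c * (extend \<rho> ^^ n) F l)"
proof (induction n)
  case (Suc n)
  show ?case unfolding funpow.simps o_def Suc.IH by (intro ext extend_cmult) measurable
qed simp

lemma extend_power_Suc_right: "(extend \<rho> ^^ Suc n) F = (extend \<rho> ^^ n) (extend \<rho> F)"
  by (simp add: funpow_swap1)

lemma extend_power_nn_integral:
  assumes [measurable]: "\<rho> \<in> borel_measurable borel"
    "(\<lambda>(y, l). H y l) \<in> borel_measurable (lborel \<Otimes>\<^sub>M list_borel)"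
  shows "(extend \<rho> ^^ n) (\<lambda>l. \<integral>\<^sup>+y. H y l \<partial>lborel) l = (\<integral>\<^sup>+y. (extend \<rho> ^^ n) (H y) l \<partial>lborel)"
proof (induction n arbitrary: l)
  case 0 then show ?case by simp
next
  case (Suc n)
  have [measurable]: "(\<lambda>(y, l). (extend \<rho> ^^ n) (H y) l) \<in> borel_measurable (lborel \<Otimes>\<^sub>M list_borel)"
    by (rule measurable_extend_power_param) measurable
  have m[measurable]: "(\<lambda>(x, y). (extend \<rho> ^^ n) (H y) (l @ [x])) \<in> borel_measurable (borel \<Otimes>\<^sub>M borel)" for l
    by measurable
  have "(extend \<rho> ^^ Suc n) (\<lambda>l. \<integral>\<^sup>+y. H y l \<partial>lborel) l =
     (\<integral>\<^sup>+x. (\<integral>\<^sup>+y. \<rho> x * indicator {upper l<..} x * (extend \<rho> ^^ n) (H y) (l @ [x]) \<partial>lborel) \<partial>lborel)"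
    unfolding funpow.simps o_def extend_def[of _ _ l] Suc.IH
    by (subst nn_integral_cmult) (auto simp: ac_simps)
  also have "\<dots> = (\<integral>\<^sup>+y. (\<integral>\<^sup>+x. \<rho> x * indicator {upper l<..} x * (extend \<rho> ^^ n) (H y) (l @ [x]) \<partial>lborel) \<partial>lborel)"
    by (rule lborel_pair.Fubini'[symmetric]) measurable
  also have "\<dots> = (\<integral>\<^sup>+y. (extend \<rho> ^^ Suc n) (H y) l \<partial>lborel)"
    unfolding funpow.simps o_def extend_def[of _ _ l] by (auto simp: ac_simps intro!: nn_integral_cong)
  finally show ?case .
qed

section \<open>Density of the ladder indices\<close>

text \<open>The exponent is the integral of the total rate \<open>\<mu> + s\<close> over \<open>0 \<le> s \<le> v\<close>: this is the probability of
  climbing from height 0 to height \<open>v\<close> without a jump and without being killed.\<close>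

definition survival :: "real \<Rightarrow> real \<Rightarrow> real" where
  "survival \<mu> v = exp (- \<mu> * v - v\<^sup>2 / 2)"

definition tail :: "real \<Rightarrow> real \<Rightarrow> ennreal" where
  "tail \<mu> x = (\<integral>\<^sup>+v\<in>{x<..}. ennreal (survival \<mu> v) \<partial>lborel)"

definition rate :: "real \<Rightarrow> real \<Rightarrow> ennreal" where
  "rate \<mu> x = ennreal (1 / (\<mu> + x))"

abbreviation "rate_below \<mu> y \<equiv> (\<lambda>x. rate \<mu> x * indicator {..<y} x)"

lemma survival_pos [simp]: "survival \<mu> v > 0" and survival_nonneg [simp]: "survival \<mu> v \<ge> 0"
  and survival_0 [simp]: "survival \<mu> 0 = 1"
  by (simp_all add: survival_def)

lemma measurable_survival [measurable]: "survival \<mu> \<in> borel_measurable borel"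
  unfolding survival_def[abs_def] by measurable

lemma measurable_rate [measurable]: "rate \<mu> \<in> borel_measurable borel"
  unfolding rate_def[abs_def] by measurable

lemma measurable_tail [measurable]: "tail \<mu> \<in> borel_measurable borel"
  unfolding tail_def[abs_def] by measurable

lemma survival_deriv:
  "(survival \<mu> has_real_derivative - ((\<mu> + v) * survival \<mu> v)) (at v)"
  unfolding survival_def[abs_def]
  by (auto intro!: derivative_eq_intros simp: algebra_simps)

lemma survival_le_exp: "survival \<mu> v \<le> exp (- \<mu> * v)"
  by (simp add: survival_def)

lemma exp_minus_tendsto: "\<mu> > 0 \<Longrightarrow> ((\<lambda>v::real. exp (- \<mu> * v)) \<longlongrightarrow> 0) at_top"
  by real_asymp

lemma survival_tendsto:
  assumes "\<mu> > 0" shows "(survival \<mu> \<longlongrightarrow> 0) at_top"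
  by (rule tendsto_sandwich[OF _ _ tendsto_const exp_minus_tendsto[OF assms]];
      intro always_eventually allI survival_le_exp survival_nonneg)

lemma survival_div_tendsto:
  assumes "\<mu> > 0" shows "((\<lambda>v. survival \<mu> v / (\<mu> + v)) \<longlongrightarrow> 0) at_top"
proof -
  have "((\<lambda>v. inverse (\<mu> + v)) \<longlongrightarrow> 0) at_top" by real_asymp
  from tendsto_mult[OF survival_tendsto[OF assms] this] show ?thesis
    by (simp add: divide_inverse)
qed

lemma nn_integral_survival_density:
  assumes "\<mu> > 0" "a \<ge> 0"
  shows "(\<integral>\<^sup>+v\<in>{a<..}. ennreal ((\<mu> + v) * survival \<mu> v) \<partial>lborel) = ennreal (survival \<mu> a)"
proof -
  have "(\<integral>\<^sup>+v\<in>{a<..}. ennreal ((\<mu> + v) * survival \<mu> v) \<partial>lborel) = ennreal (- 0 - (- survival \<mu> a))"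
    by (rule nn_integral_FTC_greaterThan)
       (use assms tendsto_minus[OF survival_tendsto[OF assms(1)]] in
         \<open>auto intro!: derivative_eq_intros survival_deriv\<close>)
  then show ?thesis by simp
qed

text \<open>The function \<open>x \<mapsto> - survival \<mu> x / (\<mu> + x)\<close> has derivative
  \<open>survival \<mu> x + survival \<mu> x / (\<mu> + x)\<^sup>2\<close>. This is the identity that makes the density
  \<open>1 / (\<mu> + x)\<close> of ladder indices stationary.\<close>

lemma tail_plus:
  assumes "\<mu> > 0" "a \<ge> 0"
  shows "tail \<mu> a + (\<integral>\<^sup>+x\<in>{a<..}. rate \<mu> x * ennreal (survival \<mu> x / (\<mu> + x)) \<partial>lborel)
    = ennreal (survival \<mu> a / (\<mu> + a))"
proof -
  have "tail \<mu> a + (\<integral>\<^sup>+x\<in>{a<..}. rate \<mu> x * ennreal (survival \<mu> x / (\<mu> + x)) \<partial>lborel)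
    = (\<integral>\<^sup>+x\<in>{a<..}. ennreal (survival \<mu> x + survival \<mu> x / (\<mu> + x)\<^sup>2) \<partial>lborel)"
    unfolding tail_def rate_def using assms
    by (subst nn_integral_add[symmetric])
       (auto intro!: nn_integral_cong simp: ennreal_mult'[symmetric] ennreal_plus[symmetric] power2_eq_square
         simp del: ennreal_plus split: split_indicator)
  also have "\<dots> = ennreal (- 0 - (- (survival \<mu> a / (\<mu> + a))))"
  proof (rule nn_integral_FTC_greaterThan)
    fix x assume "a \<le> x"
    then have x: "\<mu> + x > 0" using assms by simp
    have eq: "- ((- (c * s) * c - s * 1) / (c * c)) = s + s / c\<^sup>2" if "c > 0" for c s :: real
      using that by (simp add: field_simps power2_eq_square)
    show "((\<lambda>x. - (survival \<mu> x / (\<mu> + x))) has_real_derivative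
         survival \<mu> x + survival \<mu> x / (\<mu> + x)\<^sup>2) (at x)"
      unfolding eq[OF x, symmetric]
      by (intro DERIV_minus DERIV_divide survival_deriv) (use x in \<open>auto intro!: derivative_eq_intros\<close>)
  next
    show "((\<lambda>x. - (survival \<mu> x / (\<mu> + x))) \<longlongrightarrow> - 0) at_top"
      by (intro tendsto_minus survival_div_tendsto assms)
  qed (use assms in auto)
  finally show ?thesis by simp
qed

text \<open>By \<open>tail_plus\<close> the right side solves the fixed point equation of the series.\<close>

lemma suminf_extend_power_tail_le:
  assumes "\<mu> > 0" "upper l \<ge> 0"
  shows "(\<Sum>m. (extend (rate \<mu>) ^^ m) (\<lambda>l. tail \<mu> (upper l)) l) \<le> ennreal (survival \<mu> (upper l) / (\<mu> + upper l))"
  by (rule extend_power_suminf_le_supersolution[where a = 0 and u = "\<lambda>l. ennreal (survival \<mu> (upper l) / (\<mu> + upper l))"])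
     (use assms tail_plus[of \<mu>] in \<open>auto simp: extend_def\<close>)

lemma sum_extend_power_tail_le:
  assumes "\<mu> > 0" "upper l \<ge> 0"
  shows "(\<Sum>m\<le>n. (extend (rate \<mu>) ^^ m) (\<lambda>l. tail \<mu> (upper l)) l) \<le> ennreal (survival \<mu> (upper l) / (\<mu> + upper l))"
  by (rule extend_power_sum_le_supersolution[where a = 0 and u = "\<lambda>l. ennreal (survival \<mu> (upper l) / (\<mu> + upper l))"])
     (use assms tail_plus[of \<mu>] in \<open>auto simp: extend_def\<close>)

text \<open>The total mass of the Green function, that is, one plus the expected number of jumps before the
  killing time; its finiteness excludes that infinitely many jumps occur before that time.\<close>

lemma suminf_extend_power_survival_finite:
  assumes "\<mu> > 0"
  shows "(\<Sum>m. (extend (rate \<mu>) ^^ m) (\<lambda>l. ennreal (survival \<mu> (upper l))) []) < \<infinity>"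
proof -
  \<comment> \<open>A supersolution for the larger weight \<open>exp (- \<mu> a)\<close>: the derivative of
      \<open>- exp (- \<mu> a) / (\<mu> (\<mu> + a))\<close> is \<open>?u a / (\<mu> + a)\<close>.\<close>
  let ?u = "\<lambda>a. exp (- \<mu> * a) + exp (- \<mu> * a) / (\<mu> * (\<mu> + a))"
  have "(\<Sum>m. (extend (rate \<mu>) ^^ m) (\<lambda>l. ennreal (survival \<mu> (upper l))) []) \<le> ennreal (?u (upper []))"
  proof (rule extend_power_suminf_le_supersolution[where a = 0])
    fix l :: "real list" assume l: "0 \<le> upper l"
    have "extend (rate \<mu>) (\<lambda>l. ennreal (?u (upper l))) l
        = (\<integral>\<^sup>+x\<in>{upper l<..}. ennreal (?u x / (\<mu> + x)) \<partial>lborel)"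
      unfolding extend_def using assms l
      by (intro nn_integral_cong) (auto simp: rate_def ennreal_mult'[symmetric] simp del: ennreal_plus split: split_indicator)
    also have "\<dots> = ennreal (- 0 - (- (exp (- \<mu> * upper l) / (\<mu> * (\<mu> + upper l)))))"
    proof (rule nn_integral_FTC_greaterThan)
      fix x assume "upper l \<le> x"
      then have x: "\<mu> + x > 0" using assms l by simp
      have eq: "- ((e * - \<mu> * (\<mu> * c) - e * \<mu>) / (\<mu> * c * (\<mu> * c))) = (e + e / (\<mu> * c)) / c"
        if "c > 0" for c e :: real
        using that assms by (simp add: field_simps)
      show "((\<lambda>x. - (exp (- \<mu> * x) / (\<mu> * (\<mu> + x)))) has_real_derivative ?u x / (\<mu> + x)) (at x)"
        unfolding eq[OF x, symmetric]
        by (intro DERIV_minus DERIV_divide) (use x assms in \<open>auto intro!: derivative_eq_intros\<close>)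
      show "0 \<le> ?u x / (\<mu> + x)" using x assms by simp
    next
      have "((\<lambda>v. inverse (\<mu> * (\<mu> + v))) \<longlongrightarrow> 0) at_top" using assms by real_asymp
      from tendsto_mult[OF exp_minus_tendsto[OF assms] this]
      show "((\<lambda>x. - (exp (- \<mu> * x) / (\<mu> * (\<mu> + x)))) \<longlongrightarrow> - 0) at_top"
        by (intro tendsto_minus) (simp add: divide_inverse)
    qed simp
    finally show "ennreal (survival \<mu> (upper l)) + extend (rate \<mu>) (\<lambda>l. ennreal (?u (upper l))) l \<le> ennreal (?u (upper l))"
      using survival_le_exp[of \<mu> "upper l"] assms l
      by (auto simp: ennreal_plus[symmetric] simp del: ennreal_plus intro!: ennreal_leI)
  qed auto
  then show ?thesis by (rule order.strict_trans1) simp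
qed

text \<open>The sum is the partition function of a Poisson process of rate \<open>1 / (\<mu> + x)\<close> on \<open>(0, v)\<close>, which is
  the exponential of the total intensity \<open>ln ((\<mu> + v) / \<mu>)\<close>. The supersolution is the same quantity
  for the interval \<open>(a, v)\<close>.\<close>

lemma suminf_extend_below_le:
  assumes "\<mu> > 0" "v > 0"
  shows "(\<Sum>m. (extend (rate_below \<mu> v) ^^ m) (\<lambda>_. 1) []) \<le> ennreal ((\<mu> + v) / \<mu>)"
proof -
  let ?u = "\<lambda>a. if a < v then (\<mu> + v) / (\<mu> + a) else 1"
  have "(\<Sum>m. (extend (rate_below \<mu> v) ^^ m) (\<lambda>_. 1) []) \<le> ennreal (?u (upper []))"
  proof (rule extend_power_suminf_le_supersolution[where a = 0])
    fix l :: "real list" assume l: "0 \<le> upper l"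
    show "1 + extend (rate_below \<mu> v) (\<lambda>l. ennreal (?u (upper l))) l \<le> ennreal (?u (upper l))"
    proof (cases "upper l < v")
      case True
      have "extend (rate_below \<mu> v) (\<lambda>l. ennreal (?u (upper l))) l
        \<le> (\<integral>\<^sup>+x. ennreal ((\<mu> + v) / (\<mu> + x)\<^sup>2) * indicator {upper l..v} x \<partial>lborel)"
        unfolding extend_def using assms l
        by (intro nn_integral_mono)
           (auto simp: rate_def ennreal_mult'[symmetric] power2_eq_square simp del: ennreal_plus split: split_indicator)
      also have "\<dots> = ennreal (- ((\<mu> + v) / (\<mu> + v)) - (- ((\<mu> + v) / (\<mu> + upper l))))"
      proof (rule nn_integral_FTC_Icc)
        fix x assume "x \<in> {upper l..v}"
        then have x: "\<mu> + x > 0" using assms l by simp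
        have eq: "- ((0 * c - d * 1) / (c * c)) = d / c\<^sup>2" for c d :: real
          by (simp add: power2_eq_square)
        show "((\<lambda>x. - ((\<mu> + v) / (\<mu> + x))) has_real_derivative (\<mu> + v) / (\<mu> + x)\<^sup>2) (at x)"
          unfolding eq[symmetric]
          by (intro DERIV_minus DERIV_divide) (use x in \<open>auto intro!: derivative_eq_intros\<close>)
        show "0 \<le> (\<mu> + v) / (\<mu> + x)\<^sup>2" using assms by simp
      qed (use True in auto)
      also have "\<dots> = ennreal ((\<mu> + v) / (\<mu> + upper l) - 1)"
        using assms by (simp add: field_simps)
      finally have "1 + extend (rate_below \<mu> v) (\<lambda>l. ennreal (?u (upper l))) l
        \<le> ennreal 1 + ennreal ((\<mu> + v) / (\<mu> + upper l) - 1)"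
        by (simp add: add_left_mono)
      also have "\<dots> = ennreal ((\<mu> + v) / (\<mu> + upper l))"
        using True assms l by (subst ennreal_plus[symmetric]) auto
      finally show ?thesis using True by simp
    next
      case False
      then have "extend (rate_below \<mu> v) (\<lambda>l. ennreal (?u (upper l))) l = 0"
        unfolding extend_def by (subst nn_integral_0_iff_AE) (auto split: split_indicator)
      then show ?thesis using False by simp
    qed
  qed auto
  then show ?thesis using assms by simp
qed

section \<open>The Green function of the list of ladder indices\<close>

abbreviation "cut_snoc l y \<equiv> takeWhile (\<lambda>z. z < y) l @ [y]"

text \<open>The expectation of \<open>F\<close> after the next jump, on the event that the process is not killed before. The
  height \<open>v\<close> reached from \<open>upper l\<close> has density \<open>v * survival \<mu> v / survival \<mu> (upper l)\<close> on this
  event, and the jump goes to a uniform \<open>y < v\<close>; the factor \<open>v\<close> cancels against the uniform density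
  \<open>1 / v\<close>, and the integral over \<open>v\<close> leaves the tail beyond both \<open>upper l\<close> and \<open>y\<close>.\<close>

definition jump_operator :: "real \<Rightarrow> (real list \<Rightarrow> ennreal) \<Rightarrow> real list \<Rightarrow> ennreal" where
  "jump_operator \<mu> F l =
     (\<integral>\<^sup>+y\<in>{0<..}. tail \<mu> (max (upper l) y) * F (cut_snoc l y) \<partial>lborel)
       / ennreal (survival \<mu> (upper l))"

text \<open>The occupation functional of the chain of lists of ladder indices, observed immediately after its
  jumps and at time 0. The last entry of a list is the height at that moment.\<close>

definition Green :: "real \<Rightarrow> (real list \<Rightarrow> ennreal) \<Rightarrow> ennreal" where
  "Green \<mu> F = (\<Sum>n. (extend (rate \<mu>) ^^ n) (\<lambda>l. ennreal (survival \<mu> (upper l)) * F l) [])"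

lemma measurable_jump_operator [measurable]:
  assumes [measurable]: "F \<in> borel_measurable list_borel"
  shows "jump_operator \<mu> F \<in> borel_measurable list_borel"
  unfolding jump_operator_def[abs_def] by measurable

lemma extend_split:
  assumes [measurable]: "\<rho> \<in> borel_measurable borel" "F \<in> borel_measurable list_borel"
    and "upper l < y"
  shows "extend \<rho> F l = extend (\<lambda>x. \<rho> x * indicator {..<y} x) F l + (\<integral>\<^sup>+x\<in>{y<..}. \<rho> x * F (l @ [x]) \<partial>lborel)"
proof -
  have "extend (\<lambda>x. \<rho> x * indicator {..<y} x) F l + (\<integral>\<^sup>+x\<in>{y<..}. \<rho> x * F (l @ [x]) \<partial>lborel)
    = (\<integral>\<^sup>+x. \<rho> x * indicator {..<y} x * F (l @ [x]) * indicator {upper l<..} x + \<rho> x * F (l @ [x]) * indicator {y<..} x \<partial>lborel)"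
    unfolding extend_def by (rule nn_integral_add[symmetric]) measurable
  also have "\<dots> = extend \<rho> F l"
    unfolding extend_def
    by (rule nn_integral_cong_AE, rule AE_mp[OF AE_lborel_singleton[of y]])
       (use assms(3) in \<open>auto split: split_indicator\<close>)
  finally show ?thesis by simp
qed

lemma takeWhile_snoc_stop:
  "takeWhile P l \<noteq> l \<Longrightarrow> takeWhile P (l @ l') = takeWhile P l"
  by (metis takeWhile_append takeWhile_eq_all_conv)

text \<open>Once the list has an entry at or above \<open>y\<close>, further entries do not change the part below \<open>y\<close>.\<close>

lemma extend_power_above:
  fixes \<rho> :: "real \<Rightarrow> ennreal"
  assumes [measurable]: "\<rho> \<in> borel_measurable borel" "F \<in> borel_measurable list_borel"
    "h \<in> borel_measurable borel"
    and "takeWhile (\<lambda>z. z < y) l \<noteq> l" "y \<le> upper l"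
  shows "(extend \<rho> ^^ m) (\<lambda>l. h (max (upper l) y) * F (cut_snoc l y)) l
    = F (cut_snoc l y) * (extend \<rho> ^^ m) (\<lambda>l. h (upper l)) l"
  using assms(4,5)
proof (induction m arbitrary: l)
  case 0 then show ?case by (simp add: max_absorb1 mult.commute)
next
  case (Suc m)
  let ?c = "F (cut_snoc l y)"
  have "(extend \<rho> ^^ Suc m) (\<lambda>l. h (max (upper l) y) * F (cut_snoc l y)) l
     = extend \<rho> (\<lambda>l. ?c * (extend \<rho> ^^ m) (\<lambda>l. h (upper l)) l) l"
    unfolding funpow.simps o_def extend_def[of _ _ l]
  proof (intro nn_integral_cong, goal_cases)
    case (1 x)
    show ?case
    proof (cases "x > upper l")
      case True
      have "takeWhile (\<lambda>z. z < y) (l @ [x]) \<noteq> l @ [x]"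
        using Suc.prems True by (auto simp: takeWhile_eq_all_conv)
      moreover have "takeWhile (\<lambda>z. z < y) (l @ [x]) = takeWhile (\<lambda>z. z < y) l"
        by (rule takeWhile_snoc_stop) (use Suc.prems in auto)
      ultimately show ?thesis
        using Suc.IH[of "l @ [x]"] Suc.prems(2) True by simp
    qed simp
  qed
  also have "\<dots> = ?c * (extend \<rho> ^^ Suc m) (\<lambda>l. h (upper l)) l"
    by (subst extend_cmult) auto
  finally show ?case .
qed

text \<open>Start from a list below \<open>y\<close>. The next entry either stays below \<open>y\<close>, where the induction hypothesis
  applies, or passes \<open>y\<close>; then \<open>F\<close> is constant, and the mass of all further continuations is summed
  up by \<open>sum_extend_power_tail_le\<close>. With the term of \<open>l\<close> itself this mass adds up to
  \<open>survival \<mu> y / (\<mu> + y)\<close>, by \<open>tail_plus\<close>.\<close>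

lemma sum_extend_power_jump_le:
  assumes \<mu>: "\<mu> > 0" and [measurable]: "F \<in> borel_measurable list_borel"
    and "\<forall>x\<in>set l. x < y" "0 \<le> upper l" "0 < y"
  shows "(\<Sum>m\<le>n. (extend (rate \<mu>) ^^ m) (\<lambda>l. tail \<mu> (max (upper l) y) * F (cut_snoc l y)) l)
    \<le> (\<Sum>m\<le>n. (extend (rate_below \<mu> y) ^^ m)
          (\<lambda>l. ennreal (survival \<mu> y / (\<mu> + y)) * F (l @ [y])) l)"
  using assms(3,4)
proof (induction n arbitrary: l)
  case 0
  have "upper l < y" using 0 assms(5) by (auto simp: upper_def split: if_splits)
  moreover have "takeWhile (\<lambda>z. z < y) l = l" using 0 by (simp add: takeWhile_eq_all_conv)
  moreover have "tail \<mu> y \<le> ennreal (survival \<mu> y / (\<mu> + y))"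
    using tail_plus[OF \<mu>, of y] assms(5) by (metis le_iff_add less_imp_le)
  ultimately show ?case by (auto simp: max_absorb2 simp del: takeWhile_eq_all_conv intro!: mult_right_mono)
next
  case (Suc n)
  define \<Phi> where "\<Phi> = (\<lambda>l. tail \<mu> (max (upper l) y) * F (cut_snoc l y))"
  define \<Psi> where "\<Psi> = (\<lambda>l. ennreal (survival \<mu> y / (\<mu> + y)) * F (l @ [y]))"
  define S where "S l = (\<Sum>m\<le>n. (extend (rate \<mu>) ^^ m) \<Phi> l)" for l
  define \<rho>' where "\<rho>' = rate_below \<mu> y"
  have [measurable]: "\<Phi> \<in> borel_measurable list_borel" "\<Psi> \<in> borel_measurable list_borel" "\<rho>' \<in> borel_measurable borel"
    unfolding \<Phi>_def \<Psi>_def \<rho>'_def by measurable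
  have [measurable]: "S \<in> borel_measurable list_borel"
    unfolding S_def[abs_def] by measurable
  have ul: "upper l < y" using Suc.prems assms(5) by (auto simp: upper_def split: if_splits)
  have tl: "takeWhile (\<lambda>z. z < y) l = l" using Suc.prems by (simp add: takeWhile_eq_all_conv)
  have "(\<Sum>m\<le>Suc n. (extend (rate \<mu>) ^^ m) \<Phi> l) = \<Phi> l + extend (rate \<mu>) S l"
    unfolding S_def by (subst extend_sum) (auto simp: sum.atMost_Suc_shift simp del: sum.atMost_Suc)
  also have "extend (rate \<mu>) S l = extend \<rho>' S l + (\<integral>\<^sup>+x\<in>{y<..}. rate \<mu> x * S (l @ [x]) \<partial>lborel)"
    unfolding \<rho>'_def by (rule extend_split) (use ul in auto)
  also have "(\<integral>\<^sup>+x\<in>{y<..}. rate \<mu> x * S (l @ [x]) \<partial>lborel)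
    \<le> (\<integral>\<^sup>+x. F (l @ [y]) * (rate \<mu> x * ennreal (survival \<mu> x / (\<mu> + x)) * indicator {y<..} x) \<partial>lborel)"
  proof (rule nn_integral_mono)
    fix x
    show "rate \<mu> x * S (l @ [x]) * indicator {y<..} x
      \<le> F (l @ [y]) * (rate \<mu> x * ennreal (survival \<mu> x / (\<mu> + x)) * indicator {y<..} x)"
    proof (cases "x > y")
      case True
      have tx: "takeWhile (\<lambda>z. z < y) (l @ [x]) = l" using Suc.prems True
        by (simp add: takeWhile_tail tl)
      have "S (l @ [x]) = F (l @ [y]) * (\<Sum>m\<le>n. (extend (rate \<mu>) ^^ m) (\<lambda>l. tail \<mu> (upper l)) (l @ [x]))"
        unfolding S_def \<Phi>_def using True tx
        by (subst extend_power_above) (auto simp: sum_distrib_left)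
      also have "\<dots> \<le> F (l @ [y]) * ennreal (survival \<mu> x / (\<mu> + x))"
        using sum_extend_power_tail_le[OF \<mu>, of "l @ [x]" n] True assms(5)
        by (intro mult_left_mono) auto
      finally show ?thesis using True by (simp add: ac_simps mult_left_mono)
    qed simp
  qed
  also have "\<dots> = F (l @ [y]) * (\<integral>\<^sup>+x\<in>{y<..}. rate \<mu> x * ennreal (survival \<mu> x / (\<mu> + x)) \<partial>lborel)"
    by (rule nn_integral_cmult) measurable
  also have "\<Phi> l = F (l @ [y]) * tail \<mu> y"
    unfolding \<Phi>_def tl using ul by (simp add: max_absorb2 mult.commute)
  also have "F (l @ [y]) * tail \<mu> y + (extend \<rho>' S l + F (l @ [y]) * (\<integral>\<^sup>+x\<in>{y<..}. rate \<mu> x * ennreal (survival \<mu> x / (\<mu> + x)) \<partial>lborel))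
     = extend \<rho>' S l + F (l @ [y]) * (tail \<mu> y + (\<integral>\<^sup>+x\<in>{y<..}. rate \<mu> x * ennreal (survival \<mu> x / (\<mu> + x)) \<partial>lborel))"
    by (simp add: algebra_simps)
  also have "\<dots> = extend \<rho>' S l + \<Psi> l"
    using tail_plus[OF \<mu>, of y] assms(5) by (simp add: \<Psi>_def mult.commute)
  also have "extend \<rho>' S l \<le> extend \<rho>' (\<lambda>l. \<Sum>m\<le>n. (extend \<rho>' ^^ m) \<Psi> l) l"
  proof (rule extend_mono)
    fix x assume "upper l < x" "\<rho>' x \<noteq> 0"
    moreover from this have "x < y" by (auto simp: \<rho>'_def split: split_indicator_asm)
    ultimately show "S (l @ [x]) \<le> (\<Sum>m\<le>n. (extend \<rho>' ^^ m) \<Psi> (l @ [x]))"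
      using Suc.IH[of "l @ [x]"] Suc.prems unfolding S_def \<Phi>_def \<Psi>_def \<rho>'_def by auto
  qed
  also have "extend \<rho>' (\<lambda>l. \<Sum>m\<le>n. (extend \<rho>' ^^ m) \<Psi> l) l + \<Psi> l = (\<Sum>m\<le>Suc n. (extend \<rho>' ^^ m) \<Psi> l)"
    by (subst extend_sum) (auto simp: sum.atMost_Suc_shift add.commute simp del: sum.atMost_Suc)
  finally show ?case unfolding \<Phi>_def \<Psi>_def \<rho>'_def
    by (simp add: add_left_mono add_right_mono)
qed

lemma suminf_extend_power_jump_le:
  assumes "\<mu> > 0" and [measurable]: "F \<in> borel_measurable list_borel" and "0 < y"
  shows "(\<Sum>m. (extend (rate \<mu>) ^^ m) (\<lambda>l. tail \<mu> (max (upper l) y) * F (cut_snoc l y)) [])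
    \<le> (\<Sum>m. ennreal (survival \<mu> y / (\<mu> + y)) * (extend (rate_below \<mu> y) ^^ m) (\<lambda>l. F (l @ [y])) [])"
    (is "(\<Sum>m. ?a m) \<le> (\<Sum>m. ?b m)")
proof (rule suminf_le_of_atMost)
  fix n
  have "(\<Sum>m\<le>n. ?a m) \<le> (\<Sum>m\<le>n. ?b m)"
    using sum_extend_power_jump_le[OF assms(1,2), of "[]" y n] assms(3)
    by (subst (asm) extend_power_cmult) auto
  also have "\<dots> \<le> (\<Sum>m. ?b m)" by (rule sum_le_suminf) auto
  finally show "(\<Sum>m\<le>n. ?a m) \<le> (\<Sum>m. ?b m)" .
qed

text \<open>A jump to \<open>y\<close> leads to a list whose last entry is \<open>y\<close>. By \<open>sum_extend_power_jump_le\<close> the lists from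
  which such a jump is possible carry together the mass \<open>survival \<mu> y / (\<mu> + y)\<close> over each list
  below \<open>y\<close>, and this is the Green density of the list with \<open>y\<close> appended. The term \<open>F []\<close> accounts
  for the start in the empty list.\<close>

lemma Green_jump_operator_le:
  assumes \<mu>: "\<mu> > 0" and [measurable]: "F \<in> borel_measurable list_borel"
  shows "F [] + Green \<mu> (jump_operator \<mu> F) \<le> Green \<mu> F"
proof -
  define \<Phi> where "\<Phi> y l = tail \<mu> (max (upper l) y) * F (cut_snoc l y)" for y l
  have [measurable]: "(\<lambda>(y, l). \<Phi> y l) \<in> borel_measurable (borel \<Otimes>\<^sub>M list_borel)"
    unfolding \<Phi>_def case_prod_beta by measurable
  have [measurable]: "\<Phi> y \<in> borel_measurable list_borel" for y
    unfolding \<Phi>_def[abs_def] by measurable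
  define \<sigma> where "\<sigma> y = ennreal (survival \<mu> y / (\<mu> + y))" for y
  have [measurable]: "\<sigma> \<in> borel_measurable borel" unfolding \<sigma>_def[abs_def] by measurable
  have [measurable]: "(\<lambda>y. (extend (rate_below \<mu> y) ^^ m) (\<lambda>l. F (l @ [y])) []) \<in> borel_measurable borel" for m
    by (rule measurable_extend_power_at) (unfold case_prod_beta, measurable)
  have [measurable]: "(\<lambda>y. (extend (rate \<mu>) ^^ m) (\<Phi> y) []) \<in> borel_measurable borel" for m
    by (rule measurable_extend_power_at) measurable
  have K: "ennreal (survival \<mu> (upper l)) * jump_operator \<mu> F l = (\<integral>\<^sup>+y. indicator {0<..} y * \<Phi> y l \<partial>lborel)" for l
    unfolding jump_operator_def \<Phi>_def
    by (subst ennreal_mult_divide_cancel) (auto simp: mult.commute survival_pos[THEN less_imp_neq, symmetric])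
  have "Green \<mu> (jump_operator \<mu> F) = (\<Sum>n. \<integral>\<^sup>+y. (extend (rate \<mu>) ^^ n) (\<lambda>l. indicator {0<..} y * \<Phi> y l) [] \<partial>lborel)"
    unfolding Green_def K by (subst extend_power_nn_integral) (auto simp: case_prod_beta)
  also have "\<dots> = (\<Sum>n. \<integral>\<^sup>+y. indicator {0<..} y * (extend (rate \<mu>) ^^ n) (\<Phi> y) [] \<partial>lborel)"
    by (subst extend_power_cmult) auto
  also have "\<dots> = (\<integral>\<^sup>+y. (\<Sum>n. indicator {0<..} y * (extend (rate \<mu>) ^^ n) (\<Phi> y) []) \<partial>lborel)"
    by (rule nn_integral_suminf[symmetric]) measurable
  also have "\<dots> \<le> (\<integral>\<^sup>+y. (\<Sum>n. \<sigma> y * (extend (rate_below \<mu> y) ^^ n) (\<lambda>l. F (l @ [y])) [] * indicator {0<..} y) \<partial>lborel)"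
  proof (rule nn_integral_mono)
    fix y :: real
    show "(\<Sum>n. indicator {0<..} y * (extend (rate \<mu>) ^^ n) (\<Phi> y) [])
      \<le> (\<Sum>n. \<sigma> y * (extend (rate_below \<mu> y) ^^ n) (\<lambda>l. F (l @ [y])) [] * indicator {0<..} y)"
      using suminf_extend_power_jump_le[OF \<mu> assms(2), of y]
      by (cases "y > 0") (auto simp: \<Phi>_def[abs_def] \<sigma>_def)
  qed
  also have "\<dots> = (\<Sum>n. \<integral>\<^sup>+y. \<sigma> y * (extend (rate_below \<mu> y) ^^ n) (\<lambda>l. F (l @ [y])) [] * indicator {0<..} y \<partial>lborel)"
    by (rule nn_integral_suminf) measurable
  also have "\<dots> = (\<Sum>n. (extend (rate \<mu>) ^^ n) (extend \<sigma> F) [])"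
    using extend_power_Fubini[where \<rho> = "rate \<mu>" and \<sigma> = \<sigma> and \<Psi> = F and l = "[]"] by simp
  also have "extend \<sigma> F = extend (rate \<mu>) (\<lambda>l. ennreal (survival \<mu> (upper l)) * F l)"
    unfolding extend_def \<sigma>_def rate_def
    by (auto simp: fun_eq_iff ennreal_mult''[symmetric] mult.assoc[symmetric])
  also have "(\<Sum>n. (extend (rate \<mu>) ^^ n) (extend (rate \<mu>) (\<lambda>l. ennreal (survival \<mu> (upper l)) * F l)) [])
     = (\<Sum>n. (extend (rate \<mu>) ^^ (Suc n)) (\<lambda>l. ennreal (survival \<mu> (upper l)) * F l) [])"
    by (simp only: extend_power_Suc_right)
  finally have "F [] + Green \<mu> (jump_operator \<mu> F) \<le> F [] + \<dots>" by (rule add_left_mono)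
  also have "\<dots> = Green \<mu> F"
    unfolding Green_def
    by (subst suminf_offset[of "\<lambda>n. (extend (rate \<mu>) ^^ n) _ []" 1]) auto
  finally show ?thesis .
qed

text \<open>The joint law of the ladder indices, followed by the height, at the killing time: the last entry is
  the height, and it carries the killing rate \<open>\<mu>\<close> instead of the intensity of ladder indices.\<close>

definition ladder_law :: "real \<Rightarrow> (real list \<Rightarrow> ennreal) \<Rightarrow> ennreal" where
  "ladder_law \<mu> F = (\<Sum>n. (extend (rate \<mu>) ^^ n)
     (extend (\<lambda>_. ennreal \<mu>) (\<lambda>l. ennreal (survival \<mu> (upper l)) * F l)) [])"

text \<open>Given the height \<open>r\<close>, the ladder indices have the law of Poisson points below \<open>r\<close>, up to
  normalization.\<close>

lemma ladder_law_disintegration: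
  assumes [measurable]: "h \<in> borel_measurable borel" "F \<in> borel_measurable list_borel"
  shows "ladder_law \<mu> (\<lambda>l. h (upper l) * F (butlast l)) = (\<integral>\<^sup>+r\<in>{0<..}. ennreal \<mu> * ennreal (survival \<mu> r) * h r *
     (\<Sum>n. (extend (rate_below \<mu> r) ^^ n) F []) \<partial>lborel)"
proof -
  have "ladder_law \<mu> (\<lambda>l. h (upper l) * F (butlast l))
      = (\<Sum>n. (extend (rate \<mu>) ^^ n) (extend (\<lambda>r. ennreal \<mu> * ennreal (survival \<mu> r) * h r) (\<lambda>l. F (butlast l))) [])"
    unfolding ladder_law_def
    by (intro suminf_cong arg_cong[of _ _ "\<lambda>F. (extend (rate \<mu>) ^^ _) F []"]) (auto simp: extend_def fun_eq_iff mult.assoc)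
  also have "\<dots> = (\<Sum>n. \<integral>\<^sup>+r\<in>{0<..}. ennreal \<mu> * ennreal (survival \<mu> r) * h r *
        (extend (rate_below \<mu> r) ^^ n) F [] \<partial>lborel)"
    using extend_power_Fubini[where \<rho> = "rate \<mu>" and \<sigma> = "\<lambda>r. ennreal \<mu> * ennreal (survival \<mu> r) * h r" and \<Psi> = "\<lambda>l. F (butlast l)" and l = "[]"]
    by simp
  also have "\<dots> = (\<integral>\<^sup>+r. (\<Sum>n. ennreal \<mu> * ennreal (survival \<mu> r) * h r *
        (extend (rate_below \<mu> r) ^^ n) F [] * indicator {0<..} r) \<partial>lborel)"
  proof (rule nn_integral_suminf[symmetric])
    fix n
    have [measurable]: "(\<lambda>r. (extend (rate_below \<mu> r) ^^ n) F []) \<in> borel_measurable borel"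
      by (rule measurable_extend_power_at) (unfold case_prod_beta, measurable)
    show "(\<lambda>r. ennreal \<mu> * ennreal (survival \<mu> r) * h r *
        (extend (rate_below \<mu> r) ^^ n) F [] * indicator {0<..} r) \<in> borel_measurable lborel"
      by measurable
  qed
  finally show ?thesis by simp
qed

text \<open>The last entry integrates to \<open>\<mu>\<close> times the tail, and the remaining series is at most
  \<open>survival \<mu> 0 / (\<mu> + 0) = 1 / \<mu>\<close>.\<close>

lemma ladder_law_1_le:
  assumes "\<mu> > 0"
  shows "ladder_law \<mu> (\<lambda>_. 1) \<le> 1"
proof -
  have "extend (\<lambda>_. ennreal \<mu>) (\<lambda>l. ennreal (survival \<mu> (upper l))) = (\<lambda>l. ennreal \<mu> * tail \<mu> (upper l))"
    unfolding extend_def tail_def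
    by (auto simp: fun_eq_iff mult.assoc nn_integral_cmult)
  then have "ladder_law \<mu> (\<lambda>_. 1) = ennreal \<mu> * (\<Sum>n. (extend (rate \<mu>) ^^ n) (\<lambda>l. tail \<mu> (upper l)) [])"
    unfolding ladder_law_def by (simp add: extend_power_cmult)
  also have "\<dots> \<le> ennreal \<mu> * ennreal (survival \<mu> (upper []) / (\<mu> + upper []))"
    by (intro mult_left_mono suminf_extend_power_tail_le) (use assms in auto)
  also have "\<dots> = 1"
    using assms by (simp add: ennreal_mult'[symmetric])
  finally show ?thesis .
qed

section \<open>Jumps at exponential hazards\<close>

lemma independent_elements_nn_integral:
  assumes "prob_space M" and ind: "independent_elements M S X T Y"
    and h[measurable]: "h \<in> borel_measurable (S \<Otimes>\<^sub>M T)"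
  shows "(\<integral>\<^sup>+\<omega>. h (X \<omega>, Y \<omega>) \<partial>M) = (\<integral>\<^sup>+\<omega>. (\<integral>\<^sup>+y. h (X \<omega>, y) \<partial>distr M T Y) \<partial>M)"
proof -
  interpret prob_space M by fact
  have XY[measurable]: "X \<in> M \<rightarrow>\<^sub>M S" "Y \<in> M \<rightarrow>\<^sub>M T"
    and ind_sets: "indep_set (sets (vimage_algebra (space M) X S)) (sets (vimage_algebra (space M) Y T))"
    using ind by (auto simp: independent_elements_def)
  interpret X: prob_space "distr M S X" by (rule prob_space_distr) measurable
  interpret Y: prob_space "distr M T Y" by (rule prob_space_distr) measurable
  interpret XY: pair_prob_space "distr M S X" "distr M T Y" ..
  have "distr M S X \<Otimes>\<^sub>M distr M T Y = distr M (S \<Otimes>\<^sub>M T) (\<lambda>\<omega>. (X \<omega>, Y \<omega>))"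
  proof (rule pair_measure_eqI)
    fix A B assume "A \<in> sets (distr M S X)" "B \<in> sets (distr M T Y)"
    then have [measurable]: "A \<in> sets S" "B \<in> sets T" by auto
    have "prob ((X -` A \<inter> space M) \<inter> (Y -` B \<inter> space M)) = prob (X -` A \<inter> space M) * prob (Y -` B \<inter> space M)"
      by (rule indep_setD[OF ind_sets]) (auto simp: in_vimage_algebra)
    then have "emeasure M ((X -` A \<inter> space M) \<inter> (Y -` B \<inter> space M)) = emeasure M (X -` A \<inter> space M) * emeasure M (Y -` B \<inter> space M)"
      by (simp add: emeasure_eq_measure ennreal_mult)
    moreover have "(\<lambda>\<omega>. (X \<omega>, Y \<omega>)) -` (A \<times> B) \<inter> space M = (X -` A \<inter> space M) \<inter> (Y -` B \<inter> space M)"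
      by auto
    ultimately show "emeasure (distr M S X) A * emeasure (distr M T Y) B =
       emeasure (distr M (S \<Otimes>\<^sub>M T) (\<lambda>\<omega>. (X \<omega>, Y \<omega>))) (A \<times> B)"
      by (simp add: emeasure_distr)
  next
    show "sets (distr M S X \<Otimes>\<^sub>M distr M T Y) = sets (distr M (S \<Otimes>\<^sub>M T) (\<lambda>\<omega>. (X \<omega>, Y \<omega>)))"
      unfolding sets_distr by (rule sets_pair_measure_cong) simp_all
  qed (rule X.sigma_finite_measure_axioms Y.sigma_finite_measure_axioms)+
  note joint = this
  have h': "h \<in> borel_measurable (distr M S X \<Otimes>\<^sub>M distr M T Y)"
    by (subst measurable_cong_sets[OF sets_pair_measure_cong[OF sets_distr sets_distr] refl]) (rule h)
  have "(\<integral>\<^sup>+\<omega>. h (X \<omega>, Y \<omega>) \<partial>M) = (\<integral>\<^sup>+z. h z \<partial>distr M (S \<Otimes>\<^sub>M T) (\<lambda>\<omega>. (X \<omega>, Y \<omega>)))"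
    by (intro nn_integral_distr[symmetric] measurable_Pair XY) (simp add: h)
  also have "\<dots> = (\<integral>\<^sup>+x. (\<integral>\<^sup>+y. h (x, y) \<partial>distr M T Y) \<partial>distr M S X)"
    unfolding joint[symmetric] by (rule Y.nn_integral_fst[symmetric, OF h'])
  also have "\<dots> = (\<integral>\<^sup>+\<omega>. (\<integral>\<^sup>+y. h (X \<omega>, y) \<partial>distr M T Y) \<partial>M)"
  proof (rule nn_integral_distr)
    show "(\<lambda>x. \<integral>\<^sup>+y. h (x, y) \<partial>distr M T Y) \<in> borel_measurable (distr M S X)"
      by (rule Y.borel_measurable_nn_integral_fst[OF h'])
  qed (rule XY)
  finally show ?thesis .
qed

lemma (in prob_space) indep_vars_independent_elements:
  assumes "indep_vars M' X I" "A \<inter> B = {}" "A \<subseteq> I" "B \<subseteq> I"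
  shows "independent_elements M (PiM A M') (\<lambda>\<omega>. \<lambda>i\<in>A. X i \<omega>) (PiM B M') (\<lambda>\<omega>. \<lambda>i\<in>B. X i \<omega>)"
  using indep_var_restrict[OF assms] 
  by (simp add: independent_elements_def indep_var_eq sets_vimage_algebra)

abbreviation "standard_exponential \<equiv> density lborel (\<lambda>x. ennreal (exponential_density 1 x))"
abbreviation "standard_uniform \<equiv> density lborel (indicator {0<..<1} :: real \<Rightarrow> ennreal)"

lemma emeasure_standard_exponential:
  assumes "c \<ge> 0" shows "emeasure standard_exponential {c<..} = ennreal (exp (- c))"
proof -
  have "emeasure standard_exponential {c<..} = (\<integral>\<^sup>+x\<in>{c<..}. ennreal (exp (- x)) \<partial>lborel)"
    using assms by (subst emeasure_density)
      (auto intro!: nn_integral_cong simp: exponential_density_def split: split_indicator)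
  also have "\<dots> = ennreal (- 0 - (- exp (- c)))"
  proof (rule nn_integral_FTC_greaterThan)
    show "((\<lambda>x::real. - exp (- x)) \<longlongrightarrow> - 0) at_top" by real_asymp
  qed (auto intro!: derivative_eq_intros)
  finally show ?thesis by simp
qed

abbreviation "climb q e \<equiv> sqrt (q\<^sup>2 + 2 * e)"

text \<open>A path of unit speed that starts at height \<open>q\<close> and jumps at rate \<open>s\<close> at height \<open>s\<close> has accumulated
  the hazard \<open>(v\<^sup>2 - q\<^sup>2) / 2\<close> when it reaches \<open>v\<close>. So \<open>climb q e\<close> is the height just before the
  jump if the jump occurs at hazard \<open>e\<close>.\<close>

lemma distr_hazard_inversion:
  assumes q: "q \<ge> 0"
  shows "distr standard_exponential borel (\<lambda>e. climb q e)
    = density lborel (\<lambda>v. ennreal (v * exp (- ((v\<^sup>2 - q\<^sup>2) / 2))) * indicator {q<..} v)"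
proof (rule measure_eqI_lessThan)
  fix x :: real
  define m where "m = max q x"
  have m: "m \<ge> q" "m \<ge> 0" using q by (auto simp: m_def)
  then have mq: "q\<^sup>2 \<le> m\<^sup>2" using q by (intro power_mono) auto
  have "emeasure (distr standard_exponential borel (\<lambda>e. climb q e)) {x<..}
    = emeasure standard_exponential ((\<lambda>e. climb q e) -` {x<..})"
    by (subst emeasure_distr) auto
  also have "\<dots> = emeasure standard_exponential {(m\<^sup>2 - q\<^sup>2) / 2<..}"
  proof (rule emeasure_eq_AE)
    show "AE e in standard_exponential. (e \<in> (\<lambda>e. climb q e) -` {x<..}) = (e \<in> {(m\<^sup>2 - q\<^sup>2) / 2<..})"
    proof (subst AE_density, simp, rule AE_mp[OF AE_lborel_singleton[of 0]], intro AE_I2 impI)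
      fix e :: real assume "e \<noteq> 0" "0 < ennreal (exponential_density 1 e)"
      then have e: "e > 0" by (auto simp: exponential_density_def split: if_splits)
      show "(e \<in> (\<lambda>e. climb q e) -` {x<..}) = (e \<in> {(m\<^sup>2 - q\<^sup>2) / 2<..})"
      proof (cases "x < q")
        case True
        have "climb q e > q" using e q by (intro real_less_rsqrt) auto
        then show ?thesis using True e by (auto simp: m_def)
      next
        case False
        then have "m = x" "x \<ge> 0" using q by (auto simp: m_def)
        then have "x < climb q e \<longleftrightarrow> x\<^sup>2 < q\<^sup>2 + 2 * e"
          using real_sqrt_less_iff[of "x\<^sup>2" "q\<^sup>2 + 2 * e"] by simp
        then show ?thesis using \<open>m = x\<close> by (auto simp: field_simps)
      qed
    qed
    have "{e. x < climb q e} \<in> sets borel" by measurable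
    then show "(\<lambda>e. climb q e) -` {x<..} \<in> sets standard_exponential"
      by (simp add: vimage_def)
  qed simp
  also have "\<dots> = ennreal (exp (- ((m\<^sup>2 - q\<^sup>2) / 2)))"
    using mq by (intro emeasure_standard_exponential) simp
  finally have 1: "emeasure (distr standard_exponential borel (\<lambda>e. climb q e)) {x<..} = \<dots>" .
  show "emeasure (distr standard_exponential borel (\<lambda>e. climb q e)) {x<..} < \<infinity>"
    unfolding 1 by simp
  have "emeasure (density lborel (\<lambda>v. ennreal (v * exp (- ((v\<^sup>2 - q\<^sup>2) / 2))) * indicator {q<..} v)) {x<..}
    = (\<integral>\<^sup>+v\<in>{m<..}. ennreal (v * exp (- ((v\<^sup>2 - q\<^sup>2) / 2))) \<partial>lborel)"
    by (subst emeasure_density) (auto intro!: nn_integral_cong simp: m_def split: split_indicator)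
  also have "\<dots> = ennreal (- 0 - (- exp (- ((m\<^sup>2 - q\<^sup>2) / 2))))"
  proof (rule nn_integral_FTC_greaterThan)
    show "((\<lambda>v. - exp (- ((v\<^sup>2 - q\<^sup>2) / 2))) \<longlongrightarrow> - 0) at_top" by real_asymp
    fix v assume "m \<le> v" then show "0 \<le> v * exp (- ((v\<^sup>2 - q\<^sup>2) / 2))" using m by simp
    show "((\<lambda>v. - exp (- ((v\<^sup>2 - q\<^sup>2) / 2))) has_real_derivative v * exp (- ((v\<^sup>2 - q\<^sup>2) / 2))) (at v)"
      by (auto intro!: derivative_eq_intros)
  qed simp
  finally show "emeasure (distr standard_exponential borel (\<lambda>e. climb q e)) {x<..}
    = emeasure (density lborel (\<lambda>v. ennreal (v * exp (- ((v\<^sup>2 - q\<^sup>2) / 2))) * indicator {q<..} v)) {x<..}"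
    using 1 by simp
qed auto

lemma nn_integral_hazard_inversion:
  assumes "q \<ge> 0" and [measurable]: "\<phi> \<in> borel_measurable borel"
  shows "(\<integral>\<^sup>+e. \<phi> (climb q e) \<partial>standard_exponential)
    = (\<integral>\<^sup>+v\<in>{q<..}. ennreal (v * exp (- ((v\<^sup>2 - q\<^sup>2) / 2))) * \<phi> v \<partial>lborel)"
proof -
  have "(\<integral>\<^sup>+e. \<phi> (climb q e) \<partial>standard_exponential)
     = (\<integral>\<^sup>+v. \<phi> v \<partial>distr standard_exponential borel (\<lambda>e. climb q e))"
    by (rule nn_integral_distr[symmetric]) auto
  also have "\<dots> = (\<integral>\<^sup>+v\<in>{q<..}. ennreal (v * exp (- ((v\<^sup>2 - q\<^sup>2) / 2))) * \<phi> v \<partial>lborel)"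
    unfolding distr_hazard_inversion[OF assms(1)]
    by (subst nn_integral_density) (auto simp: ac_simps intro!: nn_integral_cong)
  finally show ?thesis .
qed

lemma nn_integral_uniform_scale:
  fixes G :: "real \<Rightarrow> ennreal"
  assumes "v > 0" and [measurable]: "G \<in> borel_measurable borel"
  shows "(\<integral>\<^sup>+u. G (u * v) \<partial>standard_uniform) = ennreal (1 / v) * (\<integral>\<^sup>+y\<in>{0<..<v}. G y \<partial>lborel)"
proof -
  have "(\<integral>\<^sup>+y\<in>{0<..<v}. G y \<partial>lborel) = ennreal \<bar>v\<bar> * (\<integral>\<^sup>+u. G (0 + v * u) * indicator {0<..<v} (0 + v * u) \<partial>lborel)"
    using assms by (intro nn_integral_real_affine) auto
  also have "(\<integral>\<^sup>+u. G (0 + v * u) * indicator {0<..<v} (0 + v * u) \<partial>lborel) = (\<integral>\<^sup>+u. G (u * v) \<partial>standard_uniform)"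
    using assms(1) by (subst nn_integral_density)
      (auto intro!: nn_integral_cong simp: ac_simps zero_less_mult_iff split: split_indicator)
  finally show ?thesis using assms(1)
    by (simp add: mult.assoc[symmetric] ennreal_mult'[symmetric])
qed

lemma nn_integral_jump_kernel:
  assumes \<mu>: "\<mu> > 0" and l: "upper l \<ge> 0" and [measurable]: "F \<in> borel_measurable list_borel"
  shows "(\<integral>\<^sup>+e. (\<integral>\<^sup>+u. ennreal (exp (- \<mu> * (climb (upper l) e - upper l))) *
        F (cut_snoc l (u * climb (upper l) e)) \<partial>standard_uniform) \<partial>standard_exponential)
     = jump_operator \<mu> F l"
proof -
  define q where "q = upper l"
  define G where "G y = F (cut_snoc l y)" for y
  have [measurable]: "G \<in> borel_measurable borel" unfolding G_def[abs_def] by measurable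
  have q: "q \<ge> 0" using l by (simp add: q_def)
  let ?c = "ennreal (1 / survival \<mu> q)"
  let ?I = "\<lambda>v y. ?c * (ennreal (survival \<mu> v) * indicator {q<..} v * (G y * indicator {0<..} y * indicator {..<v} y))"
  define \<phi> where "\<phi> v = (\<integral>\<^sup>+u. ennreal (exp (- \<mu> * (v - q))) * G (u * v) \<partial>standard_uniform)" for v
  have [measurable]: "\<phi> \<in> borel_measurable borel" unfolding \<phi>_def[abs_def]
    by (subst nn_integral_density) measurable
  have "(\<integral>\<^sup>+e. \<phi> (climb q e) \<partial>standard_exponential)
     = (\<integral>\<^sup>+v\<in>{q<..}. ennreal (v * exp (- ((v\<^sup>2 - q\<^sup>2) / 2))) * \<phi> v \<partial>lborel)"
    by (rule nn_integral_hazard_inversion[OF q]) measurable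
  also have "\<dots> = (\<integral>\<^sup>+v. (\<integral>\<^sup>+y. ?I v y \<partial>lborel) \<partial>lborel)"
  proof (rule nn_integral_cong)
    fix v
    show "ennreal (v * exp (- ((v\<^sup>2 - q\<^sup>2) / 2))) * \<phi> v * indicator {q<..} v
      = (\<integral>\<^sup>+y. ?I v y \<partial>lborel)"
    proof (cases "q < v")
      case True
      then have v: "v > 0" using q by simp
      have \<phi>: "\<phi> v = ennreal (exp (- \<mu> * (v - q))) * (ennreal (1 / v) * (\<integral>\<^sup>+y\<in>{0<..<v}. G y \<partial>lborel))"
        unfolding \<phi>_def by (subst nn_integral_cmult) (auto simp: nn_integral_uniform_scale v)
      have "ennreal (v * exp (- ((v\<^sup>2 - q\<^sup>2) / 2))) * \<phi> v
        = ennreal (v * exp (- ((v\<^sup>2 - q\<^sup>2) / 2)) * exp (- \<mu> * (v - q)) * (1 / v)) * (\<integral>\<^sup>+y\<in>{0<..<v}. G y \<partial>lborel)"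
      proof -
        have "ennreal (v * a * b * (1 / v)) = ennreal (v * a) * (ennreal b * ennreal (1 / v))" if "a > 0" "b > 0" for a b
          using v that by (simp add: ennreal_mult[symmetric])
        then show ?thesis unfolding \<phi> by (simp only: exp_gt_zero mult.assoc)
      qed
      also have "v * exp (- ((v\<^sup>2 - q\<^sup>2) / 2)) * exp (- \<mu> * (v - q)) * (1 / v) = 1 / survival \<mu> q * survival \<mu> v"
        using v by (simp add: survival_def exp_add[symmetric] exp_diff[symmetric] field_simps)
      also have "ennreal (1 / survival \<mu> q * survival \<mu> v) * (\<integral>\<^sup>+y\<in>{0<..<v}. G y \<partial>lborel)
        = (\<integral>\<^sup>+y. ?c * (ennreal (survival \<mu> v) * (G y * indicator {0<..} y * indicator {..<v} y)) \<partial>lborel)"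
        by (subst nn_integral_cmult[symmetric])
          (auto simp: ennreal_mult[of "1 / survival \<mu> q" "survival \<mu> v", simplified] mult.assoc
            intro!: nn_integral_cong split: split_indicator)
      finally show ?thesis using True by simp
    qed simp
  qed
  also have "\<dots> = (\<integral>\<^sup>+y. (\<integral>\<^sup>+v. ?I v y \<partial>lborel) \<partial>lborel)"
    by (rule lborel_pair.Fubini') measurable
  also have "\<dots> = (\<integral>\<^sup>+y. ?c * (G y * indicator {0<..} y * tail \<mu> (max q y)) \<partial>lborel)"
  proof (rule nn_integral_cong)
    fix y
    have "(\<integral>\<^sup>+v. ?I v y \<partial>lborel)
      = (\<integral>\<^sup>+v. ?c * (G y * indicator {0<..} y) * (ennreal (survival \<mu> v) * indicator {max q y<..} v) \<partial>lborel)"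
      by (intro nn_integral_cong) (simp split: split_indicator add: mult_ac)
    also have "\<dots> = ?c * (G y * indicator {0<..} y) * tail \<mu> (max q y)"
      unfolding tail_def by (rule nn_integral_cmult) measurable
    finally show "(\<integral>\<^sup>+v. ?I v y \<partial>lborel)
      = ?c * (G y * indicator {0<..} y * tail \<mu> (max q y))"
      by (simp only: mult.assoc)
  qed
  also have "\<dots> = ?c * (\<integral>\<^sup>+y. G y * indicator {0<..} y * tail \<mu> (max q y) \<partial>lborel)"
    by (rule nn_integral_cmult) measurable
  also have "\<dots> = jump_operator \<mu> F l"
    unfolding jump_operator_def G_def q_def
    by (simp add: divide_ennreal_def mult.commute inverse_ennreal inverse_eq_divide mult.left_commute)
  finally show ?thesis unfolding \<phi>_def G_def q_def .
qed

text \<open>The expectation of \<open>F\<close>, evaluated at the list with the height at the killing time appended, on the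
  event that killing comes before the next jump.\<close>

definition killing_operator :: "real \<Rightarrow> (real list \<Rightarrow> ennreal) \<Rightarrow> real list \<Rightarrow> ennreal" where
  "killing_operator \<mu> F l =
     extend (\<lambda>_. ennreal \<mu>) (\<lambda>l. ennreal (survival \<mu> (upper l)) * F l) l / ennreal (survival \<mu> (upper l))"

lemma measurable_killing_operator [measurable]:
  assumes [measurable]: "F \<in> borel_measurable list_borel"
  shows "killing_operator \<mu> F \<in> borel_measurable list_borel"
  unfolding killing_operator_def[abs_def] by measurable

lemma Green_killing_operator: "Green \<mu> (killing_operator \<mu> F) = ladder_law \<mu> F"
  unfolding Green_def ladder_law_def killing_operator_def
  by (subst ennreal_mult_divide_cancel) (auto simp: survival_pos[THEN less_imp_neq, symmetric])

text \<open>Fubini's theorem: the height \<open>v\<close> is reached before the next jump if the exponential hazard exceeds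
  \<open>(v\<^sup>2 - q\<^sup>2) / 2\<close>.\<close>

lemma nn_integral_killing_kernel:
  assumes \<mu>: "\<mu> > 0" and l: "upper l \<ge> 0" and [measurable]: "F \<in> borel_measurable list_borel"
  shows "(\<integral>\<^sup>+e. (\<integral>\<^sup>+v. ennreal (\<mu> * exp (- \<mu> * (v - upper l))) * F (l @ [v]) *
        indicator {upper l..<climb (upper l) e} v \<partial>lborel) \<partial>standard_exponential)
     = killing_operator \<mu> F l"
proof -
  define q where "q = upper l"
  have q: "q \<ge> 0" using l by (simp add: q_def)
  define G where "G v = ennreal (\<mu> * exp (- \<mu> * (v - q))) * F (l @ [v])" for v
  have [measurable]: "G \<in> borel_measurable borel" unfolding G_def[abs_def] by measurable
  have E: "(\<lambda>(e, v). G v * indicator {q..<climb q e} v) \<in> borel_measurable (standard_exponential \<Otimes>\<^sub>M lborel)"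
  proof -
    have "(\<lambda>(e, v). if q \<le> v \<and> v < climb q e then G v else 0) \<in> borel_measurable (standard_exponential \<Otimes>\<^sub>M lborel)"
      by measurable
    then show ?thesis by (rule measurable_cong[THEN iffD1, rotated]) auto
  qed
  interpret SE: prob_space standard_exponential by (rule prob_space_exponential_density) simp
  interpret pair_sigma_finite standard_exponential lborel ..
  have "(\<integral>\<^sup>+e. (\<integral>\<^sup>+v. G v * indicator {q..<climb q e} v \<partial>lborel) \<partial>standard_exponential)
    = (\<integral>\<^sup>+v. (\<integral>\<^sup>+e. G v * indicator {q..<climb q e} v \<partial>standard_exponential) \<partial>lborel)"
    by (rule Fubini'[symmetric]) (use E in simp)
  also have "\<dots> = (\<integral>\<^sup>+v. ennreal (1 / survival \<mu> q) * (ennreal \<mu> * (ennreal (survival \<mu> v) * F (l @ [v])) * indicator {q<..} v) \<partial>lborel)"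
  proof (rule nn_integral_cong_AE, rule AE_mp[OF AE_lborel_singleton[of q]], intro AE_I2 impI)
    fix v :: real assume "v \<noteq> q"
    show "(\<integral>\<^sup>+e. G v * indicator {q..<climb q e} v \<partial>standard_exponential)
      = ennreal (1 / survival \<mu> q) * (ennreal \<mu> * (ennreal (survival \<mu> v) * F (l @ [v])) * indicator {q<..} v)"
    proof (cases "q < v")
      case True
      have v2: "v < climb q e \<longleftrightarrow> (v\<^sup>2 - q\<^sup>2) / 2 < e" for e
      proof -
        have "v < climb q e \<longleftrightarrow> v\<^sup>2 < q\<^sup>2 + 2 * e"
          using True q real_sqrt_less_iff[of "v\<^sup>2" "q\<^sup>2 + 2 * e"] by simp
        then show ?thesis by (auto simp: field_simps)
      qed
      have "(\<integral>\<^sup>+e. G v * indicator {q..<climb q e} v \<partial>standard_exponential)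
        = (\<integral>\<^sup>+e. G v * indicator {(v\<^sup>2 - q\<^sup>2) / 2<..} e \<partial>standard_exponential)"
        using True v2 by (intro nn_integral_cong) (auto split: split_indicator)
      also have "\<dots> = G v * ennreal (exp (- ((v\<^sup>2 - q\<^sup>2) / 2)))"
        using True q power_mono[of q v 2]
        by (subst nn_integral_cmult_indicator) (auto simp: emeasure_standard_exponential)
      also have "\<dots> = ennreal (\<mu> * exp (- \<mu> * (v - q)) * exp (- ((v\<^sup>2 - q\<^sup>2) / 2))) * F (l @ [v])"
        using \<mu> unfolding G_def by (simp add: ennreal_mult' ac_simps)
      also have "\<mu> * exp (- \<mu> * (v - q)) * exp (- ((v\<^sup>2 - q\<^sup>2) / 2)) = 1 / survival \<mu> q * (\<mu> * survival \<mu> v)"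
        by (simp add: survival_def exp_add[symmetric] exp_diff[symmetric] field_simps)
      also have "ennreal (1 / survival \<mu> q * (\<mu> * survival \<mu> v)) = ennreal (1 / survival \<mu> q) * (ennreal \<mu> * ennreal (survival \<mu> v))"
        using \<mu> by (simp add: ennreal_mult[symmetric])
      finally show ?thesis using True by (simp add: mult.assoc)
    next
      case False then show ?thesis using \<open>v \<noteq> q\<close> by simp
    qed
  qed
  also have "\<dots> = ennreal (1 / survival \<mu> q) * (\<integral>\<^sup>+v. ennreal \<mu> * (ennreal (survival \<mu> v) * F (l @ [v])) * indicator {q<..} v \<partial>lborel)"
    by (rule nn_integral_cmult) measurable
  also have "\<dots> = killing_operator \<mu> F l"
    unfolding killing_operator_def extend_def q_def
    by (simp add: divide_ennreal_def mult.commute inverse_ennreal inverse_eq_divide)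
  finally show ?thesis unfolding G_def q_def .
qed

section \<open>The Rayleigh process as a function of independent noise\<close>

text \<open>The list of ladder indices and the elapsed time after \<open>m\<close> jumps, computed from the hazards \<open>e\<close>
  between the jumps and the uniform fractions \<open>u\<close> of the height that are kept. As the last jump
  target is always a current ladder index, the height is the last entry; the time grows by the
  height that is climbed.\<close>

primrec driven :: "(nat \<Rightarrow> real) \<Rightarrow> (nat \<Rightarrow> real) \<Rightarrow> nat \<Rightarrow> real list \<times> real" where
  "driven e u 0 = ([], 0)"
| "driven e u (Suc m) = (let (l, p) = driven e u m; v = climb (upper l) (e m)
     in (cut_snoc l (u m * v), p + (v - upper l)))"

lemma driven_cong:
  assumes "\<And>i. i < m \<Longrightarrow> e i = e' i" "\<And>i. i < m \<Longrightarrow> u i = u' i"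
  shows "driven e u m = driven e' u' m"
  using assms by (induction m) (auto simp: Let_def split: prod.splits)

text \<open>Only the first \<open>m\<close> inputs enter, so that independence of the next ones can be used.\<close>

lemma measurable_driven:
  assumes "\<And>i. i < m \<Longrightarrow> (\<lambda>x. e x i) \<in> borel_measurable N" "\<And>i. i < m \<Longrightarrow> (\<lambda>x. u x i) \<in> borel_measurable N"
  shows "(\<lambda>x. driven (e x) (u x) m) \<in> N \<rightarrow>\<^sub>M (list_borel \<Otimes>\<^sub>M borel)"
  using assms
proof (induction m)
  case (Suc m)
  have [measurable]: "(\<lambda>x. e x m) \<in> borel_measurable N" "(\<lambda>x. u x m) \<in> borel_measurable N"
    "(\<lambda>x. driven (e x) (u x) m) \<in> N \<rightarrow>\<^sub>M (list_borel \<Otimes>\<^sub>M borel)"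
    using Suc by auto
  show ?case unfolding driven.simps Let_def case_prod_beta by measurable
qed simp

lemma upper_driven_nonneg:
  assumes "\<And>i. u i \<ge> 0" "\<And>i. e i \<ge> 0" shows "upper (fst (driven e u m)) \<ge> 0"
  using assms by (cases m) (auto simp: Let_def case_prod_beta intro!: mult_nonneg_nonneg)

locale driving_noise = prob_space \<Omega> for \<Omega> :: "'b measure" +
  fixes E U :: "nat \<Rightarrow> 'b \<Rightarrow> real" and \<mu> :: real
  assumes indep: "indep_vars (\<lambda>_. borel) (case_sum E U) UNIV"
    and E_distr: "\<And>i. distributed \<Omega> lborel (E i) (exponential_density 1)"
    and U_distr: "\<And>i. distributed \<Omega> lborel (U i) (indicator {0<..<1})"
    and \<mu>_pos: "\<mu> > 0"
begin

definition Z where "Z m \<omega> = driven (\<lambda>i. E i \<omega>) (\<lambda>i. U i \<omega>) m"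

lemma measurable_E [measurable]: "E i \<in> borel_measurable \<Omega>" and measurable_U [measurable]: "U i \<in> borel_measurable \<Omega>"
  using distributed_measurable[OF E_distr[of i]] distributed_measurable[OF U_distr[of i]] by auto

lemma distr_E: "distr \<Omega> borel (E i) = standard_exponential"
  unfolding distributed_distr_eq_density[OF E_distr[of i], symmetric] by (rule distr_cong) auto

lemma distr_U: "distr \<Omega> borel (U i) = standard_uniform"
  unfolding distributed_distr_eq_density[OF U_distr[of i], symmetric] by (rule distr_cong) auto

lemma AE_noise: "AE \<omega> in \<Omega>. \<forall>i. E i \<omega> > 0 \<and> 0 < U i \<omega> \<and> U i \<omega> < 1"
proof (subst AE_all_countable, intro allI)
  fix i
  have "AE x in lborel. 0 < ennreal (exponential_density 1 x) \<longrightarrow> x > 0"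
    by (rule AE_mp[OF AE_lborel_singleton[of 0]]) (auto simp: exponential_density_def)
  then have "AE x in distr \<Omega> borel (E i). x > 0"
    unfolding distr_E by (subst AE_density) auto
  then have 1: "AE \<omega> in \<Omega>. E i \<omega> > 0" by (subst (asm) AE_distr_iff) auto
  have "AE x in distr \<Omega> borel (U i). 0 < x \<and> x < 1"
    unfolding distr_U by (subst AE_density) (auto split: split_indicator)
  then have 2: "AE \<omega> in \<Omega>. 0 < U i \<omega> \<and> U i \<omega> < 1" by (subst (asm) AE_distr_iff) auto
  show "AE \<omega> in \<Omega>. E i \<omega> > 0 \<and> 0 < U i \<omega> \<and> U i \<omega> < 1" using 1 2 by eventually_elim auto
qed

text \<open>The inputs of the next jump are independent of the present state; the fraction and the hazard are
  integrated out one after the other.\<close>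

lemma nn_integral_noise_step:
  assumes h[measurable]: "(\<lambda>(z, e, u). h z e u) \<in> borel_measurable ((list_borel \<Otimes>\<^sub>M borel) \<Otimes>\<^sub>M borel \<Otimes>\<^sub>M borel)"
  shows "(\<integral>\<^sup>+\<omega>. h (Z m \<omega>) (E m \<omega>) (U m \<omega>) \<partial>\<Omega>) =
    (\<integral>\<^sup>+\<omega>. (\<integral>\<^sup>+e. (\<integral>\<^sup>+u. h (Z m \<omega>) e u \<partial>standard_uniform) \<partial>standard_exponential) \<partial>\<Omega>)"
proof -
  let ?d = "\<lambda>f. driven (\<lambda>i. f (Inl i)) (\<lambda>i. f (Inr i)) m"
  let ?B = "\<lambda>A :: (nat + nat) set. PiM A (\<lambda>_. borel :: real measure)"
  let ?S = "list_borel \<Otimes>\<^sub>M (borel :: real measure)"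
  let ?X = "case_sum E U"
  have [measurable]: "?X i \<in> borel_measurable \<Omega>" for i by (cases i) auto
  \<comment> \<open>Indices of the inputs of the first \<open>m\<close> jumps, and then also of the next hazard.\<close>
  define A where "A = Inl ` {..<m} \<union> Inr ` {..<m :: nat}"
  define A' where "A' = insert (Inl m) A"
  have dm: "?d \<in> ?B A'' \<rightarrow>\<^sub>M ?S"
    if "A \<subseteq> A''" for A''
    by (rule measurable_driven; rule measurable_component_singleton) (use that in \<open>auto simp: A_def\<close>)
  have [measurable]: "?d \<in> ?B A \<rightarrow>\<^sub>M ?S"
    "?d \<in> ?B A' \<rightarrow>\<^sub>M ?S"
    by (auto intro!: dm simp: A'_def)
  have [measurable]: "(\<lambda>f. f (Inl m)) \<in> borel_measurable (?B A')"
    "(\<lambda>f. f (Inl m)) \<in> borel_measurable (?B {Inl m})"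
    "(\<lambda>f. f (Inr m)) \<in> borel_measurable (?B {Inr m})"
    by (auto intro!: measurable_component_singleton simp: A'_def)
  have ZA: "driven (\<lambda>i. restrict (\<lambda>i. ?X i \<omega>) A (Inl i)) (\<lambda>i. restrict (\<lambda>i. ?X i \<omega>) A (Inr i)) m = Z m \<omega>"
    "driven (\<lambda>i. restrict (\<lambda>i. ?X i \<omega>) A' (Inl i)) (\<lambda>i. restrict (\<lambda>i. ?X i \<omega>) A' (Inr i)) m = Z m \<omega>" for \<omega>
    unfolding Z_def by (rule driven_cong; simp add: A'_def A_def)+
  have r: "restrict (\<lambda>i. ?X i \<omega>) A' (Inl m) = E m \<omega>" "restrict (\<lambda>i. ?X i \<omega>) {Inr m} (Inr m) = U m \<omega>"
    "restrict (\<lambda>i. ?X i \<omega>) {Inl m} (Inl m) = E m \<omega>" for \<omega>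
    by (auto simp: A'_def)
  have 1: "independent_elements \<Omega> (?B A') (\<lambda>\<omega>. \<lambda>i\<in>A'. ?X i \<omega>) (?B {Inr m}) (\<lambda>\<omega>. \<lambda>i\<in>{Inr m}. ?X i \<omega>)"
    by (rule indep_vars_independent_elements[OF indep]) (auto simp: A'_def A_def)
  have 2: "independent_elements \<Omega> (?B A) (\<lambda>\<omega>. \<lambda>i\<in>A. ?X i \<omega>) (?B {Inl m}) (\<lambda>\<omega>. \<lambda>i\<in>{Inl m}. ?X i \<omega>)"
    by (rule indep_vars_independent_elements[OF indep]) (auto simp: A_def)
  have SU: "(\<integral>\<^sup>+y. g (y (Inr m)) \<partial>distr \<Omega> (?B {Inr m}) (\<lambda>\<omega>. \<lambda>i\<in>{Inr m}. ?X i \<omega>)) = (\<integral>\<^sup>+u. g u \<partial>standard_uniform)"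
    if [measurable]: "g \<in> borel_measurable borel" for g
    by (simp add: nn_integral_distr distr_U[of m, symmetric])
  have SE: "(\<integral>\<^sup>+y. g (y (Inl m)) \<partial>distr \<Omega> (?B {Inl m}) (\<lambda>\<omega>. \<lambda>i\<in>{Inl m}. ?X i \<omega>)) = (\<integral>\<^sup>+e. g e \<partial>standard_exponential)"
    if [measurable]: "g \<in> borel_measurable borel" for g
    by (simp add: nn_integral_distr distr_E[of m, symmetric])
  interpret SU: prob_space standard_uniform
    unfolding distr_U[of 0, symmetric] by (rule prob_space_distr) measurable
  define H where "H z e = (\<integral>\<^sup>+u. h z e u \<partial>standard_uniform)" for z e
  have "(\<lambda>(x, u). (fst x, snd x, u)) \<in> (?S \<Otimes>\<^sub>M borel) \<Otimes>\<^sub>M borel \<rightarrow>\<^sub>M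
      (?S \<Otimes>\<^sub>M borel \<Otimes>\<^sub>M (borel :: real measure))"
    by measurable
  from measurable_compose[OF this h]
  have [measurable]: "(\<lambda>(x, u). h (fst x) (snd x) u) \<in> borel_measurable ((?S \<Otimes>\<^sub>M borel) \<Otimes>\<^sub>M standard_uniform)"
    by (simp add: case_prod_beta cong: measurable_cong_sets)
  have H[measurable]: "(\<lambda>x. H (fst x) (snd x)) \<in> borel_measurable (?S \<Otimes>\<^sub>M borel)"
    unfolding H_def by (rule SU.borel_measurable_nn_integral) measurable
  have "(\<lambda>(f, g). (?d f, f (Inl m), g (Inr m)))
      \<in> ?B A' \<Otimes>\<^sub>M ?B {Inr m} \<rightarrow>\<^sub>M (?S \<Otimes>\<^sub>M borel \<Otimes>\<^sub>M (borel :: real measure))"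
    by measurable
  from measurable_compose[OF this h]
  have m1: "(\<lambda>(f, g). h (?d f) (f (Inl m)) (g (Inr m)))
      \<in> borel_measurable (?B A' \<Otimes>\<^sub>M ?B {Inr m})"
    by (simp add: case_prod_unfold)
  have "(\<lambda>(f, g). (?d f, g (Inl m)))
      \<in> ?B A \<Otimes>\<^sub>M ?B {Inl m} \<rightarrow>\<^sub>M (?S \<Otimes>\<^sub>M (borel :: real measure))"
    by measurable
  from measurable_compose[OF this H]
  have m2: "(\<lambda>(f, g). H (?d f) (g (Inl m)))
      \<in> borel_measurable (?B A \<Otimes>\<^sub>M ?B {Inl m})"
    by (simp add: case_prod_unfold)
  have hu[measurable]: "h z e \<in> borel_measurable borel" for z e
    by (rule measurable_compose[OF _ h, of "\<lambda>u. (z, e, u)", simplified])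
       (auto intro!: measurable_Pair simp: space_pair_measure)
  have Hz[measurable]: "H z \<in> borel_measurable borel" for z
    by (rule measurable_compose[OF _ H, of "\<lambda>e. (z, e)", simplified])
       (auto intro!: measurable_Pair simp: space_pair_measure)
  have "(\<integral>\<^sup>+\<omega>. h (Z m \<omega>) (E m \<omega>) (U m \<omega>) \<partial>\<Omega>) =
     (\<integral>\<^sup>+\<omega>. (\<lambda>(f, g). h (?d f) (f (Inl m)) (g (Inr m)))
        (\<lambda>i\<in>A'. ?X i \<omega>, \<lambda>i\<in>{Inr m}. ?X i \<omega>) \<partial>\<Omega>)"
    by (simp only: prod.case ZA r)
  also have "\<dots> = (\<integral>\<^sup>+\<omega>. H (Z m \<omega>) (E m \<omega>) \<partial>\<Omega>)"
    unfolding independent_elements_nn_integral[OF prob_space_axioms 1 m1]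
    by (simp only: prod.case ZA r H_def SU[OF hu])
  also have "\<dots> = (\<integral>\<^sup>+\<omega>. (\<lambda>(f, g). H (?d f) (g (Inl m)))
        (\<lambda>i\<in>A. ?X i \<omega>, \<lambda>i\<in>{Inl m}. ?X i \<omega>) \<partial>\<Omega>)"
    by (simp only: prod.case ZA r)
  also have "\<dots> = (\<integral>\<^sup>+\<omega>. (\<integral>\<^sup>+e. H (Z m \<omega>) e \<partial>standard_exponential) \<partial>\<Omega>)"
    unfolding independent_elements_nn_integral[OF prob_space_axioms 2 m2]
    by (simp only: prod.case ZA r SE[OF Hz])
  finally show ?thesis unfolding H_def .
qed

text \<open>The expectation of \<open>F\<close> after \<open>m\<close> jumps on the event that the process is not killed by then: given
  the path, an independent exponential killing time exceeds the elapsed time \<open>t\<close> with probability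
  \<open>exp (- \<mu> * t)\<close>.\<close>

definition survive :: "nat \<Rightarrow> (real list \<Rightarrow> ennreal) \<Rightarrow> ennreal" where
  "survive m F = (\<integral>\<^sup>+\<omega>. ennreal (exp (- \<mu> * snd (Z m \<omega>))) * F (fst (Z m \<omega>)) \<partial>\<Omega>)"

lemma survive_0: "survive 0 F = F []"
  by (simp add: survive_def Z_def emeasure_space_1)

lemma AE_upper_Z: "AE \<omega> in \<Omega>. upper (fst (Z m \<omega>)) \<ge> 0"
  using AE_noise unfolding Z_def by eventually_elim (rule upper_driven_nonneg, auto intro: less_imp_le)

lemma survive_Suc:
  assumes [measurable]: "F \<in> borel_measurable list_borel"
  shows "survive (Suc m) F = survive m (jump_operator \<mu> F)"
proof -
  define K where "K l e u = ennreal (exp (- \<mu> * (climb (upper l) e - upper l))) *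
    F (cut_snoc l (u * climb (upper l) e))" for l e u
  have K[measurable]: "(\<lambda>x. K (fst (fst x)) (fst (snd x)) (snd (snd x))) \<in> borel_measurable ((list_borel \<Otimes>\<^sub>M borel) \<Otimes>\<^sub>M borel \<Otimes>\<^sub>M borel)"
    unfolding K_def case_prod_beta by measurable
  have K2[measurable]: "(\<lambda>(e, u). K l e u) \<in> borel_measurable (borel \<Otimes>\<^sub>M borel)" for l
    unfolding K_def case_prod_beta by measurable
  interpret SU: prob_space standard_uniform
    unfolding distr_U[of 0, symmetric] by (rule prob_space_distr) measurable
  have [measurable]: "(\<lambda>e. \<integral>\<^sup>+u. K l e u \<partial>standard_uniform) \<in> borel_measurable borel" for l
    by measurable
  have "survive (Suc m) F = (\<integral>\<^sup>+\<omega>. (\<lambda>z e u. ennreal (exp (- \<mu> * snd z)) * K (fst z) e u) (Z m \<omega>) (E m \<omega>) (U m \<omega>) \<partial>\<Omega>)"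
    unfolding survive_def Z_def driven.simps Let_def case_prod_beta K_def
    by (intro nn_integral_cong) (simp add: ennreal_mult'[symmetric] mult.assoc[symmetric] exp_add[symmetric] algebra_simps)
  also have "\<dots> = (\<integral>\<^sup>+\<omega>. (\<integral>\<^sup>+e. (\<integral>\<^sup>+u. ennreal (exp (- \<mu> * snd (Z m \<omega>))) * K (fst (Z m \<omega>)) e u \<partial>standard_uniform) \<partial>standard_exponential) \<partial>\<Omega>)"
    by (rule nn_integral_noise_step) measurable
  also have "\<dots> = (\<integral>\<^sup>+\<omega>. ennreal (exp (- \<mu> * snd (Z m \<omega>))) * (\<integral>\<^sup>+e. (\<integral>\<^sup>+u. K (fst (Z m \<omega>)) e u \<partial>standard_uniform) \<partial>standard_exponential) \<partial>\<Omega>)"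
    by (intro nn_integral_cong) (simp add: nn_integral_cmult)
  also have "\<dots> = survive m (jump_operator \<mu> F)"
    unfolding survive_def
  proof (rule nn_integral_cong_AE)
    show "AE \<omega> in \<Omega>. ennreal (exp (- \<mu> * snd (Z m \<omega>))) * (\<integral>\<^sup>+e. (\<integral>\<^sup>+u. K (fst (Z m \<omega>)) e u \<partial>standard_uniform) \<partial>standard_exponential)
      = ennreal (exp (- \<mu> * snd (Z m \<omega>))) * jump_operator \<mu> F (fst (Z m \<omega>))"
      using AE_upper_Z[of m]
    proof eventually_elim
      case (elim \<omega>)
      show ?case unfolding K_def using nn_integral_jump_kernel[OF \<mu>_pos elim assms] by simp
    qed
  qed
  finally show ?thesis .
qed

lemma suminf_survive_le_Green:
  assumes "F \<in> borel_measurable list_borel"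
  shows "(\<Sum>i. survive i F) \<le> Green \<mu> F"
  by (rule suminf_iterates_le_supersolution[where A = "\<lambda>F. F \<in> borel_measurable list_borel" and K = "jump_operator \<mu>"])
     (use assms survive_Suc survive_0 Green_jump_operator_le[OF \<mu>_pos] in auto)

text \<open>The left side averages over the height \<open>v\<close> at the killing time when killing falls between jumps \<open>m\<close>
  and \<open>m + 1\<close>: the climb from the last jump to height \<open>v\<close> takes the time \<open>v - upper l\<close>.\<close>

lemma survive_killing:
  assumes [measurable]: "F \<in> borel_measurable list_borel"
  shows "(\<integral>\<^sup>+\<omega>. (\<integral>\<^sup>+v. ennreal (\<mu> * exp (- \<mu> * (snd (Z m \<omega>) + (v - upper (fst (Z m \<omega>)))))) * F (fst (Z m \<omega>) @ [v]) *
        indicator {upper (fst (Z m \<omega>))..<climb (upper (fst (Z m \<omega>))) (E m \<omega>)} v \<partial>lborel) \<partial>\<Omega>)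
     = survive m (killing_operator \<mu> F)"
    (is "(\<integral>\<^sup>+\<omega>. ?lhs \<omega> \<partial>\<Omega>) = _")
proof -
  define K where "K l e = (\<integral>\<^sup>+v. ennreal (\<mu> * exp (- \<mu> * (v - upper l))) * F (l @ [v]) *
        indicator {upper l..<climb (upper l) e} v \<partial>lborel)" for l e
  have ind: "indicator {a..<b} v = (indicator {a..} v * indicator {..<b} v :: ennreal)" for a b v :: real
    by (auto split: split_indicator)
  have [measurable (raw)]: "Measurable.pred N (\<lambda>x. g x \<in> {f x..})" if [measurable]: "f \<in> borel_measurable N" "g \<in> borel_measurable N"
    for N :: "'c measure" and f g :: "'c \<Rightarrow> real"
    unfolding atLeast_iff by measurable
  have K[measurable]: "(\<lambda>x. K (fst (fst x)) (fst (snd x))) \<in> borel_measurable ((list_borel \<Otimes>\<^sub>M borel) \<Otimes>\<^sub>M borel \<Otimes>\<^sub>M (borel :: real measure))"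
    unfolding K_def case_prod_beta ind by measurable
  have [measurable]: "K l \<in> borel_measurable borel" for l
    unfolding K_def[abs_def] case_prod_beta ind by measurable
  interpret SU: prob_space standard_uniform
    unfolding distr_U[of 0, symmetric] by (rule prob_space_distr) measurable
  have "(\<integral>\<^sup>+\<omega>. ?lhs \<omega> \<partial>\<Omega>)
    = (\<integral>\<^sup>+\<omega>. (\<lambda>z e u. ennreal (exp (- \<mu> * snd z)) * K (fst z) e) (Z m \<omega>) (E m \<omega>) (U m \<omega>) \<partial>\<Omega>)"
  proof (rule nn_integral_cong)
    fix \<omega>
    obtain l p where z: "Z m \<omega> = (l, p)" by (cases "Z m \<omega>")
    have "ennreal (\<mu> * exp (- \<mu> * (p + (v - upper l)))) = ennreal (exp (- \<mu> * p)) * ennreal (\<mu> * exp (- \<mu> * (v - upper l)))" for v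
      using \<mu>_pos by (simp add: ennreal_mult[symmetric] exp_add[symmetric] algebra_simps)
    then show "?lhs \<omega>
      = (\<lambda>z e u. ennreal (exp (- \<mu> * snd z)) * K (fst z) e) (Z m \<omega>) (E m \<omega>) (U m \<omega>)"
      unfolding z K_def by (simp add: mult.assoc nn_integral_cmult)
  qed
  also have "\<dots> = (\<integral>\<^sup>+\<omega>. (\<integral>\<^sup>+e. (\<integral>\<^sup>+u. ennreal (exp (- \<mu> * snd (Z m \<omega>))) * K (fst (Z m \<omega>)) e \<partial>standard_uniform) \<partial>standard_exponential) \<partial>\<Omega>)"
    by (rule nn_integral_noise_step) measurable
  also have "\<dots> = (\<integral>\<^sup>+\<omega>. ennreal (exp (- \<mu> * snd (Z m \<omega>))) * (\<integral>\<^sup>+e. K (fst (Z m \<omega>)) e \<partial>standard_exponential) \<partial>\<Omega>)"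
    by (intro nn_integral_cong) (simp add: nn_integral_cmult SU.emeasure_space_1[simplified])
  also have "\<dots> = survive m (killing_operator \<mu> F)"
    unfolding survive_def
  proof (rule nn_integral_cong_AE)
    show "AE \<omega> in \<Omega>. ennreal (exp (- \<mu> * snd (Z m \<omega>))) * (\<integral>\<^sup>+e. K (fst (Z m \<omega>)) e \<partial>standard_exponential)
      = ennreal (exp (- \<mu> * snd (Z m \<omega>))) * killing_operator \<mu> F (fst (Z m \<omega>))"
      using AE_upper_Z[of m]
    proof eventually_elim
      case (elim \<omega>)
      show ?case unfolding K_def using nn_integral_killing_kernel[OF \<mu>_pos elim assms] by simp
    qed
  qed
  finally show ?thesis .
qed

end

section \<open>Ladder indices at an exponential time\<close>

primrec ladder_list :: "(nat \<Rightarrow> real) \<Rightarrow> nat \<Rightarrow> real list" where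
  "ladder_list Q 0 = []"
| "ladder_list Q (Suc m) = cut_snoc (ladder_list Q m) (Q (Suc m))"

lemma upper_ladder_list: "Q 0 = 0 \<Longrightarrow> upper (ladder_list Q m) = Q m"
  by (cases m) auto

lemma measurable_ladder_list:
  assumes [measurable]: "\<And>i. (\<lambda>x. Q x i) \<in> borel_measurable N"
  shows "(\<lambda>x. ladder_list (Q x) m) \<in> N \<rightarrow>\<^sub>M list_borel"
  by (induction m) auto

lemma rayleigh_path_between:
  fixes P :: "nat \<Rightarrow> real"
  assumes "\<And>i. P i < P (Suc i)" "P i \<le> t" "t < P (Suc i)"
  shows "(LEAST i. t < P (Suc i)) = i"
proof (rule Least_equality)
  fix y assume "t < P (Suc y)"
  show "i \<le> y"
  proof (rule ccontr)
    assume "\<not> i \<le> y"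
    then have "Suc y \<le> i" by simp
    from lift_Suc_mono_le[of P, OF less_imp_le[OF assms(1)] this] have "P (Suc y) \<le> P i" .
    then show False using \<open>t < P (Suc y)\<close> assms(2) by simp
  qed
qed fact

lemma jump_hazard_eq:
  assumes "\<And>i. P i < P (Suc i)"
  shows "2 * jump_hazard P Q i = (Q i + (P (Suc i) - P i))\<^sup>2 - (Q i)\<^sup>2"
proof -
  have "((\<lambda>t. Q i + (t - P i)) has_integral ((Q i + (P (Suc i) - P i))\<^sup>2 / 2 - (Q i + (P i - P i))\<^sup>2 / 2)) {P i..P (Suc i)}"
  proof (rule fundamental_theorem_of_calculus)
    fix t
    have "((\<lambda>t. (Q i + (t - P i))\<^sup>2 / 2) has_real_derivative Q i + (t - P i)) (at t)"
      by (auto intro!: derivative_eq_intros)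
    then show "((\<lambda>t. (Q i + (t - P i))\<^sup>2 / 2) has_vector_derivative Q i + (t - P i)) (at t within {P i..P (Suc i)})"
      by (simp add: has_real_derivative_iff_has_vector_derivative has_vector_derivative_at_within)
  qed (use assms[of i] in simp)
  then have "(rayleigh_path P Q has_integral ((Q i + (P (Suc i) - P i))\<^sup>2 / 2 - (Q i + (P i - P i))\<^sup>2 / 2)) {P i..P (Suc i)}"
    by (rule has_integral_spike_finite[of "{P (Suc i)}", rotated 2])
       (auto simp: rayleigh_path_def rayleigh_path_between[of P, OF assms])
  then show ?thesis unfolding jump_hazard_def by (auto dest!: integral_unique)
qed

text \<open>The jump times and jump targets of the path are recovered from its hazards and jump fractions.\<close>

lemma driven_eq_path:
  fixes P Q :: "nat \<Rightarrow> real"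
  defines "E \<equiv> jump_hazard P Q" and "U \<equiv> \<lambda>i. Q (Suc i) / pre_jump_value P Q i"
  assumes P: "P 0 = 0" "\<And>i. P i < P (Suc i)" and Q0: "Q 0 = 0" and U: "\<And>i. 0 < U i"
  shows "Q m \<ge> 0 \<and> driven E U m = (ladder_list Q m, P m) \<and> climb (Q m) (E m) = Q m + (P (Suc m) - P m)"
proof -
  have V: "climb (Q m) (E m) = Q m + (P (Suc m) - P m)" if "Q m \<ge> 0" for m
  proof -
    have "(Q m)\<^sup>2 + 2 * E m = (Q m + (P (Suc m) - P m))\<^sup>2"
      unfolding E_def using jump_hazard_eq[of P Q m, OF P(2)] by linarith
    moreover have "Q m + (P (Suc m) - P m) \<ge> 0" using that P(2)[of m] by linarith
    ultimately show ?thesis by (simp only: real_sqrt_abs abs_of_nonneg)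
  qed
  have "Q m \<ge> 0 \<and> driven E U m = (ladder_list Q m, P m)"
  proof (induction m)
    case 0 then show ?case using P Q0 by simp
  next
    case (Suc m)
    have v: "U m * (Q m + (P (Suc m) - P m)) = Q (Suc m)"
      using Suc P(2)[of m] by (simp add: U_def pre_jump_value_def)
    then have "Q (Suc m) \<ge> 0"
      using mult_nonneg_nonneg[of "U m" "Q m + (P (Suc m) - P m)"] Suc P(2)[of m] U[of m] by simp
    moreover have D: "driven E U m = (ladder_list Q m, P m)" and s: "climb (Q m) (E m) = Q m + (P (Suc m) - P m)"
      using Suc V[of m] by auto
    have "driven E U (Suc m) = (ladder_list Q (Suc m), P (Suc m))"
      unfolding driven.simps D Let_def prod.case upper_ladder_list[of Q, OF Q0] s v by simp
    ultimately show ?case by simp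
  qed
  then show ?thesis using V by auto
qed

text \<open>The ladder indices at time \<open>t\<close>, followed by the height at time \<open>t\<close>.\<close>

definition stopped_list :: "(nat \<Rightarrow> real) \<Rightarrow> (nat \<Rightarrow> real) \<Rightarrow> real \<Rightarrow> real list" where
  "stopped_list P Q t = (let m = (LEAST i. t < P (Suc i)) in ladder_list Q m @ [Q m + (t - P m)])"

locale killed_rayleigh = prob_space \<Omega> for \<Omega> :: "'b measure" +
  fixes P Q :: "nat \<Rightarrow> 'b \<Rightarrow> real" and T :: "'b \<Rightarrow> real" and \<mu> :: real
  assumes rayleigh: "rayleigh_process \<Omega> P Q"
    and T_distr: "distributed \<Omega> lborel T (exponential_density \<mu>)"
    and T_indep: "independent_elements \<Omega> pair_seq_algebra (\<lambda>\<omega> i. (P i \<omega>, Q i \<omega>)) borel T"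
    and \<mu>: "\<mu> > 0"

sublocale killed_rayleigh \<subseteq> driving_noise \<Omega> "\<lambda>i \<omega>. jump_hazard (\<lambda>j. P j \<omega>) (\<lambda>j. Q j \<omega>) i"
    "\<lambda>i \<omega>. Q (Suc i) \<omega> / pre_jump_value (\<lambda>j. P j \<omega>) (\<lambda>j. Q j \<omega>) i" \<mu>
  by unfold_locales (use rayleigh \<mu> in \<open>auto simp: rayleigh_process_def Let_def\<close>)

context killed_rayleigh
begin

abbreviation "jumps \<omega> \<equiv> (\<lambda>i. (P i \<omega>, Q i \<omega>))"
abbreviation "hazard m \<omega> \<equiv> jump_hazard (\<lambda>j. P j \<omega>) (\<lambda>j. Q j \<omega>) m"
abbreviation "stopped \<omega> \<equiv> stopped_list (\<lambda>i. P i \<omega>) (\<lambda>i. Q i \<omega>) (T \<omega>)"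
abbreviation "level \<omega> \<equiv> rayleigh_path (\<lambda>i. P i \<omega>) (\<lambda>i. Q i \<omega>) (T \<omega>)"
abbreviation "ladder \<omega> \<equiv> map (\<lambda>i. Q i \<omega>) (sorted_list_of_set (ladder_jumps (\<lambda>i. P i \<omega>) (\<lambda>i. Q i \<omega>) (T \<omega>)))"

lemma measurable_P [measurable]: "P i \<in> borel_measurable \<Omega>" and measurable_Q [measurable]: "Q i \<in> borel_measurable \<Omega>"
  using rayleigh by (auto simp: rayleigh_process_def)

lemma measurable_T [measurable]: "T \<in> borel_measurable \<Omega>"
  using distributed_measurable[OF T_distr] by simp

lemma distr_T: "distr \<Omega> borel T = density lborel (exponential_density \<mu>)"
  unfolding distributed_distr_eq_density[OF T_distr, symmetric] by (rule distr_cong) auto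

text \<open>The almost sure properties of the path in the form in which they are needed pointwise.\<close>

definition path_good where
  "path_good \<omega> \<longleftrightarrow> P 0 \<omega> = 0 \<and> Q 0 \<omega> = 0 \<and> (\<forall>i. P i \<omega> < P (Suc i) \<omega>) \<and>
     (\<forall>m. Q m \<omega> \<ge> 0 \<and> Z m \<omega> = (ladder_list (\<lambda>i. Q i \<omega>) m, P m \<omega>) \<and>
      climb (Q m \<omega>) (hazard m \<omega>) = Q m \<omega> + (P (Suc m) \<omega> - P m \<omega>))"

lemma AE_path_good: "AE \<omega> in \<Omega>. path_good \<omega>"
proof -
  have "AE \<omega> in \<Omega>. P 0 \<omega> = 0 \<and> Q 0 \<omega> = 0 \<and> (\<forall>i. P i \<omega> < P (Suc i) \<omega>)"
    using rayleigh by (simp add: rayleigh_process_def)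
  with AE_noise show ?thesis
  proof eventually_elim
    case (elim \<omega>)
    then show ?case
      unfolding path_good_def Z_def
      using driven_eq_path[of "\<lambda>i. P i \<omega>" "\<lambda>i. Q i \<omega>"] by auto
  qed
qed

lemma path_good_P_nonneg: "path_good \<omega> \<Longrightarrow> P m \<omega> \<ge> 0"
proof -
  assume g: "path_good \<omega>"
  then have "P i \<omega> \<le> P (Suc i) \<omega>" for i by (simp add: path_good_def less_imp_le)
  from lift_Suc_mono_le[of "\<lambda>i. P i \<omega>", OF this, of 0 m] have "P 0 \<omega> \<le> P m \<omega>" by simp
  then show "P m \<omega> \<ge> 0" using g by (simp add: path_good_def)
qed

lemma nn_integral_T:
  assumes h: "h \<in> borel_measurable (pair_seq_algebra \<Otimes>\<^sub>M borel)"
  shows "(\<integral>\<^sup>+\<omega>. h (jumps \<omega>, T \<omega>) \<partial>\<Omega>) =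
    (\<integral>\<^sup>+\<omega>. (\<integral>\<^sup>+t. ennreal (exponential_density \<mu> t) * h (jumps \<omega>, t) \<partial>lborel) \<partial>\<Omega>)"
proof -
  have [measurable]: "(\<lambda>t. h (x, t)) \<in> borel_measurable borel" if "x \<in> space pair_seq_algebra" for x
    using measurable_compose[OF measurable_Pair1'[OF that] h] by simp
  have "(\<integral>\<^sup>+\<omega>. h (jumps \<omega>, T \<omega>) \<partial>\<Omega>) = (\<integral>\<^sup>+\<omega>. (\<integral>\<^sup>+t. h (jumps \<omega>, t) \<partial>distr \<Omega> borel T) \<partial>\<Omega>)"
    by (rule independent_elements_nn_integral[OF prob_space_axioms T_indep h])
  also have "\<dots> = (\<integral>\<^sup>+\<omega>. (\<integral>\<^sup>+t. ennreal (exponential_density \<mu> t) * h (jumps \<omega>, t) \<partial>lborel) \<partial>\<Omega>)"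
    unfolding distr_T by (intro nn_integral_cong nn_integral_density) (auto simp: space_PiM space_pair_measure)
  finally show ?thesis .
qed

lemma measurable_pair_seq [measurable]:
  "(\<lambda>z. fst (fst z i)) \<in> borel_measurable (pair_seq_algebra \<Otimes>\<^sub>M borel)"
  "(\<lambda>z. snd (fst z i)) \<in> borel_measurable (pair_seq_algebra \<Otimes>\<^sub>M borel)"
  by measurable

text \<open>The killing time is integrated out given the path; the substitution \<open>t = P\<^sub>m + (v - Q\<^sub>m)\<close> replaces
  the time between the jumps \<open>m\<close> and \<open>m + 1\<close> by the height.\<close>

lemma nn_integral_killed:
  assumes [measurable]: "F \<in> borel_measurable list_borel"
  shows "(\<integral>\<^sup>+\<omega>. indicator {P m \<omega>..<P (Suc m) \<omega>} (T \<omega>) * F (ladder_list (\<lambda>i. Q i \<omega>) m @ [Q m \<omega> + (T \<omega> - P m \<omega>)]) \<partial>\<Omega>)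
    = survive m (killing_operator \<mu> F)"
proof -
  define h where "h z = (if fst (fst z m) \<le> snd z \<and> snd z < fst (fst z (Suc m)) then
    F (ladder_list (\<lambda>i. snd (fst z i)) m @ [snd (fst z m) + (snd z - fst (fst z m))]) else 0)"
    for z :: "(nat \<Rightarrow> real \<times> real) \<times> real"
  have [measurable]: "(\<lambda>z. ladder_list (\<lambda>i. snd (fst z i)) m) \<in> (pair_seq_algebra \<Otimes>\<^sub>M borel) \<rightarrow>\<^sub>M list_borel"
    by (rule measurable_ladder_list) measurable
  have h: "h \<in> borel_measurable (pair_seq_algebra \<Otimes>\<^sub>M borel)"
    unfolding h_def[abs_def] by measurable
  have hx: "(\<lambda>t. h (x, t)) \<in> borel_measurable borel" for x
    by (rule measurable_compose[OF measurable_Pair1' h]) (auto simp: space_PiM space_pair_measure)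
  have "(\<integral>\<^sup>+\<omega>. indicator {P m \<omega>..<P (Suc m) \<omega>} (T \<omega>) * F (ladder_list (\<lambda>i. Q i \<omega>) m @ [Q m \<omega> + (T \<omega> - P m \<omega>)]) \<partial>\<Omega>)
    = (\<integral>\<^sup>+\<omega>. h (jumps \<omega>, T \<omega>) \<partial>\<Omega>)"
    by (intro nn_integral_cong) (auto simp: h_def)
  also have "\<dots> = (\<integral>\<^sup>+\<omega>. (\<integral>\<^sup>+t. ennreal (exponential_density \<mu> t) * h (jumps \<omega>, t) \<partial>lborel) \<partial>\<Omega>)"
    by (rule nn_integral_T[OF h])
  also have "\<dots> = (\<integral>\<^sup>+\<omega>. (\<integral>\<^sup>+v. ennreal (\<mu> * exp (- \<mu> * (snd (Z m \<omega>) + (v - upper (fst (Z m \<omega>)))))) * F (fst (Z m \<omega>) @ [v]) *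
        indicator {upper (fst (Z m \<omega>))..<climb (upper (fst (Z m \<omega>))) (hazard m \<omega>)} v \<partial>lborel) \<partial>\<Omega>)"
    (is "_ = (\<integral>\<^sup>+\<omega>. ?r \<omega> \<partial>\<Omega>)")
  proof (rule nn_integral_cong_AE)
    show "AE \<omega> in \<Omega>. (\<integral>\<^sup>+t. ennreal (exponential_density \<mu> t) * h (jumps \<omega>, t) \<partial>lborel)
       = ?r \<omega>"
      using AE_path_good
    proof eventually_elim
      case (elim \<omega>)
      note p = path_good_P_nonneg[OF elim, of m]
      have z: "Z m \<omega> = (ladder_list (\<lambda>i. Q i \<omega>) m, P m \<omega>)"
        and s: "climb (Q m \<omega>) (hazard m \<omega>) = Q m \<omega> + (P (Suc m) \<omega> - P m \<omega>)"
        and u: "upper (ladder_list (\<lambda>i. Q i \<omega>) m) = Q m \<omega>"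
        using elim by (auto simp: path_good_def upper_ladder_list)
      have "(\<integral>\<^sup>+t. ennreal (exponential_density \<mu> t) * h (jumps \<omega>, t) \<partial>lborel)
        = ennreal \<bar>1\<bar> * (\<integral>\<^sup>+v. ennreal (exponential_density \<mu> (P m \<omega> - Q m \<omega> + 1 * v)) * h (jumps \<omega>, P m \<omega> - Q m \<omega> + 1 * v) \<partial>lborel)"
        by (rule nn_integral_real_affine) (use hx in measurable)
      also have "\<dots> = (\<integral>\<^sup>+v. ennreal (exponential_density \<mu> (P m \<omega> - Q m \<omega> + v)) * h (jumps \<omega>, P m \<omega> - Q m \<omega> + v) \<partial>lborel)"
        by simp
      also have "\<dots> = (\<integral>\<^sup>+v. ennreal (\<mu> * exp (- \<mu> * (P m \<omega> + (v - Q m \<omega>)))) * F (ladder_list (\<lambda>i. Q i \<omega>) m @ [v]) *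
        indicator {Q m \<omega>..<Q m \<omega> + (P (Suc m) \<omega> - P m \<omega>)} v \<partial>lborel)"
        using p by (intro nn_integral_cong)
          (auto simp: h_def exponential_density_def algebra_simps split: split_indicator)
      finally show ?case unfolding z fst_conv snd_conv u s .
    qed
  qed
  also have "\<dots> = survive m (killing_operator \<mu> F)"
    by (rule survive_killing) measurable
  finally show ?thesis .
qed

lemma emeasure_not_killed: "emeasure \<Omega> {\<omega> \<in> space \<Omega>. P m \<omega> \<le> T \<omega>} = survive m (\<lambda>_. 1)"
proof -
  define h :: "(nat \<Rightarrow> real \<times> real) \<times> real \<Rightarrow> ennreal" where "h z = (if fst (fst z m) \<le> snd z then 1 else 0)" for z
  have h: "h \<in> borel_measurable (pair_seq_algebra \<Otimes>\<^sub>M borel)"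
    unfolding h_def[abs_def] by measurable
  have "emeasure \<Omega> {\<omega> \<in> space \<Omega>. P m \<omega> \<le> T \<omega>} = (\<integral>\<^sup>+\<omega>. indicator {\<omega> \<in> space \<Omega>. P m \<omega> \<le> T \<omega>} \<omega> \<partial>\<Omega>)"
    by simp
  also have "\<dots> = (\<integral>\<^sup>+\<omega>. h (jumps \<omega>, T \<omega>) \<partial>\<Omega>)"
    by (intro nn_integral_cong) (auto simp: h_def)
  also have "\<dots> = (\<integral>\<^sup>+\<omega>. (\<integral>\<^sup>+t. ennreal (exponential_density \<mu> t) * h (jumps \<omega>, t) \<partial>lborel) \<partial>\<Omega>)"
    by (rule nn_integral_T[OF h])
  also have "\<dots> = survive m (\<lambda>_. 1)"
    unfolding survive_def
  proof (rule nn_integral_cong_AE)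
    show "AE \<omega> in \<Omega>. (\<integral>\<^sup>+t. ennreal (exponential_density \<mu> t) * h (jumps \<omega>, t) \<partial>lborel)
      = ennreal (exp (- \<mu> * snd (Z m \<omega>))) * 1"
      using AE_path_good
    proof eventually_elim
      case (elim \<omega>)
      note p = path_good_P_nonneg[OF elim, of m]
      have z: "Z m \<omega> = (ladder_list (\<lambda>i. Q i \<omega>) m, P m \<omega>)" using elim by (auto simp: path_good_def)
      have "(\<integral>\<^sup>+t. ennreal (exponential_density \<mu> t) * h (jumps \<omega>, t) \<partial>lborel)
        = (\<integral>\<^sup>+t. ennreal (\<mu> * exp (- \<mu> * t)) * indicator {P m \<omega>..} t \<partial>lborel)"
        using p by (intro nn_integral_cong) (auto simp: h_def exponential_density_def mult.commute split: split_indicator)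
      also have "\<dots> = ennreal (- 0 - (- exp (- \<mu> * P m \<omega>)))"
      proof (rule nn_integral_FTC_atLeast)
        show "((\<lambda>t. - exp (- \<mu> * t)) \<longlongrightarrow> - 0) at_top"
          by (intro tendsto_minus exp_minus_tendsto \<mu>)
      qed (use \<mu> in \<open>auto intro!: derivative_eq_intros\<close>)
      finally show ?case unfolding z by simp
    qed
  qed
  finally show ?thesis .
qed

text \<open>The probabilities that killing comes after the \<open>m\<close>-th jump are summable, because their sum is at
  most the total mass of the Green function. Hence the jump times pass the killing time.\<close>

lemma AE_killed: "AE \<omega> in \<Omega>. path_good \<omega> \<and> (\<exists>m. P m \<omega> \<le> T \<omega> \<and> T \<omega> < P (Suc m) \<omega>)"
proof -
  have "(\<Sum>m. survive m (\<lambda>_. 1)) \<le> Green \<mu> (\<lambda>_. 1)"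
    by (rule suminf_survive_le_Green) simp
  also have "\<dots> < \<infinity>"
    using suminf_extend_power_survival_finite[OF \<mu>] by (simp add: Green_def)
  finally have fin: "(\<Sum>m. emeasure \<Omega> {\<omega> \<in> space \<Omega>. P m \<omega> \<le> T \<omega>}) < \<infinity>"
    by (simp add: emeasure_not_killed)
  have "AE x in distr \<Omega> borel T. 0 \<le> x"
    unfolding distr_T by (subst AE_density) (auto simp: exponential_density_def)
  then have "AE \<omega> in \<Omega>. 0 \<le> T \<omega>" by (subst (asm) AE_distr_iff) auto
  with AE_path_good have "AE \<omega> in \<Omega>. P 0 \<omega> \<le> T \<omega>" by eventually_elim (simp add: path_good_def)
  then have "AE \<omega> in \<Omega>. \<exists>m. P m \<omega> \<le> T \<omega> \<and> \<not> P (Suc m) \<omega> \<le> T \<omega>"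
    using fin by (intro AE_last_success) measurable
  with AE_path_good show ?thesis by eventually_elim (auto simp: not_le)
qed

text \<open>The process is killed in exactly one of the intervals between successive jumps, and the sum over
  these intervals is the Green functional of the killing operator.\<close>

lemma nn_integral_stopped_list_le:
  assumes [measurable]: "F \<in> borel_measurable list_borel"
  shows "(\<integral>\<^sup>+\<omega>. F (stopped \<omega>) \<partial>\<Omega>) \<le> ladder_law \<mu> F"
proof -
  let ?f = "\<lambda>m \<omega>. indicator {P m \<omega>..<P (Suc m) \<omega>} (T \<omega>) * F (ladder_list (\<lambda>i. Q i \<omega>) m @ [Q m \<omega> + (T \<omega> - P m \<omega>)])"
  have [measurable]: "(\<lambda>\<omega>. ladder_list (\<lambda>i. Q i \<omega>) m) \<in> \<Omega> \<rightarrow>\<^sub>M list_borel" for m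
    by (rule measurable_ladder_list) measurable
  have [measurable]: "?f m \<in> borel_measurable \<Omega>" for m
  proof -
    have "(\<lambda>\<omega>. if P m \<omega> \<le> T \<omega> \<and> T \<omega> < P (Suc m) \<omega> then F (ladder_list (\<lambda>i. Q i \<omega>) m @ [Q m \<omega> + (T \<omega> - P m \<omega>)]) else 0) \<in> borel_measurable \<Omega>"
      by measurable
    then show ?thesis by (rule measurable_cong[THEN iffD1, rotated]) auto
  qed
  have "(\<integral>\<^sup>+\<omega>. F (stopped \<omega>) \<partial>\<Omega>) = (\<integral>\<^sup>+\<omega>. (\<Sum>m. ?f m \<omega>) \<partial>\<Omega>)"
  proof (rule nn_integral_cong_AE)
    show "AE \<omega> in \<Omega>. F (stopped \<omega>) = (\<Sum>m. ?f m \<omega>)"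
      using AE_killed
    proof eventually_elim
      case (elim \<omega>)
      then obtain m where m: "P m \<omega> \<le> T \<omega>" "T \<omega> < P (Suc m) \<omega>" and P: "\<And>i. P i \<omega> < P (Suc i) \<omega>"
        by (auto simp: path_good_def)
      note L = rayleigh_path_between[of "\<lambda>i. P i \<omega>", OF P]
      have 0: "?f n \<omega> = 0" if "n \<noteq> m" for n
        using L[OF m] L[of n "T \<omega>"] that by (auto split: split_indicator)
      have "(\<Sum>n. ?f n \<omega>) = (\<Sum>n\<in>{m}. ?f n \<omega>)"
        by (rule suminf_finite) (use 0 in auto)
      then show ?case unfolding stopped_list_def L[OF m] using m by simp
    qed
  qed
  also have "\<dots> = (\<Sum>m. \<integral>\<^sup>+\<omega>. ?f m \<omega> \<partial>\<Omega>)"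
    by (rule nn_integral_suminf) measurable
  also have "\<dots> = (\<Sum>m. survive m (killing_operator \<mu> F))"
    by (simp only: nn_integral_killed[OF assms])
  also have "\<dots> \<le> Green \<mu> (killing_operator \<mu> F)"
    by (rule suminf_survive_le_Green) measurable
  also have "\<dots> = ladder_law \<mu> F" by (rule Green_killing_operator)
  finally show ?thesis .
qed

end

section \<open>Discrete sums and iterated integrals\<close>

text \<open>The discrete counterpart of \<open>extend\<close>, with weight \<open>r j\<close> for the entry \<open>j\<close>.\<close>

definition dextend :: "(nat \<Rightarrow> ennreal) \<Rightarrow> (nat list \<Rightarrow> ennreal) \<Rightarrow> nat list \<Rightarrow> ennreal" where
  "dextend r F l = (\<Sum>j. if upper l < j then r j * F (l @ [j]) else 0)"

text \<open>Convergence of integer lists \<open>L N\<close>, on a grid of mesh \<open>h N\<close>, to a list of real numbers.\<close>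

definition grid_tendsto :: "(nat \<Rightarrow> real) \<Rightarrow> (nat \<Rightarrow> nat list) \<Rightarrow> real list \<Rightarrow> bool" where
  "grid_tendsto h L l \<longleftrightarrow> (\<forall>N. length (L N) = length l) \<and>
     (\<forall>i<length l. (\<lambda>N. h N * real (L N ! i)) \<longlonglongrightarrow> l ! i)"

text \<open>Lower semicontinuity along grid lists. It is preserved under summation over new entries, by Fatou's
  lemma.\<close>

definition grid_lsc :: "(nat \<Rightarrow> real) \<Rightarrow> (nat \<Rightarrow> nat list \<Rightarrow> ennreal) \<Rightarrow> (real list \<Rightarrow> ennreal) \<Rightarrow> bool" where
  "grid_lsc h F G \<longleftrightarrow> (\<forall>L l. grid_tendsto h L l \<longrightarrow> G l \<le> liminf (\<lambda>N. F N (L N)))"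

lemma liminf_mult_ge_ennreal:
  fixes a b :: "nat \<Rightarrow> ennreal"
  assumes "x \<le> liminf a" "y \<le> liminf b"
  shows "x * y \<le> liminf (\<lambda>n. a n * b n)"
proof -
  have eq: "(SUP n. (INF m\<in>{n..}. a m)) * (SUP n. (INF m\<in>{n..}. b m)) = (SUP n. (INF m\<in>{n..}. a m) * (INF m\<in>{n..}. b m))"
  proof (rule antisym)
    show "(SUP n. (INF m\<in>{n..}. a m)) * (SUP n. (INF m\<in>{n..}. b m)) \<le> (SUP n. (INF m\<in>{n..}. a m) * (INF m\<in>{n..}. b m))"
    proof (subst SUP_mult_right_ennreal, rule SUP_least, subst SUP_mult_left_ennreal, rule SUP_least)
      fix i j
      have "(INF m\<in>{i..}. a m) * (INF m\<in>{j..}. b m) \<le> (INF m\<in>{max i j..}. a m) * (INF m\<in>{max i j..}. b m)"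
        by (intro mult_mono INF_superset_mono) auto
      also have "\<dots> \<le> (SUP n. (INF m\<in>{n..}. a m) * (INF m\<in>{n..}. b m))" by (rule SUP_upper) simp
      finally show "(INF m\<in>{i..}. a m) * (INF m\<in>{j..}. b m) \<le> (SUP n. (INF m\<in>{n..}. a m) * (INF m\<in>{n..}. b m))" .
    qed
  qed (auto intro!: SUP_least mult_mono SUP_upper)
  have "x * y \<le> liminf a * liminf b" using assms by (intro mult_mono) auto
  also have "\<dots> = (SUP n. (INF m\<in>{n..}. a m) * (INF m\<in>{n..}. b m))"
    unfolding liminf_SUP_INF eq ..
  also have "\<dots> \<le> liminf (\<lambda>n. a n * b n)"
    unfolding liminf_SUP_INF
    by (intro SUP_mono') (auto intro!: INF_greatest mult_mono INF_lower)
  finally show ?thesis .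
qed

text \<open>The integrand is a step function, equal to \<open>f j\<close> on the \<open>j\<close>-th cell \<open>(h (j - 1), h j]\<close>. The
  inequality is strict in general: the cell of \<open>j = 0\<close> does not meet the positive half-line.\<close>

lemma nn_integral_step_le:
  fixes f :: "nat \<Rightarrow> ennreal"
  assumes h: "h > 0"
  shows "(\<integral>\<^sup>+x\<in>{0<..}. f (nat \<lceil>x / h\<rceil>) \<partial>lborel) \<le> ennreal h * (\<Sum>j. f j)"
proof -
  have "f (nat \<lceil>x / h\<rceil>) * indicator {0<..} x = (\<Sum>j. f j * indicator {h * (real j - 1)<..h * real j} x * indicator {0<..} x)" for x
  proof (cases "x > 0")
    case True
    define k where "k = nat \<lceil>x / h\<rceil>"
    have "x / h > 0" using True h by simp
    then have k: "real k - 1 < x / h" "x / h \<le> real k"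
      unfolding k_def by (auto simp: of_nat_nat) linarith+
    have in_k: "x \<in> {h * (real j - 1)<..h * real j} \<longleftrightarrow> j = k" for j
    proof
      assume "x \<in> {h * (real j - 1)<..h * real j}"
      then have "real j - 1 < x / h" "x / h \<le> real j" using h by (auto simp: field_simps)
      with k show "j = k" by linarith
    qed (use k h in \<open>auto simp: field_simps\<close>)
    have "(\<Sum>j. f j * indicator {h * (real j - 1)<..h * real j} x * indicator {0<..} x)
       = (\<Sum>j\<in>{k}. f j * indicator {h * (real j - 1)<..h * real j} x * indicator {0<..} x)"
      by (rule suminf_finite) (simp_all add: in_k indicator_def del: greaterThanAtMost_iff)
    also have "\<dots> = f k * indicator {0<..} x" using in_k[of k] by (simp add: indicator_def del: greaterThanAtMost_iff)
    finally show ?thesis by (simp add: k_def)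
  qed simp
  then have "(\<integral>\<^sup>+x\<in>{0<..}. f (nat \<lceil>x / h\<rceil>) \<partial>lborel)
    = (\<integral>\<^sup>+x. (\<Sum>j. f j * indicator {h * (real j - 1)<..h * real j} x * indicator {0<..} x) \<partial>lborel)"
    by simp
  also have "\<dots> = (\<Sum>j. \<integral>\<^sup>+x. f j * indicator {h * (real j - 1)<..h * real j} x * indicator {0<..} x \<partial>lborel)"
    by (rule nn_integral_suminf) measurable
  also have "\<dots> \<le> (\<Sum>j. ennreal h * f j)"
  proof (rule suminf_le)
    fix j
    have "(\<integral>\<^sup>+x. f j * indicator {h * (real j - 1)<..h * real j} x * indicator {0<..} x \<partial>lborel)
      \<le> (\<integral>\<^sup>+x. f j * indicator {h * (real j - 1)<..h * real j} x \<partial>lborel)"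
      by (intro nn_integral_mono) (auto split: split_indicator)
    also have "\<dots> = f j * ennreal (h * real j - h * (real j - 1))"
      using h by (subst nn_integral_cmult_indicator) (auto simp: algebra_simps)
    also have "h * real j - h * (real j - 1) = h" by (simp add: algebra_simps)
    finally show "(\<integral>\<^sup>+x. f j * indicator {h * (real j - 1)<..h * real j} x * indicator {0<..} x \<partial>lborel) \<le> ennreal h * f j"
      by (simp add: mult.commute)
  qed auto
  also have "\<dots> = ennreal h * (\<Sum>j. f j)" by simp
  finally show ?thesis .
qed

lemma ceiling_grid_tendsto:
  assumes "\<And>N. h N > 0" "h \<longlonglongrightarrow> 0" "x > 0"
  shows "(\<lambda>N. h N * real (nat \<lceil>x / h N\<rceil>)) \<longlonglongrightarrow> x"
proof (rule tendsto_sandwich)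
  show "\<forall>\<^sub>F N in sequentially. x \<le> h N * real (nat \<lceil>x / h N\<rceil>)"
  proof (rule always_eventually, rule allI)
    fix N
    have "x / h N \<le> real (nat \<lceil>x / h N\<rceil>)" by linarith
    then show "x \<le> h N * real (nat \<lceil>x / h N\<rceil>)" using assms(1)[of N] by (simp add: field_simps)
  qed
  show "\<forall>\<^sub>F N in sequentially. h N * real (nat \<lceil>x / h N\<rceil>) \<le> x + h N"
  proof (rule always_eventually, rule allI)
    fix N
    have "x / h N > 0" using assms by simp
    then have "real (nat \<lceil>x / h N\<rceil>) \<le> x / h N + 1" by linarith
    then show "h N * real (nat \<lceil>x / h N\<rceil>) \<le> x + h N" using assms(1)[of N] by (simp add: field_simps)
  qed
  show "(\<lambda>N. x + h N) \<longlonglongrightarrow> x" using tendsto_add[OF tendsto_const assms(2), of x] by simp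
qed simp

lemma grid_tendsto_upper:
  assumes "grid_tendsto h L l"
  shows "(\<lambda>N. h N * real (upper (L N))) \<longlonglongrightarrow> upper l"
proof (cases "l = []")
  case True
  then have "L N = []" for N using assms by (auto simp: grid_tendsto_def)
  then show ?thesis using True by simp
next
  case False
  then have "upper (L N) = L N ! (length l - 1)" for N
    using assms by (auto simp: grid_tendsto_def upper_def last_conv_nth)
      (metis last_conv_nth length_0_conv)
  moreover have "upper l = l ! (length l - 1)" using False by (simp add: upper_def last_conv_nth)
  ultimately show ?thesis using assms False by (simp add: grid_tendsto_def)
qed

lemma grid_tendsto_snoc:
  assumes "grid_tendsto h L l" "(\<lambda>N. h N * real (j N)) \<longlonglongrightarrow> x"
  shows "grid_tendsto h (\<lambda>N. L N @ [j N]) (l @ [x])"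
  using assms by (auto simp: grid_tendsto_def nth_append less_Suc_eq)

text \<open>The discrete sum, as the integral of a step function, falls under Fatou's lemma.\<close>

lemma grid_lsc_extend:
  assumes h: "\<And>N. h N > 0" "h \<longlonglongrightarrow> 0"
    and r: "\<And>j x. x > 0 \<Longrightarrow> (\<lambda>N. h N * real (j N)) \<longlonglongrightarrow> x \<Longrightarrow> \<rho> x \<le> liminf (\<lambda>N. r N (j N) / ennreal (h N))"
    and F: "grid_lsc h F G"
  shows "grid_lsc h (\<lambda>N. dextend (r N) (F N)) (extend \<rho> G)"
  unfolding grid_lsc_def
proof (intro allI impI)
  fix L l assume Ll: "grid_tendsto h L l"
  note up = grid_tendsto_upper[OF Ll]
  have ul: "upper l \<ge> 0"
    by (rule tendsto_lowerbound[OF up]) (auto intro!: always_eventually simp: h(1) less_imp_le)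
  define g where "g N j = (if upper (L N) < j then r N j / ennreal (h N) * F N (L N @ [j]) else 0)" for N j
  have "extend \<rho> G l \<le> (\<integral>\<^sup>+x. liminf (\<lambda>N. g N (nat \<lceil>x / h N\<rceil>) * indicator {0<..} x) \<partial>lborel)"
    unfolding extend_def
  proof (rule nn_integral_mono)
    fix x
    show "\<rho> x * G (l @ [x]) * indicator {upper l<..} x \<le> liminf (\<lambda>N. g N (nat \<lceil>x / h N\<rceil>) * indicator {0<..} x)"
    proof (cases "x > upper l")
      case True
      then have x: "x > 0" using ul by simp
      note c = ceiling_grid_tendsto[OF h x]
      have "\<rho> x * G (l @ [x]) \<le> liminf (\<lambda>N. r N (nat \<lceil>x / h N\<rceil>) / ennreal (h N) * F N (L N @ [nat \<lceil>x / h N\<rceil>]))"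
        by (rule liminf_mult_ge_ennreal[OF r[OF x c]])
           (use F grid_tendsto_snoc[OF Ll c] in \<open>auto simp: grid_lsc_def\<close>)
      also have "\<dots> \<le> liminf (\<lambda>N. g N (nat \<lceil>x / h N\<rceil>) * indicator {0<..} x)"
      proof (rule Liminf_mono)
        have "(\<lambda>N. h N * real (nat \<lceil>x / h N\<rceil>) - h N * real (upper (L N))) \<longlonglongrightarrow> x - upper l"
          by (intro tendsto_diff c up)
        then have "\<forall>\<^sub>F N in sequentially. h N * real (nat \<lceil>x / h N\<rceil>) - h N * real (upper (L N)) > 0"
          by (rule order_tendstoD(1)) (use True in simp)
        then show "\<forall>\<^sub>F N in sequentially. r N (nat \<lceil>x / h N\<rceil>) / ennreal (h N) * F N (L N @ [nat \<lceil>x / h N\<rceil>])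
           \<le> g N (nat \<lceil>x / h N\<rceil>) * indicator {0<..} x"
        proof eventually_elim
          case (elim N)
          then have "upper (L N) < nat \<lceil>x / h N\<rceil>" using h(1)[of N] by auto
          then show ?case using x by (simp add: g_def)
        qed
      qed
      finally show ?thesis using True by simp
    qed simp
  qed
  also have "\<dots> \<le> liminf (\<lambda>N. \<integral>\<^sup>+x. g N (nat \<lceil>x / h N\<rceil>) * indicator {0<..} x \<partial>lborel)"
  proof (rule nn_integral_liminf)
    fix N
    have "(\<lambda>x. nat \<lceil>x / h N\<rceil>) \<in> borel \<rightarrow>\<^sub>M count_space UNIV" by measurable
    from measurable_compose[OF this, of "g N" borel]
    have [measurable]: "(\<lambda>x. g N (nat \<lceil>x / h N\<rceil>)) \<in> borel_measurable borel" by simp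
    show "(\<lambda>x. g N (nat \<lceil>x / h N\<rceil>) * indicator {0<..} x) \<in> borel_measurable lborel" by measurable
  qed
  also have "\<dots> \<le> liminf (\<lambda>N. dextend (r N) (F N) (L N))"
  proof (rule Liminf_mono, rule always_eventually, rule allI)
    fix N
    have "(\<integral>\<^sup>+x. g N (nat \<lceil>x / h N\<rceil>) * indicator {0<..} x \<partial>lborel) \<le> ennreal (h N) * (\<Sum>j. g N j)"
      by (rule nn_integral_step_le[OF h(1)])
    also have "\<dots> = (\<Sum>j. ennreal (h N) * g N j)" by simp
    also have "\<dots> = dextend (r N) (F N) (L N)"
      unfolding dextend_def g_def using h(1)[of N]
      by (intro suminf_cong) (auto simp: mult.assoc[symmetric] ennreal_mult_divide_cancel)
    finally show "(\<integral>\<^sup>+x. g N (nat \<lceil>x / h N\<rceil>) * indicator {0<..} x \<partial>lborel) \<le> dextend (r N) (F N) (L N)" .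
  qed
  finally show "extend \<rho> G l \<le> liminf (\<lambda>N. dextend (r N) (F N) (L N))" .
qed

lemma grid_lsc_extend_power:
  assumes "\<And>N. h N > 0" "h \<longlonglongrightarrow> 0"
    and "\<And>j x. x > 0 \<Longrightarrow> (\<lambda>N. h N * real (j N)) \<longlonglongrightarrow> x \<Longrightarrow> \<rho> x \<le> liminf (\<lambda>N. r N (j N) / ennreal (h N))"
    and "grid_lsc h F G"
  shows "grid_lsc h (\<lambda>N. (dextend (r N) ^^ n) (F N)) ((extend \<rho> ^^ n) G)"
  by (induction n) (use assms in \<open>auto intro!: grid_lsc_extend\<close>)

lemma suminf_liminf_le_ennreal:
  fixes f :: "nat \<Rightarrow> nat \<Rightarrow> ennreal"
  shows "(\<Sum>n. liminf (\<lambda>N. f N n)) \<le> liminf (\<lambda>N. \<Sum>n. f N n)"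
  using nn_integral_liminf[of f "count_space UNIV"] by (simp add: nn_integral_count_space_nat)

lemma grid_liminf_suminf:
  assumes "\<And>N. h N > 0" "h \<longlonglongrightarrow> 0"
    and "\<And>j x. x > 0 \<Longrightarrow> (\<lambda>N. h N * real (j N)) \<longlonglongrightarrow> x \<Longrightarrow> \<rho> x \<le> liminf (\<lambda>N. r N (j N) / ennreal (h N))"
    and "grid_lsc h F G"
  shows "(\<Sum>n. (extend \<rho> ^^ n) G []) \<le> liminf (\<lambda>N. \<Sum>n. (dextend (r N) ^^ n) (F N) [])"
proof -
  have "grid_tendsto h (\<lambda>_. []) []" by (simp add: grid_tendsto_def)
  then have "(extend \<rho> ^^ n) G [] \<le> liminf (\<lambda>N. (dextend (r N) ^^ n) (F N) [])" for n
    using grid_lsc_extend_power[where n = n, OF assms] by (auto simp: grid_lsc_def)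
  then have "(\<Sum>n. (extend \<rho> ^^ n) G []) \<le> (\<Sum>n. liminf (\<lambda>N. (dextend (r N) ^^ n) (F N) []))"
    by (intro suminf_le) auto
  also have "\<dots> \<le> liminf (\<lambda>N. \<Sum>n. (dextend (r N) ^^ n) (F N) [])"
    by (rule suminf_liminf_le_ennreal)
  finally show ?thesis .
qed

definition extensions :: "nat \<Rightarrow> nat list \<Rightarrow> nat list set" where
  "extensions n l = {l @ l' | l'. length l' = n \<and> sorted_wrt (<) (upper l # l')}"

lemma extensions_0: "extensions 0 l = {l}"
  by (auto simp: extensions_def)

lemma extensions_Suc: "extensions (Suc n) l = (\<Union>j\<in>{upper l<..}. extensions n (l @ [j]))"
proof (intro set_eqI iffI)
  fix x assume "x \<in> extensions (Suc n) l"
  then obtain l' where l': "x = l @ l'" "length l' = Suc n" "sorted_wrt (<) (upper l # l')"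
    by (auto simp: extensions_def)
  then obtain j l'' where "l' = j # l''" by (cases l') auto
  then show "x \<in> (\<Union>j\<in>{upper l<..}. extensions n (l @ [j]))"
    using l' by (auto simp: extensions_def intro!: bexI[of _ j])
next
  fix x assume "x \<in> (\<Union>j\<in>{upper l<..}. extensions n (l @ [j]))"
  then obtain j l' where j: "j > upper l" "x = l @ [j] @ l'" "length l' = n" "sorted_wrt (<) (j # l')"
    by (auto simp: extensions_def)
  then have "sorted_wrt (<) (upper l # j # l')" by auto
  with j show "x \<in> extensions (Suc n) l"
    unfolding extensions_def by (intro CollectI exI[of _ "j # l'"]) auto
qed

text \<open>The events that \<open>C\<close> continues \<open>l @ [j]\<close>, for different \<open>j\<close>, are disjoint, so the lower bounds for
  the point probabilities of \<open>C\<close> add up along the recursion that defines the iterates of \<open>dextend\<close>.\<close>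

lemma dextend_power_le_nn_integral:
  assumes [measurable]: "C \<in> M \<rightarrow>\<^sub>M count_space UNIV"
    and prob: "\<And>l. sorted_wrt (<) (0 # l) \<Longrightarrow> W (upper l) * prod_list (map r l) \<le> emeasure M {\<omega> \<in> space M. C \<omega> = l}"
    and "sorted_wrt (<) (0 # l)"
  shows "prod_list (map r l) * (dextend r ^^ n) (\<lambda>l. W (upper l) * g l) l
     \<le> (\<integral>\<^sup>+\<omega>. indicator (extensions n l) (C \<omega>) * g (C \<omega>) \<partial>M)"
proof -
  let ?I = "\<lambda>n l \<omega>. indicator (extensions n l) (C \<omega>) * g (C \<omega>)"
  show ?thesis
    using assms(3)
  proof (induction n arbitrary: l)
    case 0
    have "(\<integral>\<^sup>+\<omega>. ?I 0 l \<omega> \<partial>M) = (\<integral>\<^sup>+\<omega>. g l * indicator {\<omega> \<in> space M. C \<omega> = l} \<omega> \<partial>M)"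
      by (intro nn_integral_cong) (auto simp: extensions_0 split: split_indicator)
    also have "\<dots> = g l * emeasure M {\<omega> \<in> space M. C \<omega> = l}"
      by (rule nn_integral_cmult_indicator) measurable
    finally have eq: "(\<integral>\<^sup>+\<omega>. ?I 0 l \<omega> \<partial>M) = g l * emeasure M {\<omega> \<in> space M. C \<omega> = l}" .
    show ?case unfolding eq using mult_left_mono[OF prob[OF 0], of "g l"] by (simp add: ac_simps)
  next
    case (Suc n)
    have ul: "\<forall>x\<in>set l. x \<le> upper l"
      using Suc.prems by (induction l rule: rev_induct) (auto simp: sorted_wrt_append)
    have so: "sorted_wrt (<) (0 # l @ [j])" if "j > upper l" for j
      using Suc.prems that ul by (auto simp: sorted_wrt_append)
    let ?F = "\<lambda>l. W (upper l) * g l"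
    have "prod_list (map r l) * (dextend r ^^ Suc n) ?F l
      = (\<Sum>j. prod_list (map r l) * (if upper l < j then r j * (dextend r ^^ n) ?F (l @ [j]) else 0))"
      by (simp add: dextend_def[of _ _ l])
    also have "\<dots> \<le> (\<Sum>j. \<integral>\<^sup>+\<omega>. (if upper l < j then ?I n (l @ [j]) \<omega> else 0) \<partial>M)"
    proof (rule suminf_le)
      fix j
      show "prod_list (map r l) * (if upper l < j then r j * (dextend r ^^ n) ?F (l @ [j]) else 0)
        \<le> (\<integral>\<^sup>+\<omega>. (if upper l < j then ?I n (l @ [j]) \<omega> else 0) \<partial>M)"
        using Suc.IH[OF so[of j]] by (auto simp: ac_simps)
    qed auto
    also have "\<dots> = (\<integral>\<^sup>+\<omega>. (\<Sum>j. if upper l < j then ?I n (l @ [j]) \<omega> else 0) \<partial>M)"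
      by (rule nn_integral_suminf[symmetric]) measurable
    also have "\<dots> = (\<integral>\<^sup>+\<omega>. ?I (Suc n) l \<omega> \<partial>M)"
    proof (rule nn_integral_cong)
      fix \<omega>
      show "(\<Sum>j. if upper l < j then ?I n (l @ [j]) \<omega> else 0)
         = ?I (Suc n) l \<omega>"
      proof (cases "C \<omega> \<in> extensions (Suc n) l")
        case True
        then obtain j where j: "j > upper l" "C \<omega> \<in> extensions n (l @ [j])" by (auto simp: extensions_Suc)
        have "j' = j" if "C \<omega> \<in> extensions n (l @ [j'])" for j' using that j(2) by (auto simp: extensions_def)
        then have "(\<Sum>j. if upper l < j then ?I n (l @ [j]) \<omega> else 0)
          = (\<Sum>j\<in>{j}. if upper l < j then ?I n (l @ [j]) \<omega> else 0)"
          by (intro suminf_finite) (auto split: split_indicator)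
        then show ?thesis using True j by simp
      next
        case False
        then have "(\<lambda>j. if upper l < j then ?I n (l @ [j]) \<omega> else 0) = (\<lambda>_. 0)"
          by (auto simp: extensions_Suc fun_eq_iff)
        then show ?thesis using False by simp
      qed
    qed
    finally show ?case .
  qed
qed

lemma suminf_dextend_le_nn_integral:
  assumes [measurable]: "C \<in> M \<rightarrow>\<^sub>M count_space UNIV"
    and "\<And>l. sorted_wrt (<) (0 # l) \<Longrightarrow> W (upper l) * prod_list (map r l) \<le> emeasure M {\<omega> \<in> space M. C \<omega> = l}"
  shows "(\<Sum>n. (dextend r ^^ n) (\<lambda>l. W (upper l) * g l) []) \<le> (\<integral>\<^sup>+\<omega>. g (C \<omega>) \<partial>M)"
proof -
  have "(\<Sum>n. (dextend r ^^ n) (\<lambda>l. W (upper l) * g l) []) \<le> (\<Sum>n. \<integral>\<^sup>+\<omega>. indicator (extensions n []) (C \<omega>) * g (C \<omega>) \<partial>M)"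
    using dextend_power_le_nn_integral[OF assms, of "[]"] by (intro suminf_le) auto
  also have "\<dots> = (\<integral>\<^sup>+\<omega>. (\<Sum>n. indicator (extensions n []) (C \<omega>) * g (C \<omega>)) \<partial>M)"
    by (rule nn_integral_suminf[symmetric]) measurable
  also have "\<dots> \<le> (\<integral>\<^sup>+\<omega>. g (C \<omega>) \<partial>M)"
  proof (rule nn_integral_mono)
    fix \<omega>
    have eq: "(\<Sum>n. indicator (extensions n []) (C \<omega>) * g (C \<omega>)) = (\<Sum>n\<in>{length (C \<omega>)}. indicator (extensions n []) (C \<omega>) * g (C \<omega>))"
      by (rule suminf_finite) (auto simp: extensions_def)
    show "(\<Sum>n. indicator (extensions n []) (C \<omega>) * g (C \<omega>)) \<le> g (C \<omega>)"
      unfolding eq by (cases "C \<omega> \<in> extensions (length (C \<omega>)) []") simp_all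
  qed
  finally show ?thesis .
qed

text \<open>Sequential continuity on the disjoint union of the spaces \<open>\<real>\<^sup>n\<close>.\<close>

definition list_continuous :: "(real list \<Rightarrow> ennreal) \<Rightarrow> bool" where
  "list_continuous f \<longleftrightarrow> (\<forall>L l. (\<forall>N. length (L N) = length l) \<and> (\<forall>i<length l. (\<lambda>N. L N ! i) \<longlonglongrightarrow> l ! i)
     \<longrightarrow> (\<lambda>N. f (L N)) \<longlonglongrightarrow> f l)"

lemma list_continuous_grid:
  assumes "list_continuous f" "grid_tendsto h L l"
  shows "(\<lambda>N. f (map (\<lambda>j. h N * real j) (L N))) \<longlonglongrightarrow> f l"
proof -
  have "(\<forall>N. length (map (\<lambda>j. h N * real j) (L N)) = length l) \<and>
    (\<forall>i<length l. (\<lambda>N. map (\<lambda>j. h N * real j) (L N) ! i) \<longlonglongrightarrow> l ! i)"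
    using assms(2) by (auto simp: grid_tendsto_def)
  then show ?thesis
    using assms(1)[unfolded list_continuous_def, rule_format, of "\<lambda>N. map (\<lambda>j. h N * real j) (L N)" l] by blast
qed

section \<open>Poisson points on a grid\<close>

definition points_list :: "(nat \<Rightarrow> real) \<Rightarrow> real \<Rightarrow> real list" where
  "points_list D r = map D [1..<Suc (Sup {i. 1 \<le> i \<and> D i < r})]"

text \<open>The list depends on \<open>D\<close> only through the number of points below \<open>r\<close> and through single coordinates.\<close>

lemma measurable_points_list:
  assumes [measurable]: "\<And>i. i \<ge> 1 \<Longrightarrow> (\<lambda>x. D x i) \<in> borel_measurable N" "r \<in> borel_measurable N"
  shows "(\<lambda>x. points_list (D x) (r x)) \<in> N \<rightarrow>\<^sub>M list_borel"
proof -
  have p: "Measurable.pred N (\<lambda>x. 1 \<le> i \<and> D x i < r x)" for i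
    by (cases "1 \<le> i") auto
  have [measurable]: "(\<lambda>x. Sup {i. 1 \<le> i \<and> D x i < r x}) \<in> N \<rightarrow>\<^sub>M count_space UNIV"
    by (rule measurable_Sup_nat) (simp add: p)
  show ?thesis
  proof (rule measurable_list_borelI)
    show "(\<lambda>x. length (points_list (D x) (r x))) \<in> N \<rightarrow>\<^sub>M count_space UNIV"
      unfolding points_list_def by simp
    fix i
    have [measurable]: "(\<lambda>x. D x (Suc i)) \<in> borel_measurable N" by simp
    have "(\<lambda>x. if i < length (points_list (D x) (r x)) then points_list (D x) (r x) ! i else 0)
      = (\<lambda>x. if i < Sup {i. 1 \<le> i \<and> D x i < r x} then D x (Suc i) else 0)"
      unfolding points_list_def by (auto simp: fun_eq_iff simp del: upt_Suc)
    also have "\<dots> \<in> borel_measurable N" by measurable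
    finally show "(\<lambda>x. if i < length (points_list (D x) (r x)) then points_list (D x) (r x) ! i else 0) \<in> borel_measurable N" .
  qed
qed

lemma integral_rate_cell:
  fixes \<mu> a b :: real
  assumes "\<mu> > 0" "0 \<le> a" "a \<le> b"
  shows "set_integrable lborel {a..<b} (\<lambda>t. 1 / (\<mu> + t))"
    and "(LINT t:{a..<b}|lborel. 1 / (\<mu> + t)) = ln (\<mu> + b) - ln (\<mu> + a)"
proof -
  let ?f = "\<lambda>t. 1 / (\<mu> + t)"
  have I: "set_integrable lborel {a..b} ?f"
    unfolding set_integrable_def
    by (rule borel_integrable_compact) (use assms in \<open>auto intro!: continuous_intros\<close>)
  then show "set_integrable lborel {a..<b} ?f" by (rule set_integrable_subset) auto
  have "(LINT t:{a..<b}|lborel. ?f t) = (LINT t:{a..b}|lborel. ?f t)"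
    unfolding set_lebesgue_integral_def
  proof (rule integral_cong_AE)
    show "AE x in lborel. indicat_real {a..<b} x *\<^sub>R (1 / (\<mu> + x)) = indicat_real {a..b} x *\<^sub>R (1 / (\<mu> + x))"
      by (rule AE_mp[OF AE_lborel_singleton[of b]]) (auto split: split_indicator)
  qed measurable
  also have "\<dots> = ln (\<mu> + b) - ln (\<mu> + a)"
  proof -
    have "((\<lambda>t. ln (\<mu> + t)) has_real_derivative 1 / (\<mu> + x)) (at x)" if "a \<le> x" for x
      using assms that by (auto intro!: derivative_eq_intros)
    moreover have "isCont ?f x" if "a \<le> x" for x
      using assms that by (auto intro!: continuous_intros)
    ultimately have "(LBINT t. ?f t * indicator {a..b} t) = ln (\<mu> + b) - ln (\<mu> + a)"
      by (intro integral_FTC_Icc_real[OF assms(3)]) auto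
    then show ?thesis unfolding set_lebesgue_integral_def by (simp add: mult.commute)
  qed
  finally show "(LINT t:{a..<b}|lborel. ?f t) = ln (\<mu> + b) - ln (\<mu> + a)" .
qed

text \<open>The numbers of the cells \<open>[(c - 1) h, c h)\<close> of the points. They start at 1, so that the list of
  cells is increasing from a positive first entry.\<close>

definition cell_list :: "(nat \<Rightarrow> real) \<Rightarrow> real \<Rightarrow> real \<Rightarrow> nat list" where
  "cell_list D r h = map (\<lambda>x. Suc (nat \<lfloor>x / h\<rfloor>)) (points_list D r)"

text \<open>The points below \<open>M h\<close> increase and lie in distinct cells, so the list of their cells is the sorted
  list of the occupied cells.\<close>

lemma cell_list_eq:
  fixes D :: "nat \<Rightarrow> real"
  assumes h: "h > 0" and D: "0 \<le> D 1" "\<And>i. i \<ge> 1 \<Longrightarrow> D i < D (Suc i)"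
    and cells: "\<And>j. j < M \<Longrightarrow> finite {i. 1 \<le> i \<and> D i \<in> {real j * h..<real (Suc j) * h}} \<and>
      card {i. 1 \<le> i \<and> D i \<in> {real j * h..<real (Suc j) * h}} = (if Suc j \<in> set l then 1 else 0)"
    and l: "sorted_wrt (<) l" "set l \<subseteq> {1..M}"
  shows "cell_list D (real M * h) h = l"
proof -
  define c where "c i = nat \<lfloor>D i / h\<rfloor>" for i
  have mono: "D i \<le> D j" if "1 \<le> i" "i \<le> j" for i j
    using that(2)
  proof (induction j rule: dec_induct)
    case (step n)
    then show ?case using D(2)[of n] that(1) by linarith
  qed simp
  have D0: "D i \<ge> 0" if "i \<ge> 1" for i using mono[of 1 i] that D(1) by simp
  have cell: "D i \<in> {real j * h..<real (Suc j) * h} \<longleftrightarrow> c i = j" if "i \<ge> 1" for i j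
  proof -
    have "D i \<in> {real j * h..<real (Suc j) * h} \<longleftrightarrow> real j \<le> D i / h \<and> D i / h < real j + 1"
      using h by (simp add: pos_le_divide_eq pos_divide_less_eq algebra_simps)
    also have "\<dots> \<longleftrightarrow> \<lfloor>D i / h\<rfloor> = int j" by (auto simp: floor_eq_iff)
    also have "\<dots> \<longleftrightarrow> c i = j" using D0[OF that] h unfolding c_def by auto
    finally show ?thesis .
  qed
  define A where "A = {i. 1 \<le> i \<and> D i < real M * h}"
  have A: "i \<in> A \<longleftrightarrow> 1 \<le> i \<and> c i < M" for i
  proof -
    have "D i < real M * h \<longleftrightarrow> c i < M" if "1 \<le> i"
    proof -
      have "D i < real M * h \<longleftrightarrow> D i / h < real M" using h by (simp add: pos_divide_less_eq)
      also have "\<dots> \<longleftrightarrow> c i < M" using D0[OF that] h unfolding c_def by (auto simp: nat_less_iff floor_less_iff)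
      finally show ?thesis .
    qed
    then show ?thesis unfolding A_def by auto
  qed
  have cells': "finite {i. 1 \<le> i \<and> c i = j}" "card {i. 1 \<le> i \<and> c i = j} = (if Suc j \<in> set l then 1 else 0)" if "j < M" for j
  proof -
    have "{i. 1 \<le> i \<and> D i \<in> {real j * h..<real (Suc j) * h}} = {i. 1 \<le> i \<and> c i = j}"
      using cell by auto
    then show "finite {i. 1 \<le> i \<and> c i = j}" "card {i. 1 \<le> i \<and> c i = j} = (if Suc j \<in> set l then 1 else 0)"
      using cells[OF that] by auto
  qed
  have "A = (\<Union>j<M. {i. 1 \<le> i \<and> c i = j})" using A by auto
  then have finA: "finite A" using cells' by auto
  have A_eq: "A = {1..Sup A}"
  proof (cases "A = {}")
    case True then show ?thesis by (simp add: Sup_nat_def)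
  next
    case False
    then have "Sup A = Max A" by (simp add: Sup_nat_def)
    then have S: "Sup A \<in> A" "\<And>i. i \<in> A \<Longrightarrow> i \<le> Sup A" using finA False by auto
    have memA: "i \<in> A \<longleftrightarrow> 1 \<le> i \<and> D i < real M * h" for i by (simp add: A_def)
    have "i \<in> A" if "i \<in> {1..Sup A}" for i
      using mono[of i "Sup A"] that S(1) unfolding memA by auto
    moreover have "i \<in> {1..Sup A}" if "i \<in> A" for i
      using S(2)[OF that] that unfolding memA by simp
    ultimately show ?thesis by blast
  qed
  have C: "cell_list D (real M * h) h = map (\<lambda>i. Suc (c i)) [1..<Suc (Sup A)]"
    by (simp add: cell_list_def points_list_def c_def A_def o_def del: upt_Suc)
  have set_upt: "set [1..<Suc (Sup A)] = A"
    by (simp only: set_upt atLeastLessThanSuc_atLeastAtMost A_eq[symmetric])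
  have uniq: "i = i'" if "i \<in> A" "i' \<in> A" "c i = c i'" for i i'
  proof -
    let ?S = "{k. 1 \<le> k \<and> c k = c i}"
    have S: "i \<in> ?S" "i' \<in> ?S" and "c i < M" using that(3) A[of i] A[of i'] that(1,2) by auto
    from cells'[OF \<open>c i < M\<close>] have fin: "finite ?S" and "card ?S \<le> Suc 0" by auto
    with S show ?thesis using card_le_Suc0_iff_eq[OF fin] by blast
  qed
  have "sorted (cell_list D (real M * h) h)"
    unfolding C
  proof (subst sorted_map, rule sorted_wrt_mono_rel[of _ "(\<le>)"])
    show "sorted [1..<Suc (Sup A)]" by (rule sorted_upt)
    fix i j assume "i \<in> set [1..<Suc (Sup A)]" "i \<le> j"
    then have "1 \<le> i" unfolding set_upt A by simp
    then have "D i \<le> D j" using mono[of i j] \<open>i \<le> j\<close> by blast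
    then show "Suc (c i) \<le> Suc (c j)" unfolding c_def using h by (intro Suc_le_mono[THEN iffD2] nat_mono floor_mono divide_right_mono) auto
  qed
  moreover have "distinct (cell_list D (real M * h) h)"
    unfolding C distinct_map set_upt by (intro conjI inj_onI distinct_upt, rule uniq) simp_all
  moreover have "set (cell_list D (real M * h) h) = set l"
  proof -
    have "set (cell_list D (real M * h) h) = (\<lambda>i. Suc (c i)) ` A" unfolding C set_map set_upt ..
    also have "\<dots> = set l"
    proof (intro set_eqI iffI)
      fix x assume "x \<in> (\<lambda>i. Suc (c i)) ` A"
      then obtain i where i: "i \<in> A" "x = Suc (c i)" by auto
      then have "i \<in> {k. 1 \<le> k \<and> c k = c i}" "c i < M" using A by auto
      then have "card {k. 1 \<le> k \<and> c k = c i} \<noteq> 0" using cells'(1)[of "c i"] by (metis card_0_eq empty_iff)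
      then show "x \<in> set l" using cells'(2)[of "c i"] i \<open>c i < M\<close> by (auto split: if_splits)
    next
      fix x assume x: "x \<in> set l"
      then have "x \<in> {1..M}" using l(2) by blast
      then obtain j where j: "x = Suc j" "j < M" by (cases x) auto
      then have "card {k. 1 \<le> k \<and> c k = j} = 1" using cells'(2)[of j] x by simp
      then obtain i where "1 \<le> i" "c i = j" by (metis (mono_tags, lifting) card.empty empty_Collect_eq zero_neq_one)
      then show "x \<in> (\<lambda>i. Suc (c i)) ` A" using A j by auto
    qed
    finally show ?thesis .
  qed
  moreover have "sorted l" "distinct l" using l(1) by (auto simp: strict_sorted_iff)
  ultimately show ?thesis by (intro sorted_distinct_set_unique)
qed

lemma sorted_wrt_less_distinct: "sorted_wrt (<) (l :: nat list) \<Longrightarrow> distinct l"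
  by (simp add: strict_sorted_iff)

text \<open>The event that the occupied cells contain one point each and the other cells below \<open>M h\<close> are empty
  has probability \<open>(\<Prod>c\<in>l. \<Lambda>\<^sub>c) * exp (- (\<Sum>c=1..M. \<Lambda>\<^sub>c))\<close>, where the intensity of the \<open>c\<close>-th cell is
  \<open>\<Lambda>\<^sub>c = ln ((\<mu> + c h) / (\<mu> + (c - 1) h))\<close>. The exponential telescopes to \<open>\<mu> / (\<mu> + M h)\<close>, and
  \<open>\<Lambda>\<^sub>c \<ge> h / (\<mu> + c h)\<close>. In the proof the cells are numbered from 0.\<close>

lemma prob_cell_list_ge:
  fixes \<mu> r :: real
  assumes "prob_space \<Omega>" and pp: "poisson_points \<Omega> (\<lambda>t. 1 / (\<mu> + t)) D" and \<mu>: "\<mu> > 0" and h: "h > 0"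
    and l: "sorted_wrt (<) (0 # l)"
    and meas: "(\<lambda>\<omega>. cell_list (\<lambda>i. D i \<omega>) (real M * h) h) \<in> \<Omega> \<rightarrow>\<^sub>M count_space UNIV"
  shows "ennreal (\<mu> / (\<mu> + real M * h)) * prod_list (map (\<lambda>c. if c \<le> M then ennreal (h / (\<mu> + real c * h)) else 0) l)
    \<le> emeasure \<Omega> {\<omega> \<in> space \<Omega>. cell_list (\<lambda>i. D i \<omega>) (real M * h) h = l}"
proof (cases "set l \<subseteq> {1..M}")
  case False
  then obtain c where c: "c \<in> set l" "c \<notin> {1..M}" by blast
  moreover have "c > 0" using l c(1) by simp
  ultimately have c: "c \<in> set l" "\<not> c \<le> M" by auto
  have "prod_list (map (\<lambda>c. if c \<le> M then ennreal (h / (\<mu> + real c * h)) else 0) l) = 0"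
    unfolding prod_list_zero_iff using c by force
  then show ?thesis by simp
next
  case True
  interpret prob_space \<Omega> by fact
  define B where "B j = {real j * h..<real (Suc j) * h}" for j :: nat
  define \<Lambda> where "\<Lambda> j = (LINT t:B j|lborel. 1 / (\<mu> + t))" for j
  define m :: "nat \<Rightarrow> nat" where "m j = (if Suc j \<in> set l then 1 else 0)" for j
  have \<Lambda>: "\<Lambda> j = ln (\<mu> + real (Suc j) * h) - ln (\<mu> + real j * h)" for j
    unfolding \<Lambda>_def B_def by (rule integral_rate_cell) (use \<mu> h in \<open>auto intro!: mult_right_mono\<close>)
  have pos: "\<mu> + real j * h > 0" for j using \<mu> h by (simp add: add_pos_nonneg)
  have \<Lambda>_ge: "\<Lambda> j \<ge> h / (\<mu> + real (Suc j) * h)" for j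
  proof -
    have "ln ((\<mu> + real j * h) / (\<mu> + real (Suc j) * h)) \<le> (\<mu> + real j * h) / (\<mu> + real (Suc j) * h) - 1"
      by (rule ln_le_minus_one) (use pos[of j] pos[of "Suc j"] in simp)
    also have "\<dots> = - (h / (\<mu> + real (Suc j) * h))" using pos[of "Suc j"] by (simp add: field_simps)
    finally show ?thesis unfolding \<Lambda> using pos[of j] pos[of "Suc j"] by (simp add: ln_div)
  qed
  let ?G = "{\<omega> \<in> space \<Omega>. \<forall>j<M. finite {i. 1 \<le> i \<and> D i \<omega> \<in> B j} \<and> card {i. 1 \<le> i \<and> D i \<omega> \<in> B j} = m j}"
  have disj: "disjoint_family_on B {..<M}"
    unfolding disjoint_family_on_def
  proof (intro ballI impI)
    fix i j :: nat assume "i \<noteq> j"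
    then consider "Suc i \<le> j" | "Suc j \<le> i" by linarith
    then show "B i \<inter> B j = {}"
    proof cases
      case 1
      then have "real (Suc i) * h \<le> real j * h" using h by (intro mult_right_mono) auto
      then show ?thesis by (auto simp: B_def)
    next
      case 2
      then have "real (Suc j) * h \<le> real i * h" using h by (intro mult_right_mono) auto
      then show ?thesis by (auto simp: B_def)
    qed
  qed
  have B_int: "\<forall>j<M. B j \<in> sets borel \<and> B j \<subseteq> {0..} \<and> set_integrable lborel (B j) (\<lambda>t. 1 / (\<mu> + t))"
  proof (intro allI impI conjI)
    fix j
    show "B j \<subseteq> {0..}" using h by (auto simp: B_def intro: order_trans[rotated])
    show "set_integrable lborel (B j) (\<lambda>t. 1 / (\<mu> + t))"
      unfolding B_def by (rule integral_rate_cell) (use \<mu> h in \<open>auto intro!: mult_right_mono\<close>)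
  qed (simp add: B_def)
  have "measure \<Omega> ?G = (\<Prod>j<M. \<Lambda> j ^ m j / fact (m j) * exp (- \<Lambda> j))"
    unfolding \<Lambda>_def
    by (rule pp[unfolded poisson_points_def, THEN conjunct2, THEN conjunct2, THEN spec, THEN spec, THEN spec,
          THEN mp, OF conjI[OF B_int disj]])
  also have "\<dots> = (\<Prod>j<M. if Suc j \<in> set l then \<Lambda> j else 1) * (\<Prod>j<M. exp (- \<Lambda> j))"
    unfolding prod.distrib by (auto simp: m_def intro!: arg_cong2[of _ _ _ _ "(*)"] prod.cong)
  also have "(\<Prod>j<M. exp (- \<Lambda> j)) = \<mu> / (\<mu> + real M * h)"
  proof (induction M)
    case (Suc M)
    have e: "exp (- \<Lambda> M) = (\<mu> + real M * h) / (\<mu> + real (Suc M) * h)"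
      unfolding \<Lambda> using pos[of M] pos[of "Suc M"] by (simp add: exp_diff)
    have cancel: "a / b * (b / c) = a / c" if "b \<noteq> 0" for a b c :: real using that by simp
    have "(\<Prod>j<Suc M. exp (- \<Lambda> j)) = \<mu> / (\<mu> + real M * h) * ((\<mu> + real M * h) / (\<mu> + real (Suc M) * h))"
      by (simp only: prod.lessThan_Suc Suc.IH e)
    also have "\<dots> = \<mu> / (\<mu> + real (Suc M) * h)" by (rule cancel) (use pos[of M] in simp)
    finally show ?case .
  qed (use \<mu> in simp)
  also have "(\<Prod>j<M. if Suc j \<in> set l then \<Lambda> j else 1) = (\<Prod>c\<in>set l. \<Lambda> (c - 1))"
  proof -
    have "(\<Prod>j<M. if Suc j \<in> set l then \<Lambda> j else 1) = (\<Prod>j\<in>{j \<in> {..<M}. Suc j \<in> set l}. \<Lambda> j)"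
      by (rule prod.inter_filter[symmetric]) simp
    also have "\<dots> = (\<Prod>c\<in>set l. \<Lambda> (c - 1))"
    proof (rule prod.reindex_bij_witness[of _ "\<lambda>c. c - 1" Suc])
      fix b assume "b \<in> set l"
      then have "b \<in> {1..M}" using True by blast
      then have b: "Suc (b - 1) = b" "b - 1 < M" by auto
      show "Suc (b - 1) = b" "b - 1 \<in> {j \<in> {..<M}. Suc j \<in> set l}" using b \<open>b \<in> set l\<close> by auto
    qed auto
    finally show ?thesis .
  qed
  finally have mG: "measure \<Omega> ?G = (\<Prod>c\<in>set l. \<Lambda> (c - 1)) * (\<mu> / (\<mu> + real M * h))" .
  have dl: "distinct l" using l by (auto intro: sorted_wrt_less_distinct)
  have "ennreal (\<mu> / (\<mu> + real M * h)) * prod_list (map (\<lambda>c. if c \<le> M then ennreal (h / (\<mu> + real c * h)) else 0) l)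
    = ennreal (\<mu> / (\<mu> + real M * h)) * (\<Prod>c\<in>set l. ennreal (h / (\<mu> + real c * h)))"
    unfolding prod.distinct_set_conv_list[OF dl, symmetric] using True
    by (intro arg_cong2[of _ _ _ _ "(*)"] prod.cong) auto
  also have "\<dots> = ennreal (\<mu> / (\<mu> + real M * h) * (\<Prod>c\<in>set l. h / (\<mu> + real c * h)))"
    using \<mu> h pos by (subst prod_ennreal) (auto simp: ennreal_mult[symmetric] prod_nonneg less_imp_le)
  also have "\<dots> \<le> ennreal ((\<Prod>c\<in>set l. \<Lambda> (c - 1)) * (\<mu> / (\<mu> + real M * h)))"
  proof -
    have "(\<Prod>c\<in>set l. h / (\<mu> + real c * h)) \<le> (\<Prod>c\<in>set l. \<Lambda> (c - 1))"
    proof (rule prod_mono)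
      fix c assume "c \<in> set l"
      then have "c \<in> {1..M}" using True by blast
      then have "Suc (c - 1) = c" by simp
      then show "0 \<le> h / (\<mu> + real c * h) \<and> h / (\<mu> + real c * h) \<le> \<Lambda> (c - 1)"
        using \<Lambda>_ge[of "c - 1"] pos[of c] h by simp
    qed
    from mult_right_mono[OF this, of "\<mu> / (\<mu> + real M * h)"] show ?thesis
      using \<mu> pos[of M] by (intro ennreal_leI) (simp add: mult.commute)
  qed
  also have "\<dots> = emeasure \<Omega> ?G" unfolding mG[symmetric] by (simp add: emeasure_eq_measure)
  also have "\<dots> \<le> emeasure \<Omega> {\<omega> \<in> space \<Omega>. cell_list (\<lambda>i. D i \<omega>) (real M * h) h = l}"
  proof (rule emeasure_mono_AE)
    show "AE \<omega> in \<Omega>. \<omega> \<in> ?G \<longrightarrow> \<omega> \<in> {\<omega> \<in> space \<Omega>. cell_list (\<lambda>i. D i \<omega>) (real M * h) h = l}"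
      using pp[unfolded poisson_points_def, THEN conjunct2, THEN conjunct1]
    proof eventually_elim
      case (elim \<omega>)
      show ?case
      proof
        assume G: "\<omega> \<in> ?G"
        have "cell_list (\<lambda>i. D i \<omega>) (real M * h) h = l"
          by (rule cell_list_eq[OF h]) (use elim G True l in \<open>auto simp: B_def m_def\<close>)
        then show "\<omega> \<in> {\<omega> \<in> space \<Omega>. cell_list (\<lambda>i. D i \<omega>) (real M * h) h = l}" using G by simp
      qed
    qed
    have "{\<omega> \<in> space \<Omega>. cell_list (\<lambda>i. D i \<omega>) (real M * h) h = l} = (\<lambda>\<omega>. cell_list (\<lambda>i. D i \<omega>) (real M * h) h) -` {l} \<inter> space \<Omega>"
      by auto
    then show "{\<omega> \<in> space \<Omega>. cell_list (\<lambda>i. D i \<omega>) (real M * h) h = l} \<in> sets \<Omega>"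
      using measurable_sets[OF meas, of "{l}"] by simp
  qed
  finally show ?thesis .
qed

lemma measurable_cell_list:
  assumes "\<And>i. i \<ge> 1 \<Longrightarrow> D i \<in> borel_measurable N"
  shows "(\<lambda>\<omega>. cell_list (\<lambda>i. D i \<omega>) r h) \<in> N \<rightarrow>\<^sub>M count_space UNIV"
proof (rule measurable_count_space_eq2_countable[THEN iffD2], safe)
  fix l
  have P: "(\<lambda>\<omega>. points_list (\<lambda>i. D i \<omega>) r) \<in> N \<rightarrow>\<^sub>M list_borel"
    by (rule measurable_points_list) (use assms in auto)
  have [measurable]: "(\<lambda>\<omega>. length (points_list (\<lambda>i. D i \<omega>) r)) \<in> N \<rightarrow>\<^sub>M count_space UNIV"
    by (rule measurable_compose[OF P measurable_list_length])
  have [measurable]: "(\<lambda>\<omega>. if i < length (points_list (\<lambda>i. D i \<omega>) r) then points_list (\<lambda>i. D i \<omega>) r ! i else 0) \<in> borel_measurable N" for i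
    by (rule measurable_compose[OF P measurable_list_nth])
  have "(\<lambda>\<omega>. cell_list (\<lambda>i. D i \<omega>) r h) -` {l} \<inter> space N
    = {\<omega> \<in> space N. length (points_list (\<lambda>i. D i \<omega>) r) = length l \<and>
       (\<forall>i<length l. Suc (nat \<lfloor>(if i < length (points_list (\<lambda>i. D i \<omega>) r) then points_list (\<lambda>i. D i \<omega>) r ! i else 0) / h\<rfloor>) = l ! i)}"
    by (auto simp: cell_list_def list_eq_iff_nth_eq)
  also have "\<dots> \<in> sets N" by measurable
  finally show "(\<lambda>\<omega>. cell_list (\<lambda>i. D i \<omega>) r h) -` {l} \<inter> space N \<in> sets N" .
qed auto

text \<open>The points are replaced by the ends of their cells in a partition of \<open>[0, r)\<close> into \<open>N + 1\<close> cells,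
  and \<open>N\<close> tends to infinity.\<close>

lemma points_lower_bound:
  assumes "prob_space \<Omega>" and pp: "poisson_points \<Omega> (\<lambda>t. 1 / (\<mu> + t)) D" and \<mu>: "\<mu> > 0" and r: "r > 0"
    and [measurable]: "f \<in> borel_measurable list_borel"
    and cont: "list_continuous f" and bd: "\<And>l. f l \<le> ennreal B"
  shows "ennreal (\<mu> / (\<mu> + r)) * (\<Sum>n. (extend (rate_below \<mu> r) ^^ n) f [])
    \<le> (\<integral>\<^sup>+\<omega>. f (points_list (\<lambda>i. D i \<omega>) r) \<partial>\<Omega>)"
proof -
  interpret prob_space \<Omega> by fact
  have D_meas: "i \<ge> 1 \<Longrightarrow> D i \<in> borel_measurable \<Omega>" for i
    using pp by (simp add: poisson_points_def)
  define h where "h m = r / real (Suc m)" for m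
  let ?f = "\<lambda>N l. f (map (\<lambda>j. h N * real j) l)"
  have h: "h m > 0" for m using r by (simp add: h_def)
  have h0: "h \<longlonglongrightarrow> 0" unfolding h_def using r
    by (intro real_tendsto_divide_at_top[OF tendsto_const] filterlim_compose[OF filterlim_real_sequentially filterlim_Suc])
  have Mh: "real (Suc m) * h m = r" for m by (simp add: h_def)
  define w where "w m c = (if c \<le> Suc m then ennreal (h m / (\<mu> + real c * h m)) else 0)" for m c
  define k where "k = ennreal (\<mu> / (\<mu> + r))"
  define C where "C m \<omega> = cell_list (\<lambda>i. D i \<omega>) r (h m)" for m \<omega>
  have C_meas[measurable]: "C m \<in> \<Omega> \<rightarrow>\<^sub>M count_space UNIV" for m
    unfolding C_def by (rule measurable_cell_list[OF D_meas])
  define \<rho> where "\<rho> = rate_below \<mu> r"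
  have [measurable]: "\<rho> \<in> borel_measurable borel" unfolding \<rho>_def by measurable
  have w_lim: "\<rho> x \<le> liminf (\<lambda>N. w N (j N) / ennreal (h N))"
    if x: "x > 0" and j: "(\<lambda>N. h N * real (j N)) \<longlonglongrightarrow> x" for j x
  proof (cases "x < r")
    case True
    have "\<forall>\<^sub>F N in sequentially. h N * real (j N) < r" by (rule order_tendstoD(2)[OF j True])
    then have ev: "\<forall>\<^sub>F N in sequentially. w N (j N) / ennreal (h N) = ennreal (1 / (\<mu> + h N * real (j N)))"
    proof eventually_elim
      case (elim N)
      then have "h N * real (j N) < h N * real (Suc N)" using Mh[of N] by (simp add: mult.commute)
      then have "j N \<le> Suc N" using h[of N] by (simp add: mult_less_cancel_left_pos del: of_nat_Suc)
      moreover have "\<mu> + real (j N) * h N > 0" using \<mu> h[of N] by (simp add: add_pos_nonneg)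
      ultimately show ?case using h[of N] by (simp add: w_def divide_ennreal mult.commute)
    qed
    have "(\<lambda>N. ennreal (1 / (\<mu> + h N * real (j N)))) \<longlonglongrightarrow> ennreal (1 / (\<mu> + x))"
      by (intro tendsto_ennrealI tendsto_divide tendsto_const tendsto_add j) (use \<mu> x in simp)
    then have "(\<lambda>N. w N (j N) / ennreal (h N)) \<longlonglongrightarrow> ennreal (1 / (\<mu> + x))"
      by (rule tendsto_cong[THEN iffD1, rotated]) (use ev in \<open>simp add: eventually_mono\<close>)
    then have "liminf (\<lambda>N. w N (j N) / ennreal (h N)) = ennreal (1 / (\<mu> + x))"
      by (intro lim_imp_Liminf) auto
    then show ?thesis using True by (simp add: \<rho>_def rate_def)
  next
    case False then show ?thesis by (simp add: \<rho>_def)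
  qed
  have lsc: "grid_lsc h (\<lambda>N l. k * ?f N l) (\<lambda>l. k * f l)"
    unfolding grid_lsc_def
  proof (intro allI impI liminf_mult_ge_ennreal)
    fix L l assume "grid_tendsto h L l"
    from lim_imp_Liminf[OF _ list_continuous_grid[OF cont this]]
    show "f l \<le> liminf (\<lambda>N. ?f N (L N))" by simp
  qed (simp add: Liminf_const)
  have "k * (\<Sum>n. (extend \<rho> ^^ n) f []) = (\<Sum>n. (extend \<rho> ^^ n) (\<lambda>l. k * f l) [])"
    by (subst extend_power_cmult) auto
  also have "\<dots> \<le> liminf (\<lambda>N. \<Sum>n. (dextend (w N) ^^ n) (\<lambda>l. k * ?f N l) [])"
    by (rule grid_liminf_suminf[OF h h0 w_lim lsc])
  also have "\<dots> \<le> liminf (\<lambda>N. \<integral>\<^sup>+\<omega>. ?f N (C N \<omega>) \<partial>\<Omega>)"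
  proof (intro Liminf_mono always_eventually allI)
    fix N
    show "(\<Sum>n. (dextend (w N) ^^ n) (\<lambda>l. k * ?f N l) []) \<le> (\<integral>\<^sup>+\<omega>. ?f N (C N \<omega>) \<partial>\<Omega>)"
    proof (rule suminf_dextend_le_nn_integral[where W = "\<lambda>_. k" and g = "?f N"])
      fix l :: "nat list" assume l: "sorted_wrt (<) (0 # l)"
      show "k * prod_list (map (w N) l) \<le> emeasure \<Omega> {\<omega> \<in> space \<Omega>. C N \<omega> = l}"
        using prob_cell_list_ge[OF assms(1) pp \<mu> h[of N] l, of "Suc N"] C_meas[of N]
        unfolding Mh C_def w_def k_def by simp
    qed measurable
  qed
  also have "liminf (\<lambda>N. \<integral>\<^sup>+\<omega>. ?f N (C N \<omega>) \<partial>\<Omega>) = (\<integral>\<^sup>+\<omega>. f (points_list (\<lambda>i. D i \<omega>) r) \<partial>\<Omega>)"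
  proof (rule lim_imp_Liminf)
    show "(\<lambda>N. \<integral>\<^sup>+\<omega>. ?f N (C N \<omega>) \<partial>\<Omega>) \<longlonglongrightarrow> (\<integral>\<^sup>+\<omega>. f (points_list (\<lambda>i. D i \<omega>) r) \<partial>\<Omega>)"
    proof (rule nn_integral_dominated_convergence[where w = "\<lambda>_. ennreal B"])
      show "(\<lambda>\<omega>. ?f N (C N \<omega>)) \<in> borel_measurable \<Omega>" for N
        by (rule measurable_compose[OF C_meas]) simp
      have "(\<lambda>\<omega>. points_list (\<lambda>i. D i \<omega>) r) \<in> \<Omega> \<rightarrow>\<^sub>M list_borel"
        by (rule measurable_points_list) (use D_meas in auto)
      then show "(\<lambda>\<omega>. f (points_list (\<lambda>i. D i \<omega>) r)) \<in> borel_measurable \<Omega>" by measurable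
      show "(\<integral>\<^sup>+\<omega>. ennreal B \<partial>\<Omega>) < \<infinity>" by (simp add: emeasure_space_1)
      show "AE \<omega> in \<Omega>. (\<lambda>N. ?f N (C N \<omega>)) \<longlonglongrightarrow> f (points_list (\<lambda>i. D i \<omega>) r)"
        using pp[unfolded poisson_points_def, THEN conjunct2, THEN conjunct1]
      proof eventually_elim
        case (elim \<omega>)
        have D0: "D i \<omega> \<ge> 0" if "i \<ge> 1" for i
          using that by (induction i rule: dec_induct) (use elim in \<open>auto intro: order_trans less_imp_le\<close>)
        have "(\<lambda>N. h N * real (Suc (nat \<lfloor>x / h N\<rfloor>))) \<longlonglongrightarrow> x" if "x \<ge> 0" for x
        proof (rule tendsto_sandwich)
          have b: "x / h N \<le> real (Suc (nat \<lfloor>x / h N\<rfloor>)) \<and> real (Suc (nat \<lfloor>x / h N\<rfloor>)) \<le> x / h N + 1" for N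
          proof -
            have "x / h N \<ge> 0" using that h[of N] by simp
            then show ?thesis by linarith
          qed
          show "\<forall>\<^sub>F N in sequentially. x \<le> h N * real (Suc (nat \<lfloor>x / h N\<rfloor>))"
            using b h by (auto intro!: always_eventually simp: pos_divide_le_eq mult.commute simp del: of_nat_Suc)
          show "\<forall>\<^sub>F N in sequentially. h N * real (Suc (nat \<lfloor>x / h N\<rfloor>)) \<le> x + h N"
          proof (intro always_eventually allI)
            fix N
            have "h N * real (Suc (nat \<lfloor>x / h N\<rfloor>)) \<le> h N * (x / h N + 1)"
              using b[of N] h[of N] by (intro mult_left_mono) auto
            then show "h N * real (Suc (nat \<lfloor>x / h N\<rfloor>)) \<le> x + h N" using h[of N] by (simp add: distrib_left)
          qed
          show "(\<lambda>N. x + h N) \<longlonglongrightarrow> x" using tendsto_add[OF tendsto_const h0, of x] by simp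
        qed simp
        then have "grid_tendsto h (\<lambda>N. C N \<omega>) (points_list (\<lambda>i. D i \<omega>) r)"
          using D0 by (auto simp: grid_tendsto_def C_def cell_list_def points_list_def simp del: upt_Suc of_nat_Suc)
        from list_continuous_grid[OF cont this]
        show ?case .
      qed
    qed (use bd in auto)
  qed simp
  finally show ?thesis unfolding k_def \<rho>_def .
qed

section \<open>Color changes as a Markov chain\<close>

text \<open>The color changes of a walk with edge colors \<open>cs\<close> once a further edge of the current color \<open>c\<close> is
  appended. This is what happens when the walk hits \<open>[k]\<close>, since it does so at a new vertex.\<close>

definition color_marks :: "nat list \<Rightarrow> nat \<Rightarrow> nat set" where
  "color_marks cs c = {i \<in> {1..length cs}. (cs @ [c]) ! (i - 1) \<noteq> (cs @ [c]) ! i}"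

text \<open>The part of the state that is a Markov chain: the length of the walk and its color changes.\<close>

definition position :: "'v list \<times> nat list \<times> nat \<Rightarrow> nat \<times> nat set" where
  "position s = (length (fst (snd s)), color_marks (fst (snd s)) (snd (snd s)))"

text \<open>A loop at position \<open>j\<close> keeps the first \<open>j\<close> edges, and the next edge has a new color; for \<open>j = 0\<close> no
  edge is left to differ from it.\<close>

definition cut_marks :: "nat set \<Rightarrow> nat \<Rightarrow> nat set" where
  "cut_marks A j = {i \<in> A. i < j} \<union> (if j = 0 then {} else {j})"

text \<open>The colors increase along the walk, because colors are numbered in the order of their use. In
  particular the current color is either that of the last edge or new.\<close>

definition lew_invariant :: "'v list \<times> nat list \<times> nat \<Rightarrow> bool" where
  "lew_invariant s \<longleftrightarrow> (case s of (ys, cs, c) \<Rightarrow>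
     length ys = Suc (length cs) \<and> distinct ys \<and> sorted (cs @ [c]))"

lemma color_marks_append1:
  "color_marks (cs @ [d]) c = color_marks cs d \<union> (if d = c then {} else {Suc (length cs)})"
proof (rule set_eqI)
  fix i
  consider "i = 0" | "1 \<le> i" "i \<le> length cs" | "i = Suc (length cs)" | "i > Suc (length cs)" by linarith
  then show "i \<in> color_marks (cs @ [d]) c \<longleftrightarrow> i \<in> color_marks cs d \<union> (if d = c then {} else {Suc (length cs)})"
  proof cases
    case 1
    then show ?thesis by (simp add: color_marks_def)
  next
    case 2
    then have "((cs @ [d]) @ [c]) ! i = (cs @ [d]) ! i" "((cs @ [d]) @ [c]) ! (i - 1) = (cs @ [d]) ! (i - 1)"
      by (auto simp: nth_append)
    then show ?thesis using 2 by (simp add: color_marks_def)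
  next
    case 3
    then have "((cs @ [d]) @ [c]) ! i = c" "((cs @ [d]) @ [c]) ! (i - 1) = d" by (auto simp: nth_append)
    then show ?thesis using 3 by (simp add: color_marks_def)
  next
    case 4
    then show ?thesis by (simp add: color_marks_def)
  qed
qed

lemma color_marks_snoc: "color_marks (cs @ [c]) c = color_marks cs c"
  by (simp add: color_marks_append1)

lemma color_marks_take:
  assumes "j \<le> length cs" "\<forall>x\<in>set cs. x \<le> c"
  shows "color_marks (take j cs) (Suc c) = cut_marks (color_marks cs c) j"
proof (intro set_eqI)
  fix i
  have "j \<noteq> 0 \<Longrightarrow> cs ! (j - 1) \<le> c" using assms by (intro assms(2)[rule_format] nth_mem) auto
  then show "i \<in> color_marks (take j cs) (Suc c) \<longleftrightarrow> i \<in> cut_marks (color_marks cs c) j"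
    using assms(1) unfolding color_marks_def cut_marks_def
    by (cases "i = j") (auto simp: nth_append)
qed

lemma color_marks_subset: "color_marks cs c \<subseteq> {1..length cs}"
  by (auto simp: color_marks_def)

lemma lew_step_new:
  assumes "v \<notin> set ys"
  shows "position (lew_step v (ys, cs, c)) = (Suc (length cs), color_marks cs c)"
  using assms by (simp add: position_def color_marks_snoc)

lemma lew_step_loop:
  assumes "lew_invariant (ys, cs, c)" "j < length ys"
  shows "lew_step (ys ! j) (ys, cs, c) = (take (Suc j) ys, take j cs, Suc c)"
proof -
  have "(LEAST i. i < length ys \<and> ys ! i = ys ! j) = j"
    using assms by (intro Least_equality) (auto simp: lew_invariant_def nth_eq_iff_index_eq)
  then show ?thesis using assms(2) by simp
qed

lemma position_lew_step_loop:
  assumes "lew_invariant (ys, cs, c)" "j \<le> length cs"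
  shows "position (lew_step (ys ! j) (ys, cs, c)) = (j, cut_marks (color_marks cs c) j)"
proof -
  have "j < length ys" "\<forall>x\<in>set cs. x \<le> c" using assms by (auto simp: lew_invariant_def sorted_append)
  then show ?thesis using assms(2)
    by (simp add: lew_step_loop[OF assms(1)] position_def color_marks_take del: lew_step.simps)
qed

lemma lew_invariant_step:
  assumes "lew_invariant s" shows "lew_invariant (lew_step v s)"
proof -
  obtain ys cs c where s: "s = (ys, cs, c)" by (cases s)
  show ?thesis
  proof (cases "v \<in> set ys")
    case False
    then show ?thesis using assms by (auto simp: s lew_invariant_def sorted_append)
  next
    case True
    then obtain j where j: "j < length ys" "v = ys ! j" by (auto simp: in_set_conv_nth)
    have "sorted (take j cs)" using assms by (auto simp: s lew_invariant_def sorted_append sorted_wrt_take)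
    then show ?thesis using assms j lew_step_loop[OF assms[unfolded s] j(1)]
      by (auto simp: s lew_invariant_def sorted_append simp del: lew_step.simps dest!: in_set_takeD)
  qed
qed

lemma lew_invariant_lew: "lew_invariant (lew x n)"
proof (induction n)
  case 0 then show ?case by (simp add: lew_invariant_def)
next
  case (Suc n) then show ?case by (simp add: lew_invariant_step)
qed

lemma set_lew_subset: "set (fst (lew x n)) \<subseteq> x ` {..n}"
proof (induction n)
  case (Suc n)
  obtain ys cs c where s: "lew x n = (ys, cs, c)" by (cases "lew x n")
  show ?case using Suc unfolding lew.simps s
    by (auto simp: Let_def atMost_Suc dest!: in_set_takeD)
qed simp

text \<open>A uniform step to a vertex outside \<open>[k]\<close> reaches each vertex of the present walk once, and the
  remaining \<open>N - k - (L + 1)\<close> vertices prolong it.\<close>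

lemma sum_position_lew_step:
  fixes F :: "nat \<times> nat set \<Rightarrow> ennreal"
  assumes inv: "lew_invariant (ys, cs, c)" and ys: "set ys \<subseteq> {Suc k..N}"
  shows "(\<Sum>v\<in>{Suc k..N}. F (position (lew_step v (ys, cs, c))))
    = of_nat (N - k - Suc (length cs)) * F (Suc (length cs), color_marks cs c)
      + (\<Sum>j\<le>length cs. F (j, cut_marks (color_marks cs c) j))"
proof -
  have len: "length ys = Suc (length cs)" and dist: "distinct ys" using inv by (auto simp: lew_invariant_def)
  have "(\<Sum>v\<in>{Suc k..N}. F (position (lew_step v (ys, cs, c))))
    = (\<Sum>v\<in>{Suc k..N} - set ys. F (position (lew_step v (ys, cs, c)))) + (\<Sum>v\<in>set ys. F (position (lew_step v (ys, cs, c))))"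
    by (rule sum.subset_diff[OF ys]) simp
  also have "(\<Sum>v\<in>{Suc k..N} - set ys. F (position (lew_step v (ys, cs, c))))
    = (\<Sum>v\<in>{Suc k..N} - set ys. F (Suc (length cs), color_marks cs c))"
    by (intro sum.cong refl, subst lew_step_new) auto
  also have "\<dots> = of_nat (N - k - Suc (length cs)) * F (Suc (length cs), color_marks cs c)"
    using ys by (simp add: card_Diff_subset distinct_card[OF dist] len)
  also have "(\<Sum>v\<in>set ys. F (position (lew_step v (ys, cs, c)))) = (\<Sum>j<length ys. F (position (lew_step (ys ! j) (ys, cs, c))))"
    by (rule sum.reindex_bij_betw[symmetric], rule bij_betw_nth[OF dist]) auto
  also have "\<dots> = (\<Sum>j\<le>length cs. F (j, cut_marks (color_marks cs c) j))"
    unfolding len lessThan_Suc_atMost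
    by (intro sum.cong refl, subst position_lew_step_loop[OF inv]) auto
  finally show ?thesis .
qed

text \<open>The colors along the walk are sorted, so there is one color more than there are color changes.\<close>

lemma color_changes_lew_snoc:
  assumes "lew x n = (ys, cs, c)" "x (Suc n) \<notin> set ys"
  shows "color_changes x (Suc n) = color_marks cs c" "num_colors x (Suc n) = Suc (card (color_marks cs c))"
proof -
  have inv: "length ys = Suc (length cs)" "sorted (cs @ [c])"
    using lew_invariant_lew[of x n] assms(1) by (auto simp: lew_invariant_def)
  have l: "lew x (Suc n) = (ys @ [x (Suc n)], cs @ [c], c)"
    using assms by simp
  show "color_changes x (Suc n) = color_marks cs c"
    unfolding color_changes_def lew_length_def edge_color_def l color_marks_def using inv by simp
  have "num_colors x (Suc n) = card ((\<lambda>i. (cs @ [c]) ! (i - 1)) ` {1..Suc (length cs)})"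
    unfolding num_colors_def edge_color_def lew_length_def l using inv by simp
  also have "(\<lambda>i. (cs @ [c]) ! (i - 1)) ` {1..Suc (length cs)} = set (cs @ [c])"
  proof (intro set_eqI iffI)
    fix y assume "y \<in> (\<lambda>i. (cs @ [c]) ! (i - 1)) ` {1..Suc (length cs)}"
    then obtain i where "i \<in> {1..Suc (length cs)}" "y = (cs @ [c]) ! (i - 1)" by blast
    then show "y \<in> set (cs @ [c])" by (auto intro!: nth_mem simp del: set_append)
  next
    fix y assume "y \<in> set (cs @ [c])"
    then obtain i where "i < length (cs @ [c])" "y = (cs @ [c]) ! i" by (metis in_set_conv_nth)
    then show "y \<in> (\<lambda>i. (cs @ [c]) ! (i - 1)) ` {1..Suc (length cs)}" by (intro image_eqI[of _ _ "Suc i"]) auto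
  qed
  also have "card (set (cs @ [c])) = Suc (card (color_marks cs c))"
    using inv(2)
  proof (induction cs arbitrary: c rule: rev_induct)
    case Nil then show ?case by (simp add: color_marks_def)
  next
    case (snoc d cs)
    then have IH: "card (set (cs @ [d])) = Suc (card (color_marks cs d))" and so: "sorted (cs @ [d])" "\<forall>x\<in>set (cs @ [d]). x \<le> c"
      by (auto simp: sorted_append)
    have m: "color_marks (cs @ [d]) c = color_marks cs d \<union> (if d = c then {} else {Suc (length cs)})"
      by (rule color_marks_append1)
    show ?case
    proof (cases "d = c")
      case True then show ?thesis using IH unfolding m by (simp add: insert_absorb)
    next
      case False
      have "c \<notin> set (cs @ [d])" using False so by (auto simp: sorted_append) 
      moreover have "Suc (length cs) \<notin> color_marks cs d" using color_marks_subset[of cs d] by auto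
      moreover have "finite (color_marks cs d)" using color_marks_subset finite_subset by blast
      moreover have "set ((cs @ [d]) @ [c]) = insert c (set (cs @ [d]))" by auto
      moreover have "color_marks (cs @ [d]) c = insert (Suc (length cs)) (color_marks cs d)" unfolding m using False by simp
      ultimately show ?thesis using IH card_insert_disjoint[of "set (cs @ [d])" c]
        card_insert_disjoint[of "color_marks cs d" "Suc (length cs)"] by (metis List.finite_set)
    qed
  qed
  finally show "num_colors x (Suc n) = Suc (card (color_marks cs c))" .
qed

section \<open>The Green function of the colored walk\<close>

text \<open>The probability that the first \<open>l\<close> steps lead to new vertices outside \<open>[k]\<close>: before the \<open>i\<close>-th step,
  \<open>i\<close> vertices are occupied. It is the discrete counterpart of \<open>survival\<close>.\<close>

definition fresh_prob :: "nat \<Rightarrow> nat \<Rightarrow> nat \<Rightarrow> real" where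
  "fresh_prob N k l = (\<Prod>i=1..l. 1 - real (k + i) / real N)"

text \<open>The transition operator of the position, on the event that \<open>[k]\<close> is not hit: the walk is prolonged,
  or it closes a loop.\<close>

definition walk_transition :: "nat \<Rightarrow> nat \<Rightarrow> (nat \<times> nat set \<Rightarrow> ennreal) \<Rightarrow> nat \<times> nat set \<Rightarrow> ennreal" where
  "walk_transition N k F s = ennreal (1 / real N) *
     (of_nat (N - k - Suc (fst s)) * F (Suc (fst s), snd s) + (\<Sum>j\<le>fst s. F (j, cut_marks (snd s) j)))"

text \<open>The Green functional of the position: color changes occur with the weights \<open>1 / (k + c)\<close> of
  independent marks. The factor \<open>(k + 1) / k\<close> comes from the loops at the starting vertex, which
  create no color change.\<close>

definition walk_Green :: "nat \<Rightarrow> nat \<Rightarrow> (nat \<times> nat set \<Rightarrow> ennreal) \<Rightarrow> ennreal" where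
  "walk_Green N k F = (\<Sum>l<N - k. ennreal ((real k + 1) / real k * fresh_prob N k l) *
     (\<Sum>A\<in>Pow {1..l}. (\<Prod>c\<in>A. ennreal (1 / real (k + c))) * F (l, A)))"

lemma fresh_prob_Suc: "fresh_prob N k (Suc l) = fresh_prob N k l * (1 - real (k + Suc l) / real N)"
  by (simp add: fresh_prob_def)

lemma fresh_prob_nonneg: "l \<le> N - k \<Longrightarrow> k < N \<Longrightarrow> fresh_prob N k l \<ge> 0"
  unfolding fresh_prob_def
proof (rule prod_nonneg)
  fix i assume "l \<le> N - k" "k < N" "i \<in> {1..l}"
  then have "real (k + i) \<le> real N" "real N > 0" by auto
  then show "0 \<le> 1 - real (k + i) / real N" by simp
qed

lemma fresh_prob_eq_0: "N - k \<le> l \<Longrightarrow> k < N \<Longrightarrow> fresh_prob N k l = 0"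
  unfolding fresh_prob_def
proof (rule prod_zero)
  assume "N - k \<le> l" "k < N"
  then show "\<exists>i\<in>{1..l}. 1 - real (k + i) / real N = 0" by (intro bexI[of _ "N - k"]) auto
qed simp

lemma sum_Pow_prod: 
  fixes q :: "nat \<Rightarrow> ennreal"
  shows "finite S \<Longrightarrow> (\<Sum>B\<in>Pow S. \<Prod>c\<in>B. q c) = (\<Prod>c\<in>S. 1 + q c)"
proof (induction S rule: finite_induct)
  case (insert x S)
  have "(\<Sum>B\<in>Pow (insert x S). \<Prod>c\<in>B. q c) = (\<Sum>B\<in>Pow S. \<Prod>c\<in>B. q c) + (\<Sum>B\<in>insert x ` Pow S. \<Prod>c\<in>B. q c)"
    unfolding Pow_insert using insert by (intro sum.union_disjoint) auto
  also have "(\<Sum>B\<in>insert x ` Pow S. \<Prod>c\<in>B. q c) = (\<Sum>B\<in>Pow S. \<Prod>c\<in>insert x B. q c)"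
    by (rule sum.reindex_cong[where l = "insert x"]) (use insert in \<open>auto simp: inj_on_def\<close>)
  also have "\<dots> = (\<Sum>B\<in>Pow S. q x * (\<Prod>c\<in>B. q c))"
  proof (rule sum.cong[OF refl])
    fix B assume "B \<in> Pow S"
    then have "x \<notin> B" "finite B" using insert finite_subset by auto
    then show "(\<Prod>c\<in>insert x B. q c) = q x * (\<Prod>c\<in>B. q c)" by simp
  qed
  finally show ?case using insert by (simp add: sum_distrib_left[symmetric] algebra_simps)
qed simp

lemma prod_one_plus_inverse:
  assumes "k \<ge> 1" "1 \<le> j" "j \<le> Suc l"
  shows "(\<Prod>c\<in>{j..l}. 1 + ennreal (1 / real (k + c))) = ennreal (real (k + Suc l) / real (k + j))"
  using assms(3)
proof (induction l)
  case 0 then show ?case using assms by (cases "j = 1") auto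
next
  case (Suc l)
  show ?case
  proof (cases "j = Suc (Suc l)")
    case True then show ?thesis using assms by simp
  next
    case False
    then have j: "j \<le> Suc l" using Suc.prems by simp
    have "(\<Prod>c\<in>{j..Suc l}. 1 + ennreal (1 / real (k + c))) = ennreal (real (k + Suc l) / real (k + j)) * (1 + ennreal (1 / real (k + Suc l)))"
    proof -
      have "\<not> Suc l < j" using j by simp
      then show ?thesis unfolding prod.cl_ivl_Suc Suc.IH[OF j] by (simp only: if_False)
    qed
    also have "1 + ennreal (1 / real (k + Suc l)) = ennreal (1 + 1 / real (k + Suc l))"
      by (subst ennreal_plus) auto
    also have "ennreal (real (k + Suc l) / real (k + j)) * \<dots> = ennreal (real (k + Suc (Suc l)) / real (k + j))"
    proof -
      have "x / y * (1 + 1 / x) = (x + 1) / y" if "x \<noteq> 0" for x y :: real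
        using that by (cases "y = 0") (simp_all add: field_simps)
      from this[of "real (k + Suc l)" "real (k + j)"]
      have "real (k + Suc l) / real (k + j) * (1 + 1 / real (k + Suc l)) = real (k + Suc (Suc l)) / real (k + j)" by simp
      then show ?thesis by (subst ennreal_mult[symmetric]) simp_all
    qed
    finally show ?thesis .
  qed
qed

text \<open>The marks before \<open>j\<close> and those from \<open>j\<close> on are independent; cutting at \<open>j\<close> forgets the latter.\<close>

lemma sum_Pow_cut_marks:
  fixes q :: "nat \<Rightarrow> ennreal" and F :: "nat set \<Rightarrow> ennreal"
  assumes "1 \<le> j" "j \<le> l"
  shows "(\<Sum>A\<in>Pow {1..l}. (\<Prod>c\<in>A. q c) * F (cut_marks A j))
    = (\<Sum>A\<in>Pow {1..<j}. (\<Prod>c\<in>A. q c) * F (insert j A)) * (\<Prod>c\<in>{j..l}. 1 + q c)"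
proof -
  have "(\<Sum>A\<in>Pow {1..l}. (\<Prod>c\<in>A. q c) * F (cut_marks A j))
    = (\<Sum>(A, B)\<in>Pow {1..<j} \<times> Pow {j..l}. (\<Prod>c\<in>A. q c) * F (insert j A) * (\<Prod>c\<in>B. q c))"
  proof (rule sum.reindex_bij_witness[of _ "\<lambda>(A, B). A \<union> B" "\<lambda>A. (A \<inter> {1..<j}, A \<inter> {j..l})"])
    fix A assume "A \<in> Pow {1..l}"
    then show "(case (A \<inter> {1..<j}, A \<inter> {j..l}) of (A, B) \<Rightarrow> A \<union> B) = A" using assms by (auto simp: not_less)
    have A: "A = (A \<inter> {1..<j}) \<union> (A \<inter> {j..l})" using \<open>A \<in> Pow {1..l}\<close> by auto
    have "(\<Prod>c\<in>A. q c) = (\<Prod>c\<in>A \<inter> {1..<j}. q c) * (\<Prod>c\<in>A \<inter> {j..l}. q c)"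
      by (subst A, rule prod.union_disjoint) auto
    moreover have "cut_marks A j = insert j (A \<inter> {1..<j})"
      using assms \<open>A \<in> Pow {1..l}\<close> by (auto simp: cut_marks_def)
    ultimately show "(case (A \<inter> {1..<j}, A \<inter> {j..l}) of (A, B) \<Rightarrow> (\<Prod>c\<in>A. q c) * F (insert j A) * (\<Prod>c\<in>B. q c))
       = (\<Prod>c\<in>A. q c) * F (cut_marks A j)" by (simp add: ac_simps)
  qed (use assms in \<open>auto simp: subset_eq\<close>)
  also have "\<dots> = (\<Sum>A\<in>Pow {1..<j}. (\<Prod>c\<in>A. q c) * F (insert j A)) * (\<Sum>B\<in>Pow {j..l}. \<Prod>c\<in>B. q c)"
    by (simp add: sum.cartesian_product[symmetric] sum_product)
  finally show ?thesis by (simp add: sum_Pow_prod)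
qed

text \<open>The summand is the probability that the first \<open>l\<close> steps are new and the next one is not, so the sum
  telescopes.\<close>

lemma sum_fresh_prob:
  assumes "k < N" "j \<le> L" "L \<le> N - k"
  shows "(\<Sum>l\<in>{j..<L}. fresh_prob N k l * real (k + Suc l) / real N) = fresh_prob N k j - fresh_prob N k L"
  using assms(2,3)
proof (induction L rule: dec_induct)
  case (step n)
  then show ?case by (simp add: fresh_prob_Suc algebra_simps diff_divide_distrib)
qed simp

text \<open>Both sides are compared at each position \<open>(l, A)\<close>. It is reached by a prolonging step from length
  \<open>l - 1\<close> if \<open>l\<close> is not a color change, and by a loop if it is. For a loop to \<open>j > 0\<close>, summing over
  the forgotten marks turns the weight of the marks into
  \<open>\<Prod>c=j..l. 1 + 1 / (k + c) = (k + l + 1) / (k + j)\<close>, and the sum over the length \<open>l\<close> of the walk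
  before the loop telescopes by \<open>sum_fresh_prob\<close>. What remains is the weight \<open>1 / (k + j)\<close> of a mark
  at \<open>j\<close>. The loops to 0 and the start together account for the factor
  \<open>(k + 1) / k = 1 + (k + 1) / k * (1 / (k + 1))\<close> at length 0.\<close>

lemma walk_Green_transition_le:
  assumes k: "1 \<le> k" "k < N"
  shows "F (0, {}) + walk_Green N k (walk_transition N k F) \<le> walk_Green N k F"
proof -
  define L where "L = N - k"
  have L: "L \<ge> 1" using k by (simp add: L_def)
  define t where "t l = ennreal ((real k + 1) / real k * fresh_prob N k l)" for l
  define q where "q c = ennreal (1 / real (k + c))" for c
  define \<epsilon> where "\<epsilon> = ennreal (1 / real N)"
  have t_Suc: "\<epsilon> * of_nat (L - Suc l) * t l = t (Suc l)" if "l < L" for l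
  proof -
    have "fresh_prob N k l \<ge> 0" using that k by (intro fresh_prob_nonneg) (auto simp: L_def)
    moreover have "1 / real N * real (L - Suc l) = 1 - real (k + Suc l) / real N"
      using that k by (simp add: L_def of_nat_diff field_simps)
    moreover have "ennreal a * ennreal b * ennreal c = ennreal ((a * b) * c)" if "a \<ge> 0" "b \<ge> 0" "c \<ge> 0" for a b c
      using that by (simp add: ennreal_mult)
    from this[of "1 / real N" "real (L - Suc l)" "(real k + 1) / real k * fresh_prob N k l"]
    have "\<epsilon> * of_nat (L - Suc l) * t l = ennreal ((1 / real N * real (L - Suc l)) * ((real k + 1) / real k * fresh_prob N k l))"
      using \<open>fresh_prob N k l \<ge> 0\<close> by (simp add: t_def \<epsilon>_def ennreal_of_nat_eq_real_of_nat)
    ultimately show ?thesis unfolding t_def fresh_prob_Suc by (simp only: mult_ac)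
  qed
  have t_L: "t L = 0" unfolding t_def using fresh_prob_eq_0[of N k L] k by (simp add: L_def)
  have tail: "(\<Sum>l\<in>{j..<L}. \<epsilon> * t l * (\<Prod>c\<in>{max 1 j..l}. 1 + q c)) \<le> t j * ennreal (1 / real (k + max 1 j))" if "j < L" for j
  proof -
    have fp: "fresh_prob N k l \<ge> 0" if "l \<le> L" for l
      using that k by (intro fresh_prob_nonneg) (auto simp: L_def)
    have "(\<Sum>l\<in>{j..<L}. \<epsilon> * t l * (\<Prod>c\<in>{max 1 j..l}. 1 + q c))
      = (\<Sum>l\<in>{j..<L}. ennreal ((real k + 1) / real k * (1 / real (k + max 1 j)) * (fresh_prob N k l * real (k + Suc l) / real N)))"
    proof (rule sum.cong[OF refl])
      fix l assume l: "l \<in> {j..<L}"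
      have "(\<Prod>c\<in>{max 1 j..l}. 1 + q c) = ennreal (real (k + Suc l) / real (k + max 1 j))"
        unfolding q_def by (rule prod_one_plus_inverse) (use l k in auto)
      then show "\<epsilon> * t l * (\<Prod>c\<in>{max 1 j..l}. 1 + q c)
        = ennreal ((real k + 1) / real k * (1 / real (k + max 1 j)) * (fresh_prob N k l * real (k + Suc l) / real N))"
        unfolding t_def \<epsilon>_def using fp[of l] l by (simp add: ennreal_mult[symmetric] mult_ac)
    qed
    also have "\<dots> = ennreal ((real k + 1) / real k * (1 / real (k + max 1 j)) * (\<Sum>l\<in>{j..<L}. fresh_prob N k l * real (k + Suc l) / real N))"
      unfolding sum_distrib_left using fp by (intro sum_ennreal) auto
    also have "(\<Sum>l\<in>{j..<L}. fresh_prob N k l * real (k + Suc l) / real N) = fresh_prob N k j"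
      using sum_fresh_prob[of k N j L] that k fresh_prob_eq_0[of N k L] by (simp add: L_def)
    also have "ennreal ((real k + 1) / real k * (1 / real (k + max 1 j)) * fresh_prob N k j) = t j * ennreal (1 / real (k + max 1 j))"
      unfolding t_def using fp[of j] that by (simp add: ennreal_mult[symmetric] mult_ac)
    finally show ?thesis by simp
  qed
  define g where "g A = (\<Prod>c\<in>A. q c)" for A
  have G: "walk_Green N k F = (\<Sum>l<L. t l * (\<Sum>A\<in>Pow {1..l}. g A * F (l, A)))" for F
    unfolding walk_Green_def L_def t_def g_def q_def ..
  \<comment> \<open>The two sums are the contributions of the prolonging steps and of the loops.\<close>
  have "walk_Green N k (walk_transition N k F)
    = (\<Sum>l<L. \<epsilon> * of_nat (L - Suc l) * t l * (\<Sum>A\<in>Pow {1..l}. g A * F (Suc l, A)))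
      + (\<Sum>l<L. \<epsilon> * t l * (\<Sum>A\<in>Pow {1..l}. g A * (\<Sum>j\<le>l. F (j, cut_marks A j))))"
    unfolding G walk_transition_def sum.distrib[symmetric] L_def \<epsilon>_def fst_conv snd_conv
    by (intro sum.cong refl) (simp add: sum_distrib_left sum.distrib[symmetric] distrib_left mult_ac)
  also have "(\<Sum>l<L. \<epsilon> * of_nat (L - Suc l) * t l * (\<Sum>A\<in>Pow {1..l}. g A * F (Suc l, A)))
     = (\<Sum>l<L. t (Suc l) * (\<Sum>A\<in>Pow {1..l}. g A * F (Suc l, A)))"
    by (intro sum.cong refl) (simp add: t_Suc)
  also have "\<dots> = (\<Sum>l<L. (if l = 0 then 0 else t l * (\<Sum>A\<in>Pow {1..<l}. g A * F (l, A))))"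
  proof -
    obtain L' where L': "L = Suc L'" using L by (cases L) auto
    have "(\<Sum>l<L. t (Suc l) * (\<Sum>A\<in>Pow {1..l}. g A * F (Suc l, A)))
       = (\<Sum>l<L'. t (Suc l) * (\<Sum>A\<in>Pow {1..l}. g A * F (Suc l, A)))"
      using t_L by (simp add: L')
    also have "\<dots> = (\<Sum>l<L'. t (Suc l) * (\<Sum>A\<in>Pow {1..<Suc l}. g A * F (Suc l, A)))"
      by (simp only: atLeastLessThanSuc_atLeastAtMost)
    also have "\<dots> = (\<Sum>l<L. (if l = 0 then 0 else t l * (\<Sum>A\<in>Pow {1..<l}. g A * F (l, A))))"
      unfolding L' sum.lessThan_Suc_shift by simp
    finally show ?thesis .
  qed
  also have "(\<Sum>l<L. \<epsilon> * t l * (\<Sum>A\<in>Pow {1..l}. g A * (\<Sum>j\<le>l. F (j, cut_marks A j))))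
     = (\<Sum>j<L. \<Sum>l\<in>{j..<L}. \<epsilon> * t l * (\<Sum>A\<in>Pow {1..l}. g A * F (j, cut_marks A j)))"
  proof -
    have "(\<Sum>l<L. \<epsilon> * t l * (\<Sum>A\<in>Pow {1..l}. g A * (\<Sum>j\<le>l. F (j, cut_marks A j))))
      = (\<Sum>l<L. \<Sum>j\<le>l. \<epsilon> * t l * (\<Sum>A\<in>Pow {1..l}. g A * F (j, cut_marks A j)))"
      by (intro sum.cong refl, subst sum_distrib_left[symmetric], subst sum.swap) (simp add: sum_distrib_left)
    also have "\<dots> = (\<Sum>j<L. \<Sum>l\<in>{j..<L}. \<epsilon> * t l * (\<Sum>A\<in>Pow {1..l}. g A * F (j, cut_marks A j)))"
      unfolding sum.Sigma[OF finite_lessThan ballI, OF finite_atMost] sum.Sigma[OF finite_lessThan ballI, OF finite_atLeastLessThan]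
      by (rule sum.reindex_bij_witness[of _ "\<lambda>(j, l). (l, j)" "\<lambda>(l, j). (j, l)"]) auto
    finally show ?thesis .
  qed
  finally have split: "walk_Green N k (walk_transition N k F)
    = (\<Sum>l<L. (if l = 0 then 0 else t l * (\<Sum>A\<in>Pow {1..<l}. g A * F (l, A))))
      + (\<Sum>j<L. \<Sum>l\<in>{j..<L}. \<epsilon> * t l * (\<Sum>A\<in>Pow {1..l}. g A * F (j, cut_marks A j)))" .
  have loops: "(\<Sum>j<L. \<Sum>l\<in>{j..<L}. \<epsilon> * t l * (\<Sum>A\<in>Pow {1..l}. g A * F (j, cut_marks A j)))
    \<le> (\<Sum>j<L. if j = 0 then t 0 * ennreal (1 / real (k + 1)) * F (0, {})
      else t j * ennreal (1 / real (k + j)) * (\<Sum>A\<in>Pow {1..<j}. g A * F (j, insert j A)))"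
  proof (rule sum_mono)
    fix j assume j: "j \<in> {..<L}"
    show "(\<Sum>l\<in>{j..<L}. \<epsilon> * t l * (\<Sum>A\<in>Pow {1..l}. g A * F (j, cut_marks A j)))
      \<le> (if j = 0 then t 0 * ennreal (1 / real (k + 1)) * F (0, {})
      else t j * ennreal (1 / real (k + j)) * (\<Sum>A\<in>Pow {1..<j}. g A * F (j, insert j A)))"
    proof (cases "j = 0")
      case True
      have "(\<Sum>l\<in>{j..<L}. \<epsilon> * t l * (\<Sum>A\<in>Pow {1..l}. g A * F (j, cut_marks A j)))
         = (\<Sum>l\<in>{j..<L}. \<epsilon> * t l * (\<Prod>c\<in>{max 1 j..l}. 1 + q c)) * F (0, {})"
        unfolding True cut_marks_def g_def sum_distrib_right
        by (intro sum.cong refl) (simp add: sum_distrib_right[symmetric] sum_Pow_prod mult.assoc)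
      also have "\<dots> \<le> t j * ennreal (1 / real (k + max 1 j)) * F (0, {})"
        by (intro mult_right_mono tail) (use j in auto)
      finally show ?thesis using True by simp
    next
      case False
      have "(\<Sum>l\<in>{j..<L}. \<epsilon> * t l * (\<Sum>A\<in>Pow {1..l}. g A * F (j, cut_marks A j)))
         = (\<Sum>l\<in>{j..<L}. \<epsilon> * t l * (\<Prod>c\<in>{max 1 j..l}. 1 + q c)) * (\<Sum>A\<in>Pow {1..<j}. g A * F (j, insert j A))"
        unfolding sum_distrib_right
      proof (intro sum.cong refl)
        fix l assume l: "l \<in> {j..<L}"
        show "\<epsilon> * t l * (\<Sum>A\<in>Pow {1..l}. g A * F (j, cut_marks A j))
          = \<epsilon> * t l * (\<Prod>c\<in>{max 1 j..l}. 1 + q c) * (\<Sum>A\<in>Pow {1..<j}. g A * F (j, insert j A))"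
          unfolding g_def using sum_Pow_cut_marks[of j l q "\<lambda>A. F (j, A)"] False l
          by (simp add: max_absorb2 mult_ac)
      qed
      also have "\<dots> \<le> t j * ennreal (1 / real (k + max 1 j)) * (\<Sum>A\<in>Pow {1..<j}. g A * F (j, insert j A))"
        by (intro mult_right_mono tail) (use j in auto)
      finally show ?thesis using False by (simp add: max_absorb2)
    qed
  qed
  have "F (0, {}) + walk_Green N k (walk_transition N k F)
    \<le> F (0, {}) + ((\<Sum>l<L. (if l = 0 then 0 else t l * (\<Sum>A\<in>Pow {1..<l}. g A * F (l, A))))
      + (\<Sum>j<L. if j = 0 then t 0 * ennreal (1 / real (k + 1)) * F (0, {})
      else t j * ennreal (1 / real (k + j)) * (\<Sum>A\<in>Pow {1..<j}. g A * F (j, insert j A))))"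
    unfolding split by (intro add_left_mono loops)
  also have "\<dots> = F (0, {}) + (\<Sum>l<L. if l = 0 then t 0 * ennreal (1 / real (k + 1)) * F (0, {}) else t l * (\<Sum>A\<in>Pow {1..l}. g A * F (l, A)))"
  proof -
    have "t l * (\<Sum>A\<in>Pow {1..<l}. g A * F (l, A)) + t l * ennreal (1 / real (k + l)) * (\<Sum>A\<in>Pow {1..<l}. g A * F (l, insert l A))
      = t l * (\<Sum>A\<in>Pow {1..l}. g A * F (l, A))" if "l \<noteq> 0" for l
    proof -
      have iv: "{1..l} = insert l {1..<l}" using that by auto
      have "(\<Sum>A\<in>Pow {1..l}. g A * F (l, A)) = (\<Sum>A\<in>Pow {1..<l}. g A * F (l, A)) + (\<Sum>A\<in>insert l ` Pow {1..<l}. g A * F (l, A))"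
        unfolding iv Pow_insert by (rule sum.union_disjoint) auto
      also have "(\<Sum>A\<in>insert l ` Pow {1..<l}. g A * F (l, A)) = (\<Sum>A\<in>Pow {1..<l}. g (insert l A) * F (l, insert l A))"
      proof (rule sum.reindex_cong[where l = "insert l"])
        show "inj_on (insert l) (Pow {1..<l})"
          by (intro inj_onI) (metis Diff_insert_absorb PowD atLeastLessThan_iff less_irrefl subsetD)
      qed auto
      also have "\<dots> = (\<Sum>A\<in>Pow {1..<l}. q l * (g A * F (l, insert l A)))"
      proof (rule sum.cong[OF refl])
        fix A assume "A \<in> Pow {1..<l}"
        then have "l \<notin> A" "finite A" using finite_subset by auto
        then show "g (insert l A) * F (l, insert l A) = q l * (g A * F (l, insert l A))"
          unfolding g_def by (simp add: mult.assoc)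
      qed
      finally show ?thesis unfolding q_def by (simp add: sum_distrib_left[symmetric] distrib_left mult.assoc)
    qed
    then show ?thesis unfolding sum.distrib[symmetric]
      by (intro arg_cong2[of _ _ _ _ "(+)"] sum.cong refl) auto
  qed
  also have "\<dots> = walk_Green N k F"
  proof -
    obtain L' where L': "L = Suc L'" using L by (cases L) auto
    have "F (0, {}) + t 0 * ennreal (1 / real (k + 1)) * F (0, {}) = t 0 * F (0, {})"
    proof -
      have "1 + t 0 * ennreal (1 / real (k + 1)) = ennreal (1 + (real k + 1) / real k * (1 / real (k + 1)))"
        unfolding t_def fresh_prob_def by (simp add: ennreal_mult[symmetric] del: ennreal_plus flip: ennreal_plus ennreal_1)
      also have "1 + (real k + 1) / real k * (1 / real (k + 1)) = (real k + 1) / real k" using k by (simp add: field_simps)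
      finally have "1 + t 0 * ennreal (1 / real (k + 1)) = t 0" unfolding t_def fresh_prob_def by simp
      then have "t 0 * F (0, {}) = (1 + t 0 * ennreal (1 / real (k + 1))) * F (0, {})" by simp
      then show ?thesis by (simp add: distrib_right)
    qed
    moreover have "g {} = 1" by (simp add: g_def)
    ultimately show ?thesis unfolding G L' sum.lessThan_Suc_shift by (simp add: add.assoc[symmetric])
  qed
  finally show ?thesis .
qed

text \<open>The walk hits \<open>[k]\<close> at most once, and it does so in the next step with probability \<open>k / N\<close>. In the
  sum over the marks, \<open>(k + 1) / k\<close> cancels and the sum over the lengths telescopes.\<close>

lemma walk_Green_1_le:
  assumes k: "1 \<le> k" "k < N"
  shows "ennreal (real k / real N) * walk_Green N k (\<lambda>_. 1) \<le> 1"
proof -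
  define L where "L = N - k"
  have "ennreal (real k / real N) * walk_Green N k (\<lambda>_. 1)
    = (\<Sum>l\<in>{0..<L}. ennreal (fresh_prob N k l * real (k + Suc l) / real N))"
    unfolding walk_Green_def L_def lessThan_atLeast0 sum_distrib_left[where A = "{0..<N - k}"]
  proof (intro sum.cong refl)
    fix l assume l: "l \<in> {0..<N - k}"
    have fp: "fresh_prob N k l \<ge> 0" using l k by (intro fresh_prob_nonneg) auto
    have "(\<Sum>A\<in>Pow {1..l}. (\<Prod>c\<in>A. ennreal (1 / real (k + c))) * 1) = ennreal (real (k + Suc l) / real (k + 1))"
      using sum_Pow_prod[of "{1..l}" "\<lambda>c. ennreal (1 / real (k + c))"] prod_one_plus_inverse[of k 1 l] k by simp
    then show "ennreal (real k / real N) * (ennreal ((real k + 1) / real k * fresh_prob N k l) *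
        (\<Sum>A\<in>Pow {1..l}. (\<Prod>c\<in>A. ennreal (1 / real (k + c))) * 1)) = ennreal (fresh_prob N k l * real (k + Suc l) / real N)"
      using fp k by (simp add: ennreal_mult[symmetric] divide_simps)
  qed
  also have "\<dots> = ennreal (\<Sum>l\<in>{0..<L}. fresh_prob N k l * real (k + Suc l) / real N)"
    using k by (intro sum_ennreal) (auto simp: L_def intro!: fresh_prob_nonneg mult_nonneg_nonneg divide_nonneg_nonneg)
  also have "(\<Sum>l\<in>{0..<L}. fresh_prob N k l * real (k + Suc l) / real N) = 1"
    using sum_fresh_prob[of k N 0 L] fresh_prob_eq_0[of N k L] k by (simp add: L_def fresh_prob_def[of _ _ 0])
  finally show ?thesis by simp
qed

section \<open>The walk up to its hitting time\<close>

lemma upper_singleton: "upper [x] = x"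
  by (simp add: upper_def)

lemma lew_cong: "(\<And>t. t \<le> n \<Longrightarrow> x t = y t) \<Longrightarrow> lew x n = lew y n"
  by (induction n) auto

lemma measurable_lew:
  fixes g :: "'a \<Rightarrow> nat \<Rightarrow> nat"
  assumes "\<And>t. t \<le> n \<Longrightarrow> (\<lambda>\<omega>. g \<omega> t) \<in> M \<rightarrow>\<^sub>M count_space UNIV"
  shows "(\<lambda>\<omega>. lew (g \<omega>) n) \<in> M \<rightarrow>\<^sub>M count_space UNIV"
  using assms
proof (induction n)
  case 0
  then show ?case using measurable_compose[OF 0[of 0], of "\<lambda>v. ([v], [], 0)" "count_space UNIV"] by simp
next
  case (Suc n)
  then have "(\<lambda>\<omega>. lew (g \<omega>) n) \<in> M \<rightarrow>\<^sub>M count_space UNIV" by simp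
  moreover have "(\<lambda>\<omega>. g \<omega> (Suc n)) \<in> M \<rightarrow>\<^sub>M count_space UNIV" using Suc.prems by simp
  ultimately show ?case unfolding lew.simps
    by (intro measurable_compose_countable[where f = "\<lambda>v \<omega>. lew_step v (lew (g \<omega>) n)" and g = "\<lambda>\<omega>. g \<omega> (Suc n)"])
       (auto intro: measurable_compose)
qed

locale stopped_walk = prob_space M for M :: "'a measure" +
  fixes X :: "nat \<Rightarrow> 'a \<Rightarrow> nat" and N k :: nat
  assumes walk: "uniform_walk M N X" and k: "1 \<le> k" "k < N"
begin

lemma X0: "\<omega> \<in> space M \<Longrightarrow> X 0 \<omega> = N"
  using walk by (simp add: uniform_walk_def)

lemma indep_X: "indep_vars (\<lambda>_. count_space UNIV) X {1..}"
  using walk by (simp add: uniform_walk_def)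

lemma distr_X: "t \<ge> 1 \<Longrightarrow> distr M (count_space UNIV) (X t) = measure_pmf (pmf_of_set {1..N})"
  using walk by (simp add: uniform_walk_def)

lemma measurable_X [measurable]: "X t \<in> M \<rightarrow>\<^sub>M count_space UNIV"
proof (cases "t = 0")
  case True
  then show ?thesis using X0 by (subst measurable_cong[of _ _ "\<lambda>_. N"]) auto
next
  case False
  then show ?thesis using indep_X by (auto simp: indep_vars_def)
qed

lemma borel_measurable_X [measurable]: "X t \<in> borel_measurable M"
  using measurable_compose[OF measurable_X, of "\<lambda>v. v" borel] by simp

lemma AE_X_range: "AE \<omega> in M. \<forall>t\<ge>1. X t \<omega> \<in> {1..N}"
proof (subst AE_all_countable, intro allI)
  fix t
  show "AE \<omega> in M. t \<ge> 1 \<longrightarrow> X t \<omega> \<in> {1..N}"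
  proof (cases "t \<ge> 1")
    case True
    have "AE x in distr M (count_space UNIV) (X t). x \<in> {1..N}"
      unfolding distr_X[OF True] using k by (auto simp: AE_measure_pmf_iff set_pmf_of_set)
    then show ?thesis by (subst (asm) AE_distr_iff) auto
  qed simp
qed

definition S where "S n \<omega> = lew (\<lambda>t. X t \<omega>) n"

text \<open>Time 0 is left out because the walk starts at \<open>N\<close>, which lies outside \<open>[k]\<close>.\<close>

definition alive where "alive n \<omega> \<longleftrightarrow> (\<forall>t\<in>{1..n}. X t \<omega> \<notin> {1..k})"

lemma measurable_S [measurable]: "S n \<in> M \<rightarrow>\<^sub>M count_space UNIV"
  unfolding S_def[abs_def] by (rule measurable_lew) measurable

lemma measurable_alive [measurable]: "Measurable.pred M (alive n)"
  unfolding alive_def[abs_def] by measurable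

definition occupation :: "nat \<Rightarrow> (nat \<times> nat set \<Rightarrow> ennreal) \<Rightarrow> ennreal" where
  "occupation n F = (\<integral>\<^sup>+\<omega>. (if alive n \<omega> then F (position (S n \<omega>)) else 0) \<partial>M)"

text \<open>The next vertex is uniform and independent of the walk up to time \<open>n\<close>. The initial vertex is
  deterministic and is therefore restored by hand.\<close>

lemma nn_integral_next_step:
  fixes H :: "bool \<Rightarrow> nat list \<times> nat list \<times> nat \<Rightarrow> nat \<Rightarrow> ennreal"
  shows "(\<integral>\<^sup>+\<omega>. H (alive n \<omega>) (S n \<omega>) (X (Suc n) \<omega>) \<partial>M)
    = (\<integral>\<^sup>+\<omega>. ennreal (1 / real N) * (\<Sum>v\<in>{1..N}. H (alive n \<omega>) (S n \<omega>) v) \<partial>M)"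
proof -
  let ?C = "\<lambda>I :: nat set. PiM I (\<lambda>_. count_space (UNIV :: nat set))"
  define st where "st f = lew (f(0 := N)) n" for f :: "nat \<Rightarrow> nat"
  define al where "al f \<longleftrightarrow> (\<forall>t\<in>{1..n}. f t \<notin> {1..k})" for f :: "nat \<Rightarrow> nat"
  have comp: "(\<lambda>f. f t) \<in> ?C {1..n} \<rightarrow>\<^sub>M count_space UNIV" if "t \<in> {1..n}" for t
    using that by (rule measurable_component_singleton)
  have [measurable]: "st \<in> ?C {1..n} \<rightarrow>\<^sub>M count_space UNIV"
    unfolding st_def[abs_def]
  proof (rule measurable_lew)
    fix t assume "t \<le> n"
    then show "(\<lambda>f. (f(0 := N)) t) \<in> ?C {1..n} \<rightarrow>\<^sub>M count_space UNIV"
      by (cases "t = 0") (auto intro!: comp)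
  qed
  have [measurable]: "Measurable.pred (?C {1..n}) al"
    unfolding al_def[abs_def]
    by (intro pred_intros_finite finite_atLeastAtMost) (auto intro!: measurable_compose[OF comp])
  have [measurable]: "(\<lambda>f. f (Suc n)) \<in> ?C {Suc n} \<rightarrow>\<^sub>M count_space UNIV"
    by (rule measurable_component_singleton) simp
  have m: "(\<lambda>(f, g). H (al f) (st f) (g (Suc n))) \<in>
    borel_measurable (?C {1..n} \<Otimes>\<^sub>M ?C {Suc n})"
  proof -
    have "(\<lambda>z :: (nat \<Rightarrow> nat) \<times> (nat \<Rightarrow> nat). (al (fst z), st (fst z), snd z (Suc n))) \<in>
      (?C {1..n} \<Otimes>\<^sub>M ?C {Suc n}) \<rightarrow>\<^sub>M
      (count_space UNIV \<Otimes>\<^sub>M (count_space UNIV \<Otimes>\<^sub>M count_space UNIV))"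
      by measurable
    also have "count_space UNIV \<Otimes>\<^sub>M (count_space UNIV \<Otimes>\<^sub>M count_space UNIV)
      = (count_space UNIV :: (bool \<times> (nat list \<times> nat list \<times> nat) \<times> nat) measure)"
      by (simp add: pair_measure_countable)
    finally have "(\<lambda>z :: (nat \<Rightarrow> nat) \<times> (nat \<Rightarrow> nat). (al (fst z), st (fst z), snd z (Suc n))) \<in>
      (?C {1..n} \<Otimes>\<^sub>M ?C {Suc n}) \<rightarrow>\<^sub>M count_space UNIV" .
    from measurable_compose[OF this, of "\<lambda>(b, s, v). H b s v" borel]
    show ?thesis by (simp add: case_prod_unfold)
  qed
  have ind: "independent_elements M (?C {1..n}) (\<lambda>\<omega>. \<lambda>i\<in>{1..n}. X i \<omega>)
      (?C {Suc n}) (\<lambda>\<omega>. \<lambda>i\<in>{Suc n}. X i \<omega>)"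
    by (rule indep_vars_independent_elements[OF indep_X]) auto
  have al: "al (\<lambda>i\<in>{1..n}. X i \<omega>) = alive n \<omega>" for \<omega>
    by (simp add: al_def alive_def)
  have st: "st (\<lambda>i\<in>{1..n}. X i \<omega>) = S n \<omega>" if "\<omega> \<in> space M" for \<omega>
    unfolding st_def S_def by (rule lew_cong) (use X0[OF that] in auto)
  have "(\<integral>\<^sup>+\<omega>. H (alive n \<omega>) (S n \<omega>) (X (Suc n) \<omega>) \<partial>M)
    = (\<integral>\<^sup>+\<omega>. (\<lambda>(f, g). H (al f) (st f) (g (Suc n))) (\<lambda>i\<in>{1..n}. X i \<omega>, \<lambda>i\<in>{Suc n}. X i \<omega>) \<partial>M)"
    by (rule nn_integral_cong) (simp add: al st del: One_nat_def)
  also have "\<dots> = (\<integral>\<^sup>+\<omega>. (\<integral>\<^sup>+g. H (al (\<lambda>i\<in>{1..n}. X i \<omega>)) (st (\<lambda>i\<in>{1..n}. X i \<omega>)) (g (Suc n))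
       \<partial>distr M (?C {Suc n}) (\<lambda>\<omega>. \<lambda>i\<in>{Suc n}. X i \<omega>)) \<partial>M)"
    unfolding independent_elements_nn_integral[OF prob_space_axioms ind m] by simp
  also have "\<dots> = (\<integral>\<^sup>+\<omega>. ennreal (1 / real N) * (\<Sum>v\<in>{1..N}. H (alive n \<omega>) (S n \<omega>) v) \<partial>M)"
  proof (rule nn_integral_cong)
    fix \<omega> assume w: "\<omega> \<in> space M"
    define f where "f v = H (alive n \<omega>) (S n \<omega>) v" for v
    have "(\<integral>\<^sup>+g. f (g (Suc n)) \<partial>distr M (?C {Suc n}) (\<lambda>\<omega>. \<lambda>i\<in>{Suc n}. X i \<omega>))
      = (\<integral>\<^sup>+\<omega>'. f ((\<lambda>i\<in>{Suc n}. X i \<omega>') (Suc n)) \<partial>M)"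
      by (rule nn_integral_distr) measurable
    also have "\<dots> = (\<integral>\<^sup>+v. f v \<partial>distr M (count_space UNIV) (X (Suc n)))"
      by (subst nn_integral_distr) auto
    also have "\<dots> = (\<Sum>v\<in>{1..N}. f v) / ennreal (real N)"
      unfolding distr_X[of "Suc n", simplified] using k
      by (subst nn_integral_pmf_of_set) (auto simp: ennreal_of_nat_eq_real_of_nat)
    also have "\<dots> = ennreal (1 / real N) * (\<Sum>v\<in>{1..N}. f v)"
      using k by (simp add: divide_ennreal_def inverse_ennreal inverse_eq_divide mult.commute)
    finally show "(\<integral>\<^sup>+g. H (al (\<lambda>i\<in>{1..n}. X i \<omega>)) (st (\<lambda>i\<in>{1..n}. X i \<omega>)) (g (Suc n))
       \<partial>distr M (?C {Suc n}) (\<lambda>\<omega>. \<lambda>i\<in>{Suc n}. X i \<omega>))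
      = ennreal (1 / real N) * (\<Sum>v\<in>{1..N}. H (alive n \<omega>) (S n \<omega>) v)"
      unfolding al st[OF w] f_def .
  qed
  finally show ?thesis .
qed

lemma AE_alive_S:
  "AE \<omega> in M. alive n \<omega> \<longrightarrow> set (fst (S n \<omega>)) \<subseteq> {Suc k..N}"
  using AE_X_range AE_space
proof eventually_elim
  case (elim \<omega>)
  have "X t \<omega> \<in> {Suc k..N}" if "alive n \<omega>" "t \<le> n" for t
  proof (cases "t = 0")
    case True
    then show ?thesis using X0[OF elim(2)] k by simp
  next
    case False
    then have "X t \<omega> \<in> {1..N}" "X t \<omega> \<notin> {1..k}" using that elim(1) unfolding alive_def by auto
    then show ?thesis by auto
  qed
  then show ?case using set_lew_subset[of "\<lambda>t. X t \<omega>" n] unfolding S_def by fastforce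
qed

lemma occupation_Suc: "occupation (Suc n) F = occupation n (walk_transition N k F)"
proof -
  have "occupation (Suc n) F = (\<integral>\<^sup>+\<omega>. (\<lambda>b s v. if b \<and> v \<notin> {1..k} then F (position (lew_step v s)) else 0)
     (alive n \<omega>) (S n \<omega>) (X (Suc n) \<omega>) \<partial>M)"
    unfolding occupation_def S_def
    by (intro nn_integral_cong) (auto simp: alive_def atLeastAtMostSuc_conv)
  also have "\<dots> = (\<integral>\<^sup>+\<omega>. ennreal (1 / real N) * (\<Sum>v\<in>{1..N}.
      (if alive n \<omega> \<and> v \<notin> {1..k} then F (position (lew_step v (S n \<omega>))) else 0)) \<partial>M)"
    by (rule nn_integral_next_step)
  also have "\<dots> = occupation n (walk_transition N k F)"
    unfolding occupation_def
  proof (rule nn_integral_cong_AE)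
    show "AE \<omega> in M. ennreal (1 / real N) * (\<Sum>v\<in>{1..N}.
      (if alive n \<omega> \<and> v \<notin> {1..k} then F (position (lew_step v (S n \<omega>))) else 0))
      = (if alive n \<omega> then walk_transition N k F (position (S n \<omega>)) else 0)"
      using AE_alive_S[of n]
    proof eventually_elim
      case (elim \<omega>)
      show ?case
      proof (cases "alive n \<omega>")
        case True
        obtain ys cs c where s: "S n \<omega> = (ys, cs, c)" by (cases "S n \<omega>")
        have inv: "lew_invariant (ys, cs, c)" using lew_invariant_lew[of "\<lambda>t. X t \<omega>" n] s by (simp add: S_def)
        have ys: "set ys \<subseteq> {Suc k..N}" using elim True s by simp
        have "(\<Sum>v\<in>{1..N}. (if alive n \<omega> \<and> v \<notin> {1..k} then F (position (lew_step v (S n \<omega>))) else 0))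
          = (\<Sum>v\<in>{Suc k..N}. F (position (lew_step v (ys, cs, c))))"
          unfolding s using True by (intro sum.mono_neutral_cong_right) auto
        then show ?thesis
          using True sum_position_lew_step[OF inv ys, of F]
          by (simp add: walk_transition_def s position_def del: lew_step.simps)
      qed simp
    qed
  qed
  finally show ?thesis .
qed

lemma occupation_0: "occupation 0 F = F (0, {})"
proof -
  have "occupation 0 F = (\<integral>\<^sup>+\<omega>. F (0, {}) \<partial>M)"
    unfolding occupation_def alive_def S_def by (simp add: position_def color_marks_def)
  then show ?thesis by (simp add: emeasure_space_1)
qed

lemma suminf_occupation_le: "(\<Sum>n. occupation n F) \<le> walk_Green N k F"
  by (rule suminf_iterates_le_supersolution[where A = "\<lambda>_. True" and K = "walk_transition N k"])
     (auto simp: occupation_Suc occupation_0 intro: walk_Green_transition_le[OF k])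

lemma nn_integral_hit:
  "(\<integral>\<^sup>+\<omega>. (if alive n \<omega> \<and> X (Suc n) \<omega> \<in> {1..k} then F (position (S n \<omega>)) else 0) \<partial>M)
    = ennreal (real k / real N) * occupation n F"
proof -
  have "(\<integral>\<^sup>+\<omega>. (if alive n \<omega> \<and> X (Suc n) \<omega> \<in> {1..k} then F (position (S n \<omega>)) else 0) \<partial>M)
    = (\<integral>\<^sup>+\<omega>. ennreal (1 / real N) * (\<Sum>v\<in>{1..N}. (if alive n \<omega> \<and> v \<in> {1..k} then F (position (S n \<omega>)) else 0)) \<partial>M)"
    by (rule nn_integral_next_step[where H = "\<lambda>b s v. if b \<and> v \<in> {1..k} then F (position s) else 0"])
  also have "\<dots> = (\<integral>\<^sup>+\<omega>. ennreal (real k / real N) * (if alive n \<omega> then F (position (S n \<omega>)) else 0) \<partial>M)"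
  proof (rule nn_integral_cong)
    fix \<omega>
    have "(\<Sum>v\<in>{1..N}. (if alive n \<omega> \<and> v \<in> {1..k} then F (position (S n \<omega>)) else 0))
      = (\<Sum>v\<in>{1..k}. (if alive n \<omega> then F (position (S n \<omega>)) else 0))"
      using k by (intro sum.mono_neutral_cong_right) auto
    also have "\<dots> = ennreal (real k) * (if alive n \<omega> then F (position (S n \<omega>)) else 0)"
      by (simp add: ennreal_of_nat_eq_real_of_nat)
    finally show "ennreal (1 / real N) * (\<Sum>v\<in>{1..N}. (if alive n \<omega> \<and> v \<in> {1..k} then F (position (S n \<omega>)) else 0))
      = ennreal (real k / real N) * (if alive n \<omega> then F (position (S n \<omega>)) else 0)"
      by (simp add: mult.assoc[symmetric] ennreal_mult[symmetric])
  qed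
  also have "\<dots> = ennreal (real k / real N) * occupation n F"
    unfolding occupation_def
  proof (rule nn_integral_cmult)
    have [measurable]: "(\<lambda>\<omega>. F (position (S n \<omega>))) \<in> borel_measurable M"
      by (rule measurable_compose[OF measurable_S]) simp
    show "(\<lambda>\<omega>. if alive n \<omega> then F (position (S n \<omega>)) else 0) \<in> borel_measurable M" by measurable
  qed
  finally show ?thesis .
qed

lemma walk_Green_1_finite: "walk_Green N k (\<lambda>_. 1) < \<infinity>"
proof (rule ccontr)
  assume "\<not> walk_Green N k (\<lambda>_. 1) < \<infinity>"
  then have "walk_Green N k (\<lambda>_. 1) = \<infinity>" by (simp add: not_less top_unique)
  then show False using walk_Green_1_le[OF k] k by (simp add: ennreal_mult_top top_unique)
qed

text \<open>The expected number of steps before \<open>[k]\<close> is hit is at most the total mass of the Green functional.\<close>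

lemma AE_hits: "AE \<omega> in M. \<exists>n. alive n \<omega> \<and> X (Suc n) \<omega> \<in> {1..k}"
proof -
  have occ: "occupation n (\<lambda>_. 1) = emeasure M {\<omega> \<in> space M. alive n \<omega>}" for n
  proof -
    have "occupation n (\<lambda>_. 1) = (\<integral>\<^sup>+\<omega>. indicator {\<omega> \<in> space M. alive n \<omega>} \<omega> \<partial>M)"
      unfolding occupation_def by (intro nn_integral_cong) auto
    then show ?thesis by simp
  qed
  have fin: "(\<Sum>n. emeasure M {\<omega> \<in> space M. alive n \<omega>}) < \<infinity>"
    using suminf_occupation_le[of "\<lambda>_. 1"] walk_Green_1_finite unfolding occ by (rule order.strict_trans1)
  then have "AE \<omega> in M. \<exists>n. alive n \<omega> \<and> \<not> alive (Suc n) \<omega>"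
    by (intro AE_last_success) (auto simp: alive_def)
  then show ?thesis by eventually_elim (auto simp: alive_def atLeastAtMostSuc_conv)
qed

lemma hitting_time_eq:
  assumes "\<omega> \<in> space M" "alive n \<omega>" "X (Suc n) \<omega> \<in> {1..k}"
  shows "hitting_time k (\<lambda>t. X t \<omega>) = Suc n"
  unfolding hitting_time_def
proof (rule Least_equality)
  fix y assume y: "X y \<omega> \<in> {1..k}"
  show "Suc n \<le> y"
  proof (rule ccontr)
    assume "\<not> Suc n \<le> y"
    then have "y = 0 \<or> y \<in> {1..n}" by auto
    then show False using y assms(2) X0[OF assms(1)] k by (auto simp: alive_def)
  qed
qed fact

definition changes where
  "changes \<omega> = color_changes (\<lambda>t. X t \<omega>) (hitting_time k (\<lambda>t. X t \<omega>))"

lemma AE_changes: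
  "AE \<omega> in M. \<exists>n. alive n \<omega> \<and> X (Suc n) \<omega> \<in> {1..k} \<and> hitting_time k (\<lambda>t. X t \<omega>) = Suc n \<and>
     changes \<omega> = snd (position (S n \<omega>)) \<and> num_colors (\<lambda>t. X t \<omega>) (Suc n) = Suc (card (changes \<omega>))"
proof -
  have "AE \<omega> in M. \<forall>n. alive n \<omega> \<longrightarrow> set (fst (S n \<omega>)) \<subseteq> {Suc k..N}"
    by (subst AE_all_countable) (intro allI AE_alive_S)
  with AE_hits AE_space show ?thesis
  proof eventually_elim
    case (elim \<omega>)
    then obtain n where n: "alive n \<omega>" "X (Suc n) \<omega> \<in> {1..k}" by blast
    note h = hitting_time_eq[OF elim(2) n]
    obtain ys cs c where s: "S n \<omega> = (ys, cs, c)" by (cases "S n \<omega>")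
    have "X (Suc n) \<omega> \<notin> set ys" using elim(3) n s by fastforce
    note cc = color_changes_lew_snoc[of "\<lambda>t. X t \<omega>" n ys cs c, OF s[unfolded S_def] this]
    show ?case using n h cc by (intro exI[of _ n]) (simp add: changes_def s position_def)
  qed
qed

lemma nn_integral_changes_le:
  assumes [measurable]: "(\<lambda>\<omega>. G (changes \<omega>)) \<in> borel_measurable M"
  shows "(\<integral>\<^sup>+\<omega>. G (changes \<omega>) \<partial>M) \<le> ennreal (real k / real N) * walk_Green N k (\<lambda>s. G (snd s))"
proof -
  let ?f = "\<lambda>n \<omega>. if alive n \<omega> \<and> X (Suc n) \<omega> \<in> {1..k} then G (snd (position (S n \<omega>))) else 0"
  have [measurable]: "?f n \<in> borel_measurable M" for n
  proof -
    have [measurable]: "(\<lambda>\<omega>. G (snd (position (S n \<omega>)))) \<in> borel_measurable M"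
      by (rule measurable_compose[OF measurable_S]) simp
    show ?thesis by measurable
  qed
  have "(\<integral>\<^sup>+\<omega>. G (changes \<omega>) \<partial>M) \<le> (\<integral>\<^sup>+\<omega>. (\<Sum>n. ?f n \<omega>) \<partial>M)"
  proof (rule nn_integral_mono_AE)
    show "AE \<omega> in M. G (changes \<omega>) \<le> (\<Sum>n. ?f n \<omega>)"
      using AE_changes
    proof eventually_elim
      case (elim \<omega>)
      then obtain n where "alive n \<omega>" "X (Suc n) \<omega> \<in> {1..k}" "changes \<omega> = snd (position (S n \<omega>))" by blast
      then have "G (changes \<omega>) = ?f n \<omega>" by simp
      also have "\<dots> = (\<Sum>n\<in>{n}. ?f n \<omega>)" by simp
      also have "\<dots> \<le> (\<Sum>n. ?f n \<omega>)" by (rule sum_le_suminf) auto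
      finally show ?case .
    qed
  qed
  also have "\<dots> = (\<Sum>n. \<integral>\<^sup>+\<omega>. ?f n \<omega> \<partial>M)"
    by (rule nn_integral_suminf) measurable
  also have "\<dots> = (\<Sum>n. ennreal (real k / real N) * occupation n (\<lambda>s. G (snd s)))"
    using nn_integral_hit[of _ "\<lambda>s. G (snd s)"] by simp
  also have "\<dots> = ennreal (real k / real N) * (\<Sum>n. occupation n (\<lambda>s. G (snd s)))" by simp
  also have "\<dots> \<le> ennreal (real k / real N) * walk_Green N k (\<lambda>s. G (snd s))"
    by (intro mult_left_mono suminf_occupation_le) auto
  finally show ?thesis .
qed

lemma measurable_hitting_time [measurable]: "(\<lambda>\<omega>. hitting_time k (\<lambda>t. X t \<omega>)) \<in> M \<rightarrow>\<^sub>M count_space UNIV"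
  unfolding hitting_time_def by measurable

text \<open>The time and the state take countably many values.\<close>

lemma measurable_stopped:
  fixes g :: "nat \<Rightarrow> nat list \<times> nat list \<times> nat \<Rightarrow> 'c"
  shows "(\<lambda>\<omega>. g (hitting_time k (\<lambda>t. X t \<omega>)) (lew (\<lambda>t. X t \<omega>) (hitting_time k (\<lambda>t. X t \<omega>)))) \<in> M \<rightarrow>\<^sub>M count_space UNIV"
proof (rule measurable_compose_countable[where f = "\<lambda>n \<omega>. g n (lew (\<lambda>t. X t \<omega>) n)"])
  fix n
  have "(\<lambda>\<omega>. lew (\<lambda>t. X t \<omega>) n) \<in> M \<rightarrow>\<^sub>M count_space UNIV" by (rule measurable_lew) measurable
  then show "(\<lambda>\<omega>. g n (lew (\<lambda>t. X t \<omega>) n)) \<in> M \<rightarrow>\<^sub>M count_space UNIV"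
    by (rule measurable_compose) simp
qed measurable

lemma measurable_changes [measurable]: "changes \<in> M \<rightarrow>\<^sub>M count_space UNIV"
  unfolding changes_def[abs_def] color_changes_def edge_color_def lew_length_def
  by (rule measurable_stopped[where g = "\<lambda>n s. {i \<in> {1..length (fst s) - 1 - 1}. fst (snd s) ! (i - 1) \<noteq> fst (snd s) ! (i + 1 - 1)}"])

text \<open>The upper bound \<open>nn_integral_changes_le\<close>, applied to the event that the set of color changes differs
  from \<open>set l\<close>, is a lower bound for the probability of equality, because the total mass of the
  majorant is at most 1. The sum on the left runs over the length \<open>j\<close> of the walk immediately before
  it hits \<open>[k]\<close>.\<close>

lemma prob_changes_ge:
  assumes l: "sorted_wrt (<) (0 # l)"
  shows "dextend (\<lambda>_. ennreal ((real k + 1) / real N)) (\<lambda>l. ennreal (fresh_prob N k (upper l))) [upper l] *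
     prod_list (map (\<lambda>c. ennreal (1 / real (k + c))) l)
    \<le> emeasure M {\<omega> \<in> space M. sorted_list_of_set (changes \<omega>) = l}"
proof -
  define A where "A = set l"
  define q where "q c = ennreal (1 / real (k + c))" for c
  have dl: "distinct l" "sorted l" using l by (auto simp: strict_sorted_iff)
  have l_eq: "sorted_list_of_set A = l" using dl by (simp add: A_def sorted_list_of_set.idem_if_sorted_distinct)
  have up: "\<forall>x\<in>A. 1 \<le> x \<and> x \<le> upper l"
    using l unfolding A_def by (induction l rule: rev_induct) (auto simp: sorted_wrt_append)
  have fin: "finite (changes \<omega>)" for \<omega> by (simp add: changes_def color_changes_def)
  have ev: "{\<omega> \<in> space M. sorted_list_of_set (changes \<omega>) = l} = {\<omega> \<in> space M. changes \<omega> = A}"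
    using fin l_eq by (auto simp: A_def)
  define y where "y = ennreal (real k / real N) * walk_Green N k (\<lambda>s. if snd s = A then 0 else 1)"
  define x where "x = ennreal (real k / real N) * walk_Green N k (\<lambda>s. if snd s = A then 1 else 0)"
  have xy: "x + y \<le> 1"
  proof -
    have "walk_Green N k (\<lambda>s. if snd s = A then 1 else 0) + walk_Green N k (\<lambda>s. if snd s = A then 0 else 1) = walk_Green N k (\<lambda>_. 1)"
      unfolding walk_Green_def sum.distrib[symmetric] distrib_left[symmetric]
      by (intro sum.cong refl arg_cong2[of _ _ _ _ "(*)"]) (auto simp: distrib_left[symmetric])
    then show ?thesis using walk_Green_1_le[OF k] unfolding x_def y_def by (simp add: distrib_left[symmetric])
  qed
  have "emeasure M {\<omega> \<in> space M. changes \<omega> \<noteq> A} = (\<integral>\<^sup>+\<omega>. (\<lambda>B. if B = A then 0 else 1) (changes \<omega>) \<partial>M)"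
  proof -
    have "(\<integral>\<^sup>+\<omega>. (\<lambda>B. if B = A then 0 else 1 :: ennreal) (changes \<omega>) \<partial>M) = (\<integral>\<^sup>+\<omega>. indicator {\<omega> \<in> space M. changes \<omega> \<noteq> A} \<omega> \<partial>M)"
      by (intro nn_integral_cong) auto
    then show ?thesis by simp
  qed
  also have "\<dots> \<le> y" unfolding y_def
    by (rule nn_integral_changes_le[where G = "\<lambda>B. if B = A then 0 else 1"]) measurable
  finally have le_y: "emeasure M {\<omega> \<in> space M. changes \<omega> \<noteq> A} \<le> y" .
  have "{\<omega> \<in> space M. changes \<omega> \<noteq> A} = space M - {\<omega> \<in> space M. changes \<omega> = A}" by auto
  then have "emeasure M {\<omega> \<in> space M. changes \<omega> = A} + emeasure M {\<omega> \<in> space M. changes \<omega> \<noteq> A} = 1"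
    by (simp add: emeasure_compl emeasure_eq_measure prob_compl ennreal_plus[symmetric] del: ennreal_plus)
  then have "1 \<le> emeasure M {\<omega> \<in> space M. changes \<omega> = A} + y"
    using add_left_mono[OF le_y, of "emeasure M {\<omega> \<in> space M. changes \<omega> = A}"] by simp
  from order_trans[OF xy this]
  have "y + x \<le> y + emeasure M {\<omega> \<in> space M. changes \<omega> = A}" by (simp only: add.commute)
  moreover have "y \<noteq> \<infinity>" using xy by (auto simp: top_unique)
  ultimately have x_le: "x \<le> emeasure M {\<omega> \<in> space M. changes \<omega> = A}"
    unfolding ennreal_add_left_cancel_le by simp
  have pl: "prod_list (map (\<lambda>c. ennreal (1 / real (k + c))) l) = (\<Prod>c\<in>A. q c)"
    unfolding A_def q_def using prod.distinct_set_conv_list[OF dl(1)] by metis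
  have "dextend (\<lambda>_. ennreal ((real k + 1) / real N)) (\<lambda>l. ennreal (fresh_prob N k (upper l))) [upper l]
    = (\<Sum>j<N - k. if upper l < j then ennreal ((real k + 1) / real N) * ennreal (fresh_prob N k j) else 0)"
    unfolding dextend_def
  proof (subst suminf_finite[of "{..<N - k}"])
    show "(if upper [upper l] < j then ennreal ((real k + 1) / real N) * ennreal (fresh_prob N k (upper ([upper l] @ [j]))) else 0) = 0"
      if "j \<notin> {..<N - k}" for j
    proof -
      have "fresh_prob N k (upper ([upper l] @ [j])) = 0"
        unfolding upper_snoc using that k by (intro fresh_prob_eq_0) auto
      then show ?thesis by simp
    qed
  qed (simp_all only: upper_snoc upper_singleton finite_lessThan)
  also have "\<dots> * (\<Prod>c\<in>A. q c) \<le> x"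
    unfolding x_def walk_Green_def sum_distrib_left sum_distrib_right
  proof (rule sum_mono)
    fix j assume j: "j \<in> {..<N - k}"
    show "(if upper l < j then ennreal ((real k + 1) / real N) * ennreal (fresh_prob N k j) else 0) * (\<Prod>c\<in>A. q c)
      \<le> (\<Sum>i\<in>Pow {1..j}. ennreal (real k / real N) * (ennreal ((real k + 1) / real k * fresh_prob N k j) *
          ((\<Prod>c\<in>i. ennreal (1 / real (k + c))) * (if snd (j, i) = A then 1 else 0))))"
    proof (cases "upper l < j")
      case True
      then have A: "A \<in> Pow {1..j}" using up by force
      have fp: "fresh_prob N k j \<ge> 0" using j k by (intro fresh_prob_nonneg) auto
      have "ennreal ((real k + 1) / real N) * ennreal (fresh_prob N k j) = ennreal (real k / real N) * ennreal ((real k + 1) / real k * fresh_prob N k j)"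
        using fp k by (simp add: ennreal_mult[symmetric])
      then have "(if upper l < j then ennreal ((real k + 1) / real N) * ennreal (fresh_prob N k j) else 0) * (\<Prod>c\<in>A. q c)
        = (\<Sum>i\<in>{A}. ennreal (real k / real N) * (ennreal ((real k + 1) / real k * fresh_prob N k j) *
          ((\<Prod>c\<in>i. ennreal (1 / real (k + c))) * (if snd (j, i) = A then 1 else 0))))"
        using True by (simp add: q_def mult.assoc)
      also have "\<dots> \<le> (\<Sum>i\<in>Pow {1..j}. ennreal (real k / real N) * (ennreal ((real k + 1) / real k * fresh_prob N k j) *
          ((\<Prod>c\<in>i. ennreal (1 / real (k + c))) * (if snd (j, i) = A then 1 else 0))))"
        by (rule sum_mono2) (use A in auto)
      finally show ?thesis .
    qed simp
  qed
  finally show ?thesis unfolding ev pl using x_le by (rule order_trans)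
qed

end

section \<open>The scaling limit of the walk\<close>

text \<open>From \<open>ln (1 - a) \<ge> - a - 2 a\<^sup>2\<close> for \<open>0 \<le> a \<le> 1 / 2\<close>, applied to every factor.\<close>

lemma fresh_prob_ge:
  assumes "N > 0" "2 * (k + j) \<le> N"
  shows "exp (- ((real k * real j + real j * (real j + 1) / 2) / real N + 2 * real j * ((real k + real j) / real N)\<^sup>2)) \<le> fresh_prob N k j"
proof -
  define a where "a i = real (k + i) / real N" for i
  have a: "0 \<le> a i" "a i \<le> 1 / 2" "a i \<le> (real k + real j) / real N" if "i \<in> {1..j}" for i
    using that assms by (auto simp: a_def field_simps)
  have sum_a: "(\<Sum>i=1..j. a i) = (real k * real j + real j * (real j + 1) / 2) / real N"
  proof -
    have "(\<Sum>i=1..j. real (k + i)) = real k * real j + real j * (real j + 1) / 2"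
      by (induction j) (simp_all add: algebra_simps)
    then show ?thesis unfolding a_def by (simp add: sum_divide_distrib[symmetric])
  qed
  have "(\<Sum>i=1..j. 2 * (a i)\<^sup>2) \<le> (\<Sum>i=1..j. 2 * ((real k + real j) / real N)\<^sup>2)"
    using a by (intro sum_mono mult_left_mono power_mono) auto
  also have "\<dots> = 2 * real j * ((real k + real j) / real N)\<^sup>2" by simp
  finally have "exp (- ((real k * real j + real j * (real j + 1) / 2) / real N + 2 * real j * ((real k + real j) / real N)\<^sup>2))
    \<le> exp (\<Sum>i=1..j. - a i - 2 * (a i)\<^sup>2)"
    unfolding sum_a[symmetric] by (simp add: sum_subtractf sum_negf)
  also have "\<dots> = (\<Prod>i=1..j. exp (- a i - 2 * (a i)\<^sup>2))" by (simp add: exp_sum)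
  also have "\<dots> \<le> (\<Prod>i=1..j. 1 - a i)"
  proof (rule prod_mono)
    fix i assume i: "i \<in> {1..j}"
    have "- a i - 2 * (a i)\<^sup>2 \<le> ln (1 - a i)"
      using ln_one_minus_pos_lower_bound[of "a i"] a[OF i] by simp
    then have "exp (- a i - 2 * (a i)\<^sup>2) \<le> exp (ln (1 - a i))" by simp
    also have "\<dots> = 1 - a i" using a[OF i] by simp
    finally show "0 \<le> exp (- a i - 2 * (a i)\<^sup>2) \<and> exp (- a i - 2 * (a i)\<^sup>2) \<le> 1 - a i" by simp
  qed
  finally show ?thesis by (simp add: fresh_prob_def a_def)
qed

lemma survival_le_liminf_fresh_prob:
  fixes k j :: "nat \<Rightarrow> nat"
  assumes k: "(\<lambda>N. real (k N) / sqrt (real N)) \<longlonglongrightarrow> \<mu>" and j: "(\<lambda>N. real (j N) / sqrt (real N)) \<longlonglongrightarrow> x"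
  shows "ennreal (survival \<mu> x) \<le> liminf (\<lambda>N. ennreal (fresh_prob N (k N) (j N)))"
proof -
  define K J e where "K N = real (k N) / sqrt (real N)" and "J N = real (j N) / sqrt (real N)" and "e N = 1 / sqrt (real N)" for N
  have e: "e \<longlonglongrightarrow> 0" unfolding e_def by real_asymp
  define b where "b N = K N * J N + J N * (J N + e N) / 2 + 2 * J N * (K N + J N)\<^sup>2 * e N" for N
  have "b \<longlonglongrightarrow> \<mu> * x + x * (x + 0) / 2 + 2 * x * (\<mu> + x)\<^sup>2 * 0"
    unfolding b_def using k j e unfolding K_def[symmetric] J_def[symmetric] by (intro tendsto_intros) auto
  then have "(\<lambda>N. exp (- b N)) \<longlonglongrightarrow> exp (- (\<mu> * x + x * (x + 0) / 2 + 2 * x * (\<mu> + x)\<^sup>2 * 0))"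
    by (intro tendsto_intros)
  then have lim: "(\<lambda>N. exp (- b N)) \<longlonglongrightarrow> survival \<mu> x"
    by (simp add: survival_def power2_eq_square)
  have "(\<lambda>N. (K N + J N) * e N) \<longlonglongrightarrow> (\<mu> + x) * 0"
    using k j e unfolding K_def[symmetric] J_def[symmetric] by (intro tendsto_intros)
  then have "\<forall>\<^sub>F N in sequentially. (K N + J N) * e N < 1 / 2" by (intro order_tendstoD(2)) auto
  then have "\<forall>\<^sub>F N in sequentially. ennreal (exp (- b N)) \<le> ennreal (fresh_prob N (k N) (j N))"
    using eventually_gt_at_top[of 0]
  proof eventually_elim
    case (elim N)
    define s where "s = sqrt (real N)"
    have s: "s > 0" "real N = s * s" using elim by (auto simp: s_def)
    have kj: "real (k N) = K N * s" "real (j N) = J N * s" "e N = 1 / s" unfolding K_def J_def e_def s_def[symmetric] using s(1) by auto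
    have "(K N + J N) * e N * (s * s) < 1 / 2 * (s * s)" using elim(1) s by (intro mult_strict_right_mono) auto
    moreover have "(K N + J N) * e N * (s * s) = real (k N) + real (j N)" unfolding kj using s(1) by (simp add: field_simps)
    ultimately have "real (k N) + real (j N) < 1 / 2 * real N" unfolding s(2) by simp
    then have "real (2 * (k N + j N)) \<le> real N" by simp
    then have "2 * (k N + j N) \<le> N" by (simp only: of_nat_le_iff)
    from fresh_prob_ge[OF elim(2) this]
    have "exp (- ((real (k N) * real (j N) + real (j N) * (real (j N) + 1) / 2) / real N + 2 * real (j N) * ((real (k N) + real (j N)) / real N)\<^sup>2)) \<le> fresh_prob N (k N) (j N)" .
    also have "(real (k N) * real (j N) + real (j N) * (real (j N) + 1) / 2) / real N + 2 * real (j N) * ((real (k N) + real (j N)) / real N)\<^sup>2 = b N"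
      unfolding b_def kj s(2) using s(1) by (simp add: field_simps power2_eq_square)
    finally show ?case by (rule ennreal_leI)
  qed
  then have "liminf (\<lambda>N. ennreal (exp (- b N))) \<le> liminf (\<lambda>N. ennreal (fresh_prob N (k N) (j N)))"
    by (rule Liminf_mono)
  moreover have "liminf (\<lambda>N. ennreal (exp (- b N))) = ennreal (survival \<mu> x)"
    by (rule lim_imp_Liminf) (auto intro!: tendsto_ennrealI lim)
  ultimately show ?thesis by simp
qed

lemma floor_sqrt_tendsto:
  assumes "\<mu> > 0"
  shows "(\<lambda>N. real (nat \<lfloor>\<mu> * sqrt (real N)\<rfloor>) / sqrt (real N)) \<longlonglongrightarrow> \<mu>"
proof (rule tendsto_sandwich)
  show "\<forall>\<^sub>F N in sequentially. \<mu> - 1 / sqrt (real N) \<le> real (nat \<lfloor>\<mu> * sqrt (real N)\<rfloor>) / sqrt (real N)"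
    using eventually_gt_at_top[of 0]
  proof eventually_elim
    case (elim N)
    have "\<mu> * sqrt (real N) - 1 \<le> real (nat \<lfloor>\<mu> * sqrt (real N)\<rfloor>)" by linarith
    then have "(\<mu> * sqrt (real N) - 1) / sqrt (real N) \<le> real (nat \<lfloor>\<mu> * sqrt (real N)\<rfloor>) / sqrt (real N)"
      by (rule divide_right_mono) simp
    then show ?case using elim by (simp add: diff_divide_distrib)
  qed
  show "\<forall>\<^sub>F N in sequentially. real (nat \<lfloor>\<mu> * sqrt (real N)\<rfloor>) / sqrt (real N) \<le> \<mu>"
    using eventually_gt_at_top[of 0]
  proof eventually_elim
    case (elim N)
    have "\<mu> * sqrt (real N) \<ge> 0" using assms by simp
    then have "real (nat \<lfloor>\<mu> * sqrt (real N)\<rfloor>) \<le> \<mu> * sqrt (real N)" by linarith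
    then show ?case using elim by (simp add: pos_divide_le_eq)
  qed
  show "(\<lambda>N. \<mu> - 1 / sqrt (real N)) \<longlonglongrightarrow> \<mu>" by real_asymp
qed simp

lemma eventually_floor_sqrt:
  assumes "\<mu> > 0"
  shows "\<forall>\<^sub>F N in sequentially. 1 \<le> nat \<lfloor>\<mu> * sqrt (real N)\<rfloor> \<and> nat \<lfloor>\<mu> * sqrt (real N)\<rfloor> < N \<and> N \<ge> 2"
proof -
  have "\<forall>\<^sub>F N in sequentially. 1 \<le> \<mu> * sqrt (real N)" using assms by real_asymp
  moreover have "\<forall>\<^sub>F N in sequentially. \<mu> * sqrt (real N) < real N" using assms by real_asymp
  ultimately show ?thesis using eventually_ge_at_top[of 2]
  proof eventually_elim
    case (elim N)
    then have "1 \<le> \<lfloor>\<mu> * sqrt (real N)\<rfloor>" "\<lfloor>\<mu> * sqrt (real N)\<rfloor> < int N" by (auto simp: le_floor_iff floor_less_iff)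
    then show ?case using elim by linarith
  qed
qed

lemma grid_tendsto_butlast:
  "grid_tendsto h L l \<Longrightarrow> grid_tendsto h (\<lambda>N. butlast (L N)) (butlast l)"
  by (auto simp: grid_tendsto_def nth_butlast)

text \<open>In a sum over the last entry, what depends on the other entries only is a constant factor.\<close>

lemma dextend_mult_butlast:
  fixes g :: "nat list \<Rightarrow> ennreal"
  shows "dextend r (\<lambda>l. H (upper l) * g (butlast l)) l = dextend r (\<lambda>l. H (upper l)) [upper l] * g l"
proof -
  have "dextend r (\<lambda>l. H (upper l)) [upper l] * g l = (\<Sum>j. (if upper l < j then r j * H j else 0) * g l)"
    unfolding dextend_def upper_snoc upper_singleton by (rule ennreal_suminf_multc[symmetric])
  also have "\<dots> = dextend r (\<lambda>l. H (upper l) * g (butlast l)) l"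
    unfolding dextend_def upper_snoc butlast_snoc by (intro suminf_cong) (auto simp: mult.assoc)
  finally show ?thesis ..
qed

text \<open>The weights of \<open>prob_changes_ge\<close> converge on the grid of mesh \<open>1 / \<surd>N\<close>: \<open>\<surd>N / (k + c)\<close> to
  \<open>1 / (\<mu> + x)\<close>, \<open>(k + 1) / \<surd>N\<close> to \<open>\<mu>\<close>, and the product \<open>fresh_prob\<close> to \<open>survival\<close>. So
  \<open>grid_liminf_suminf\<close> applies.\<close>

lemma walk_lower_bound:
  fixes \<mu> :: real and M :: "nat \<Rightarrow> 'a measure" and X :: "nat \<Rightarrow> nat \<Rightarrow> 'a \<Rightarrow> nat"
  defines "k \<equiv> \<lambda>N. nat \<lfloor>\<mu> * sqrt (real N)\<rfloor>"
  assumes \<mu>: "\<mu> > 0" and walk: "\<And>N. N \<ge> 2 \<Longrightarrow> uniform_walk (M N) N (X N)"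
    and cont: "list_continuous f"
  shows "ladder_law \<mu> (\<lambda>l. f (butlast l)) \<le>
    liminf (\<lambda>N. \<integral>\<^sup>+\<omega>. f (map (\<lambda>j. real j / sqrt (real N))
       (sorted_list_of_set (color_changes (\<lambda>t. X N t \<omega>) (hitting_time (k N) (\<lambda>t. X N t \<omega>))))) \<partial>M N)"
    (is "_ \<le> liminf (\<lambda>N. \<integral>\<^sup>+\<omega>. ?f N \<omega> \<partial>M N)")
proof -
  \<comment> \<open>The mesh has to be positive also for \<open>N = 0\<close>.\<close>
  define h where "h N = (if N = 0 then 1 else 1 / sqrt (real N))" for N
  have h: "h N > 0" for N by (simp add: h_def)
  have h_ev: "\<forall>\<^sub>F N in sequentially. h N = 1 / sqrt (real N)"
    using eventually_gt_at_top[of 0] by eventually_elim (simp add: h_def)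
  have h0: "h \<longlonglongrightarrow> 0"
  proof (rule tendsto_cong[THEN iffD2, OF h_ev])
    show "(\<lambda>N. 1 / sqrt (real N)) \<longlonglongrightarrow> 0" by real_asymp
  qed
  have kl: "(\<lambda>N. real (k N) / sqrt (real N)) \<longlonglongrightarrow> \<mu>" unfolding k_def by (rule floor_sqrt_tendsto[OF \<mu>])
  have k_ev: "\<forall>\<^sub>F N in sequentially. 1 \<le> k N \<and> k N < N \<and> N \<ge> 2" unfolding k_def by (rule eventually_floor_sqrt[OF \<mu>])
  have hj: "(\<lambda>N. real (j N) / sqrt (real N)) \<longlonglongrightarrow> x" if "(\<lambda>N. h N * real (j N)) \<longlonglongrightarrow> x" for j x
    by (rule tendsto_cong[THEN iffD1, OF _ that]) (use h_ev in \<open>eventually_elim, simp\<close>)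
  define T where "T N l = ennreal (fresh_prob N (k N) (upper l)) * f (map (\<lambda>j. h N * real j) (butlast l))" for N l
  have lsc1: "grid_lsc h T (\<lambda>l. ennreal (survival \<mu> (upper l)) * f (butlast l))"
    unfolding grid_lsc_def T_def
  proof (intro allI impI liminf_mult_ge_ennreal)
    fix L l assume L: "grid_tendsto h L l"
    show "ennreal (survival \<mu> (upper l)) \<le> liminf (\<lambda>N. ennreal (fresh_prob N (k N) (upper (L N))))"
      by (rule survival_le_liminf_fresh_prob[OF kl hj[OF grid_tendsto_upper[OF L]]])
    from lim_imp_Liminf[OF _ list_continuous_grid[OF cont grid_tendsto_butlast[OF L]]]
    show "f (butlast l) \<le> liminf (\<lambda>N. f (map (\<lambda>j. h N * real j) (butlast (L N))))" by simp
  qed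
  define c where "c N = ennreal ((real (k N) + 1) / real N)" for N
  define r where "r N j = ennreal (1 / real (k N + j))" for N j
  have lsc2: "grid_lsc h (\<lambda>N. dextend (\<lambda>_. c N) (T N)) (extend (\<lambda>_. ennreal \<mu>) (\<lambda>l. ennreal (survival \<mu> (upper l)) * f (butlast l)))"
  proof (rule grid_lsc_extend[OF h h0 _ lsc1])
    have "(\<lambda>N. ennreal (real (k N) / sqrt (real N) + 1 / sqrt (real N))) \<longlonglongrightarrow> ennreal (\<mu> + 0)"
      by (intro tendsto_ennrealI tendsto_add kl) real_asymp
    then have "(\<lambda>N. c N / ennreal (h N)) \<longlonglongrightarrow> ennreal \<mu>"
    unfolding add_0_right
    proof (rule tendsto_cong[THEN iffD1, rotated])
      show "\<forall>\<^sub>F N in sequentially. ennreal (real (k N) / sqrt (real N) + 1 / sqrt (real N)) = c N / ennreal (h N)"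
        using h_ev k_ev
      proof eventually_elim
        case (elim N)
        have "(a + 1) / (s * s) / (1 / s) = a / s + 1 / s" if "s > 0" for a s :: real
          using that by (simp add: field_simps)
        from this[of "sqrt (real N)" "real (k N)"] elim
        have "(real (k N) + 1) / real N / (1 / sqrt (real N)) = real (k N) / sqrt (real N) + 1 / sqrt (real N)"
          by (simp only: real_sqrt_mult_self abs_of_nat) simp
        then show ?case using elim by (simp add: c_def divide_ennreal)
      qed
    qed
    then show "ennreal \<mu> \<le> liminf (\<lambda>N. c N / ennreal (h N))"
      using lim_imp_Liminf[of sequentially "\<lambda>N. c N / ennreal (h N)"] by simp
  qed
  have r_lim: "rate \<mu> x \<le> liminf (\<lambda>N. r N (j N) / ennreal (h N))"
    if x: "x > 0" and j: "(\<lambda>N. h N * real (j N)) \<longlonglongrightarrow> x" for j x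
  proof -
    have "(\<lambda>N. ennreal (1 / (real (k N) / sqrt (real N) + real (j N) / sqrt (real N)))) \<longlonglongrightarrow> ennreal (1 / (\<mu> + x))"
      by (intro tendsto_ennrealI tendsto_divide tendsto_const tendsto_add kl hj[OF j]) (use \<mu> x in simp)
    then have "(\<lambda>N. r N (j N) / ennreal (h N)) \<longlonglongrightarrow> ennreal (1 / (\<mu> + x))"
    proof (rule tendsto_cong[THEN iffD1, rotated])
      show "\<forall>\<^sub>F N in sequentially. ennreal (1 / (real (k N) / sqrt (real N) + real (j N) / sqrt (real N))) = r N (j N) / ennreal (h N)"
        using h_ev k_ev
      proof eventually_elim
        case (elim N)
        have "sqrt (real N) > 0" "real (k N + j N) > 0" using elim by auto
        then have "1 / real (k N + j N) / (1 / sqrt (real N)) = 1 / (real (k N) / sqrt (real N) + real (j N) / sqrt (real N))"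
          by (simp add: add_divide_distrib[symmetric])
        then show ?case using elim by (simp add: r_def divide_ennreal)
      qed
    qed
    then show ?thesis unfolding rate_def
      using lim_imp_Liminf[of sequentially "\<lambda>N. r N (j N) / ennreal (h N)"] by simp
  qed
  have "ladder_law \<mu> (\<lambda>l. f (butlast l)) \<le> liminf (\<lambda>N. \<Sum>n. (dextend (r N) ^^ n) (dextend (\<lambda>_. c N) (T N)) [])"
    unfolding ladder_law_def by (rule grid_liminf_suminf[OF h h0 r_lim lsc2])
  also have "\<dots> \<le> liminf (\<lambda>N. \<integral>\<^sup>+\<omega>. ?f N \<omega> \<partial>M N)"
  proof (rule Liminf_mono)
    show "\<forall>\<^sub>F N in sequentially. (\<Sum>n. (dextend (r N) ^^ n) (dextend (\<lambda>_. c N) (T N)) []) \<le>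
      (\<integral>\<^sup>+\<omega>. ?f N \<omega> \<partial>M N)"
      using h_ev k_ev
    proof eventually_elim
      case (elim N)
      interpret prob_space "M N" using walk[of N] elim by (simp add: uniform_walk_def)
      interpret stopped_walk "M N" "X N" N "k N" by unfold_locales (use walk[of N] elim in auto)
      let ?W = "\<lambda>u. dextend (\<lambda>_. c N) (\<lambda>l. ennreal (fresh_prob N (k N) (upper l))) [u]"
      let ?g = "\<lambda>l. f (map (\<lambda>j. h N * real j) l)"
      have "dextend (\<lambda>_. c N) (T N) = (\<lambda>l. ?W (upper l) * ?g l)"
        unfolding T_def[abs_def] using dextend_mult_butlast[of "\<lambda>_. c N" "\<lambda>u. ennreal (fresh_prob N (k N) u)" ?g] by (simp add: fun_eq_iff)
      moreover have "(\<Sum>n. (dextend (r N) ^^ n) (\<lambda>l. ?W (upper l) * ?g l) []) \<le> (\<integral>\<^sup>+\<omega>. ?g (sorted_list_of_set (changes \<omega>)) \<partial>M N)"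
      proof (rule suminf_dextend_le_nn_integral)
        show "(\<lambda>\<omega>. sorted_list_of_set (changes \<omega>)) \<in> M N \<rightarrow>\<^sub>M count_space UNIV"
          by (rule measurable_compose[OF measurable_changes]) simp
        fix l :: "nat list" assume "sorted_wrt (<) (0 # l)"
        then show "?W (upper l) * prod_list (map (r N) l) \<le> emeasure (M N) {\<omega> \<in> space (M N). sorted_list_of_set (changes \<omega>) = l}"
          unfolding r_def[abs_def] c_def by (rule prob_changes_ge)
      qed
      ultimately show ?case unfolding changes_def elim(1) by simp
    qed
  qed
  finally show ?thesis .
qed

section \<open>Poisson points below the Rayleigh process\<close>

lemma takeWhile_less_sorted:
  fixes l :: "real list" shows "sorted l \<Longrightarrow> takeWhile (\<lambda>z. z < y) l = filter (\<lambda>z. z < y) l"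
  by (induction l) (auto intro!: filter_False[symmetric])

text \<open>A ladder index stays one after jump \<open>m + 1\<close> if it is below \<open>Q (Suc m)\<close>; as the ladder indices
  increase, the remaining ones form a prefix of the list.\<close>

lemma ladder_list_eq:
  "ladder_list Q m = map Q (sorted_list_of_set {i \<in> {1..m}. \<forall>j\<in>{i<..m}. Q i < Q j})"
proof (induction m)
  case 0 then show ?case by simp
next
  case (Suc m)
  let ?K = "\<lambda>m. {i \<in> {1..m}. \<forall>j\<in>{i<..m}. Q i < Q j}"
  define xs where "xs = sorted_list_of_set (?K m)"
  have xs: "sorted_wrt (<) xs" "set xs = ?K m"
    unfolding xs_def by (auto simp: strict_sorted_iff)
  have "sorted (map Q xs)"
    unfolding sorted_map
    by (rule sorted_wrt_mono_rel[OF _ xs(1)]) (use xs(2) in \<open>auto intro!: less_imp_le\<close>)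
  then have tw: "takeWhile (\<lambda>z. z < Q (Suc m)) (map Q xs) = map Q (filter (\<lambda>i. Q i < Q (Suc m)) xs)"
    by (simp add: takeWhile_less_sorted filter_map o_def)
  have K: "?K (Suc m) = {i \<in> ?K m. Q i < Q (Suc m)} \<union> {Suc m}"
    by (auto simp: le_Suc_eq)
  have "sorted_list_of_set (?K (Suc m)) = filter (\<lambda>i. Q i < Q (Suc m)) xs @ [Suc m]"
  proof (rule sorted_distinct_set_unique)
    have "sorted_wrt (<) (filter (\<lambda>i. Q i < Q (Suc m)) xs @ [Suc m])"
      using xs by (auto simp: sorted_wrt_append sorted_wrt_filter)
    then show "sorted (filter (\<lambda>i. Q i < Q (Suc m)) xs @ [Suc m])" "distinct (filter (\<lambda>i. Q i < Q (Suc m)) xs @ [Suc m])"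
      by (simp_all add: strict_sorted_iff)
    show "set (sorted_list_of_set (?K (Suc m))) = set (filter (\<lambda>i. Q i < Q (Suc m)) xs @ [Suc m])"
    proof -
      have "set (sorted_list_of_set (?K (Suc m))) = ?K (Suc m)" by simp
      also have "\<dots> = set (filter (\<lambda>i. Q i < Q (Suc m)) xs @ [Suc m])" unfolding K using xs(2) by auto
      finally show ?thesis .
    qed
  qed simp_all
  then show ?case using Suc tw by (simp add: xs_def)
qed

definition seq_of_list :: "real list \<Rightarrow> nat \<times> (nat \<Rightarrow> real)" where
  "seq_of_list l = finite_seq (length l) (nth l)"

lemma ladder_indices_eq:
  "ladder_indices P Q T = seq_of_list (map Q (sorted_list_of_set (ladder_jumps P Q T)))"
proof -
  have "length (sorted_list_of_set A) = card A" for A :: "nat set"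
    by (cases "finite A") auto
  then show ?thesis unfolding ladder_indices_def seq_of_list_def finite_seq_def by (auto simp: fun_eq_iff)
qed

lemma points_below_eq: "points_below D r = seq_of_list (points_list D r)"
  unfolding points_below_def seq_of_list_def finite_seq_def points_list_def
  by (auto simp: fun_eq_iff simp del: upt_Suc)

lemma ladder_jumps_eq:
  assumes "\<And>i. P i < P (Suc i)" "P m \<le> T" "T < P (Suc m)"
  shows "ladder_jumps P Q T = {i \<in> {1..m}. \<forall>j\<in>{i<..m}. Q i < Q j}"
proof -
  have mono: "P i \<le> P j" if "i \<le> j" for i j
    using lift_Suc_mono_le[of P, OF less_imp_le[OF assms(1)] that] .
  have le: "P i \<le> T \<longleftrightarrow> i \<le> m" for i
    using mono[of i m] mono[of "Suc m" i] assms(2,3) by (cases "i \<le> m") auto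
  have "(\<forall>n\<ge>1. i + n \<le> m \<longrightarrow> Q i < Q (i + n)) \<longleftrightarrow> (\<forall>j\<in>{i<..m}. Q i < Q j)" for i
  proof
    assume a: "\<forall>n\<ge>1. i + n \<le> m \<longrightarrow> Q i < Q (i + n)"
    show "\<forall>j\<in>{i<..m}. Q i < Q j"
    proof
      fix j assume "j \<in> {i<..m}"
      then have "1 \<le> j - i" "i + (j - i) = j" "j \<le> m" by auto
      then show "Q i < Q j" using a[rule_format, of "j - i"] by simp
    qed
  qed auto
  then show ?thesis unfolding ladder_jumps_def le by auto
qed

context killed_rayleigh
begin

lemma last_stopped_list: "upper (stopped_list p q t) = rayleigh_path p q t"
  by (simp add: stopped_list_def rayleigh_path_def Let_def)

lemma measurable_ladder_jumps_list:
  "(\<lambda>\<omega>. ladder \<omega>) \<in> \<Omega> \<rightarrow>\<^sub>M list_borel"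
proof (rule measurable_compose_countable[where f = "\<lambda>l \<omega>. map (\<lambda>i. Q i \<omega>) l"])
  fix l
  show "(\<lambda>\<omega>. map (\<lambda>i. Q i \<omega>) l) \<in> \<Omega> \<rightarrow>\<^sub>M list_borel"
  proof (rule measurable_list_borelI)
    fix i
    have "(\<lambda>\<omega>. if i < length l then Q (l ! i) \<omega> else 0) \<in> borel_measurable \<Omega>" by measurable
    then show "(\<lambda>\<omega>. if i < length (map (\<lambda>i. Q i \<omega>) l) then map (\<lambda>i. Q i \<omega>) l ! i else 0) \<in> borel_measurable \<Omega>"
      by (rule measurable_cong[THEN iffD1, rotated]) auto
  qed simp
next
  let ?J = "\<lambda>\<omega>. ladder_jumps (\<lambda>i. P i \<omega>) (\<lambda>i. Q i \<omega>) (T \<omega>)"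
  have [measurable]: "Measurable.pred \<Omega> (\<lambda>\<omega>. i \<in> ?J \<omega>)" for i
    unfolding ladder_jumps_def mem_Collect_eq by measurable
  show "(\<lambda>\<omega>. sorted_list_of_set (?J \<omega>)) \<in> \<Omega> \<rightarrow>\<^sub>M count_space UNIV"
  proof (rule measurable_count_space_eq2_countable[THEN iffD2], safe)
    fix l
    have fin: "finite (?J \<omega>) \<longleftrightarrow> (\<exists>n. \<forall>i. i > n \<longrightarrow> i \<notin> ?J \<omega>)" for \<omega>
      by (auto simp: finite_nat_set_iff_bounded_le not_less[symmetric])
    have "(\<lambda>\<omega>. sorted_list_of_set (?J \<omega>)) -` {l} \<inter> space \<Omega>
      = {\<omega> \<in> space \<Omega>. if \<exists>n. \<forall>i. i > n \<longrightarrow> i \<notin> ?J \<omega> then (\<forall>i. i \<in> ?J \<omega> \<longleftrightarrow> i \<in> set l) \<and> sorted_list_of_set (set l) = l else l = []}"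
    proof (intro set_eqI)
      fix \<omega>
      have "sorted_list_of_set (?J \<omega>) = l \<longleftrightarrow> (if finite (?J \<omega>) then ?J \<omega> = set l \<and> sorted_list_of_set (set l) = l else l = [])"
        by (cases "finite (?J \<omega>)") auto
      then show "\<omega> \<in> (\<lambda>\<omega>. sorted_list_of_set (?J \<omega>)) -` {l} \<inter> space \<Omega> \<longleftrightarrow>
        \<omega> \<in> {\<omega> \<in> space \<Omega>. if \<exists>n. \<forall>i. i > n \<longrightarrow> i \<notin> ?J \<omega> then (\<forall>i. i \<in> ?J \<omega> \<longleftrightarrow> i \<in> set l) \<and> sorted_list_of_set (set l) = l else l = []}"
        unfolding fin by (auto simp: set_eq_iff)
    qed
    also have "\<dots> \<in> sets \<Omega>" by measurable
    finally show "(\<lambda>\<omega>. sorted_list_of_set (?J \<omega>)) -` {l} \<inter> space \<Omega> \<in> sets \<Omega>" .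
  qed auto
qed

lemma nn_integral_ladder_le:
  assumes [measurable]: "F \<in> borel_measurable list_borel"
  shows "(\<integral>\<^sup>+\<omega>. F (ladder \<omega>) \<partial>\<Omega>)
    \<le> ladder_law \<mu> (\<lambda>l. F (butlast l))"
proof -
  have "(\<integral>\<^sup>+\<omega>. F (ladder \<omega>) \<partial>\<Omega>)
    = (\<integral>\<^sup>+\<omega>. F (butlast (stopped \<omega>)) \<partial>\<Omega>)"
  proof (rule nn_integral_cong_AE)
    show "AE \<omega> in \<Omega>. F (ladder \<omega>)
      = F (butlast (stopped \<omega>))"
      using AE_killed
    proof eventually_elim
      case (elim \<omega>)
      then obtain m where m: "P m \<omega> \<le> T \<omega>" "T \<omega> < P (Suc m) \<omega>" and P: "\<And>i. P i \<omega> < P (Suc i) \<omega>"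
        by (auto simp: path_good_def)
      have "(LEAST i. T \<omega> < P (Suc i) \<omega>) = m"
        by (rule rayleigh_path_between[of "\<lambda>i. P i \<omega>", OF P m])
      then show ?case
        unfolding stopped_list_def ladder_jumps_eq[of "\<lambda>i. P i \<omega>", OF P m] by (simp add: ladder_list_eq)
    qed
  qed
  also have "\<dots> \<le> ladder_law \<mu> (\<lambda>l. F (butlast l))"
    by (rule nn_integral_stopped_list_le[of "\<lambda>l. F (butlast l)"]) measurable
  finally show ?thesis .
qed

lemma measurable_rayleigh_path_param:
  assumes [measurable]: "\<And>i. (\<lambda>x. p x i) \<in> borel_measurable N" "\<And>i. (\<lambda>x. q x i) \<in> borel_measurable N" "t \<in> borel_measurable N"
  shows "(\<lambda>x. rayleigh_path (p x) (q x) (t x)) \<in> borel_measurable N"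
  unfolding rayleigh_path_def Let_def
  by (rule measurable_compose_countable[where f = "\<lambda>i x. q x i + (t x - p x i)"]) measurable

lemma measurable_R [measurable]: "(\<lambda>\<omega>. level \<omega>) \<in> borel_measurable \<Omega>"
  by (rule measurable_rayleigh_path_param) measurable

text \<open>The height at the killing time has at most this density, by \<open>nn_integral_stopped_list_le\<close> and
  \<open>suminf_extend_below_le\<close>. The density has integral 1, so passing to complements gives equality.\<close>

lemma distr_R:
  "distr \<Omega> borel (\<lambda>\<omega>. level \<omega>)
    = density lborel (\<lambda>r. ennreal ((\<mu> + r) * survival \<mu> r) * indicator {0<..} r)" (is "?M = ?N")
proof (rule measure_eqI)
  interpret R: prob_space ?M by (rule prob_space_distr) measurable
  have "emeasure ?N (space ?N) = (\<integral>\<^sup>+r\<in>{0<..}. ennreal ((\<mu> + r) * survival \<mu> r) \<partial>lborel)"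
    by (subst emeasure_density) auto
  also have "\<dots> = 1" using nn_integral_survival_density[OF \<mu>, of 0] by simp
  finally interpret N: prob_space ?N by (rule prob_spaceI)
  have le: "emeasure ?M A \<le> emeasure ?N A" if [measurable]: "A \<in> sets borel" for A
  proof -
    have "emeasure ?M A = (\<integral>\<^sup>+\<omega>. indicator A (upper (stopped \<omega>)) \<partial>\<Omega>)"
      unfolding last_stopped_list
      by (subst emeasure_distr) (auto simp: nn_integral_indicator[symmetric] simp del: nn_integral_indicator
        intro!: nn_integral_cong split: split_indicator)
    also have "\<dots> \<le> ladder_law \<mu> (\<lambda>l. indicator A (upper l))"
      by (rule nn_integral_stopped_list_le) measurable
    also have "\<dots> = (\<integral>\<^sup>+r\<in>{0<..}. ennreal \<mu> * ennreal (survival \<mu> r) * indicator A r *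
        (\<Sum>n. (extend (rate_below \<mu> r) ^^ n) (\<lambda>_. 1) []) \<partial>lborel)"
      using ladder_law_disintegration[of "indicator A" "\<lambda>_. 1"] by simp
    also have "\<dots> \<le> (\<integral>\<^sup>+r. ennreal ((\<mu> + r) * survival \<mu> r) * indicator {0<..} r * indicator A r \<partial>lborel)"
    proof (rule nn_integral_mono)
      fix r :: real
      show "ennreal \<mu> * ennreal (survival \<mu> r) * indicator A r *
        (\<Sum>n. (extend (rate_below \<mu> r) ^^ n) (\<lambda>_. 1) []) * indicator {0<..} r
        \<le> ennreal ((\<mu> + r) * survival \<mu> r) * indicator {0<..} r * indicator A r"
      proof (cases "r > 0 \<and> r \<in> A")
        case True
        have "ennreal \<mu> * ennreal (survival \<mu> r) * (\<Sum>n. (extend (rate_below \<mu> r) ^^ n) (\<lambda>_. 1) [])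
          \<le> ennreal \<mu> * ennreal (survival \<mu> r) * ennreal ((\<mu> + r) / \<mu>)"
          by (intro mult_left_mono suminf_extend_below_le \<mu>) (use True in auto)
        also have "\<dots> = ennreal ((\<mu> + r) * survival \<mu> r)"
          using \<mu> True by (simp add: ennreal_mult[symmetric])
        finally show ?thesis using True by simp
      qed (auto split: split_indicator)
    qed
    also have "\<dots> = emeasure ?N A" by (subst emeasure_density) auto
    finally show ?thesis .
  qed
  show "emeasure ?M A = emeasure ?N A" if A: "A \<in> sets ?M" for A
  proof (rule antisym)
    from A have A': "A \<in> sets borel" by simp
    show "emeasure ?M A \<le> emeasure ?N A" by (rule le[OF A'])
    have "emeasure ?M (space ?M - A) \<le> emeasure ?N (space ?N - A)" using le[of "- A"] A' by (simp add: Compl_eq_Diff_UNIV)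
    then have "1 - measure ?M A \<le> 1 - measure ?N A"
      using A' R.prob_compl[of A] N.prob_compl[of A] by (simp add: R.emeasure_eq_measure N.emeasure_eq_measure)
    then show "emeasure ?N A \<le> emeasure ?M A"
      by (simp add: R.emeasure_eq_measure N.emeasure_eq_measure)
  qed
qed simp

text \<open>The points are independent of the height \<open>r\<close>, whose density is known, and \<open>points_lower_bound\<close> holds
  for each \<open>r\<close>. The factors combine by \<open>(\<mu> + r) * (\<mu> / (\<mu> + r)) = \<mu>\<close>.\<close>

lemma ladder_law_le_points:
  assumes pp: "poisson_points \<Omega> (\<lambda>t. 1 / (\<mu> + t)) D"
    and ind: "independent_elements \<Omega> (pair_seq_algebra \<Otimes>\<^sub>M borel) (\<lambda>\<omega>. (jumps \<omega>, T \<omega>))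
           (PiM {1..} (\<lambda>_. borel)) (\<lambda>\<omega>. \<lambda>i\<in>{1..}. D i \<omega>)"
    and F[measurable]: "F \<in> borel_measurable list_borel" and cont: "list_continuous F" and bd: "\<And>l. F l \<le> ennreal B"
  shows "ladder_law \<mu> (\<lambda>l. F (butlast l)) \<le>
    (\<integral>\<^sup>+\<omega>. F (points_list (\<lambda>i. D i \<omega>) (level \<omega>)) \<partial>\<Omega>)"
proof -
  have D_meas: "i \<ge> 1 \<Longrightarrow> D i \<in> borel_measurable \<Omega>" for i using pp by (simp add: poisson_points_def)
  have DP[measurable]: "(\<lambda>\<omega>. \<lambda>i\<in>{1..}. D i \<omega>) \<in> \<Omega> \<rightarrow>\<^sub>M PiM {1..} (\<lambda>_. borel)"
    using ind by (simp add: independent_elements_def)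
  have pl_restrict: "points_list (\<lambda>i\<in>{1..}. d i) r = points_list d r" for d r
  proof -
    have "{i. 1 \<le> i \<and> (\<lambda>i\<in>{1..}. d i) i < r} = {i. 1 \<le> i \<and> d i < r}" by auto
    then show ?thesis unfolding points_list_def by (auto simp del: upt_Suc)
  qed
  define \<Phi> where "\<Phi> r = (\<integral>\<^sup>+\<omega>. F (points_list (\<lambda>i. D i \<omega>) r) \<partial>\<Omega>)" for r
  have "(\<lambda>(r, \<omega>). points_list (\<lambda>i. D i \<omega>) r) \<in> borel \<Otimes>\<^sub>M \<Omega> \<rightarrow>\<^sub>M list_borel"
    unfolding case_prod_beta by (rule measurable_points_list) (auto intro!: measurable_compose[OF measurable_snd D_meas])
  then have [measurable]: "\<Phi> \<in> borel_measurable borel"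
    unfolding \<Phi>_def[abs_def] by measurable
  define h where "h z = F (points_list (snd z) (rayleigh_path (\<lambda>i. fst (fst (fst z) i)) (\<lambda>i. snd (fst (fst z) i)) (snd (fst z))))"
    for z :: "((nat \<Rightarrow> real \<times> real) \<times> real) \<times> (nat \<Rightarrow> real)"
  have h: "h \<in> borel_measurable ((pair_seq_algebra \<Otimes>\<^sub>M borel) \<Otimes>\<^sub>M PiM {1..} (\<lambda>_. borel))"
    unfolding h_def[abs_def]
  proof (rule measurable_compose[OF measurable_points_list F])
    fix i :: nat assume "i \<ge> 1"
    then have "(\<lambda>d. d i) \<in> borel_measurable (PiM {1..} (\<lambda>_. borel :: real measure))" by (intro measurable_component_singleton) auto
    from measurable_compose[OF measurable_snd this]
    show "(\<lambda>x. snd x i) \<in> borel_measurable ((pair_seq_algebra \<Otimes>\<^sub>M (borel :: real measure)) \<Otimes>\<^sub>M PiM {1..} (\<lambda>_. borel :: real measure))" .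
  next
    show "(\<lambda>x. rayleigh_path (\<lambda>i. fst (fst (fst x) i)) (\<lambda>i. snd (fst (fst x) i)) (snd (fst x)))
      \<in> borel_measurable ((pair_seq_algebra \<Otimes>\<^sub>M borel) \<Otimes>\<^sub>M PiM {1..} (\<lambda>_. borel))"
      by (rule measurable_rayleigh_path_param) measurable
  qed
  have "(\<integral>\<^sup>+\<omega>. F (points_list (\<lambda>i. D i \<omega>) (level \<omega>)) \<partial>\<Omega>)
    = (\<integral>\<^sup>+\<omega>. h ((jumps \<omega>, T \<omega>), \<lambda>i\<in>{1..}. D i \<omega>) \<partial>\<Omega>)"
    by (simp add: h_def pl_restrict del: One_nat_def)
  also have "\<dots> = (\<integral>\<^sup>+\<omega>. (\<integral>\<^sup>+d. h ((jumps \<omega>, T \<omega>), d) \<partial>distr \<Omega> (PiM {1..} (\<lambda>_. borel)) (\<lambda>\<omega>. \<lambda>i\<in>{1..}. D i \<omega>)) \<partial>\<Omega>)"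
    by (rule independent_elements_nn_integral[OF prob_space_axioms ind h])
  also have "\<dots> = (\<integral>\<^sup>+\<omega>. \<Phi> (level \<omega>) \<partial>\<Omega>)"
  proof (rule nn_integral_cong)
    fix \<omega> assume "\<omega> \<in> space \<Omega>"
    have "(\<lambda>d. h ((jumps \<omega>, T \<omega>), d)) \<in> borel_measurable (PiM {1..} (\<lambda>_. borel))"
      by (rule measurable_compose[OF measurable_Pair1' h]) (auto simp: space_pair_measure space_PiM)
    then have "(\<integral>\<^sup>+d. h ((jumps \<omega>, T \<omega>), d) \<partial>distr \<Omega> (PiM {1..} (\<lambda>_. borel)) (\<lambda>\<omega>. \<lambda>i\<in>{1..}. D i \<omega>))
      = (\<integral>\<^sup>+\<omega>'. h ((jumps \<omega>, T \<omega>), \<lambda>i\<in>{1..}. D i \<omega>') \<partial>\<Omega>)"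
      by (subst nn_integral_distr[OF DP]) (simp_all del: One_nat_def)
    then show "(\<integral>\<^sup>+d. h ((jumps \<omega>, T \<omega>), d) \<partial>distr \<Omega> (PiM {1..} (\<lambda>_. borel)) (\<lambda>\<omega>. \<lambda>i\<in>{1..}. D i \<omega>))
      = \<Phi> (level \<omega>)"
      by (simp add: h_def pl_restrict \<Phi>_def del: One_nat_def)
  qed
  also have "\<dots> = (\<integral>\<^sup>+r. \<Phi> r \<partial>distr \<Omega> borel (\<lambda>\<omega>. level \<omega>))"
    by (rule nn_integral_distr[symmetric]) measurable
  also have "\<dots> = (\<integral>\<^sup>+r. ennreal ((\<mu> + r) * survival \<mu> r) * indicator {0<..} r * \<Phi> r \<partial>lborel)"
    unfolding distr_R by (rule nn_integral_density) measurable
  finally have eq: "(\<integral>\<^sup>+\<omega>. F (points_list (\<lambda>i. D i \<omega>) (level \<omega>)) \<partial>\<Omega>)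
    = (\<integral>\<^sup>+r. ennreal ((\<mu> + r) * survival \<mu> r) * indicator {0<..} r * \<Phi> r \<partial>lborel)" .
  show ?thesis
    unfolding eq ladder_law_disintegration[of "\<lambda>_. 1", OF measurable_const F, simplified]
  proof (rule nn_integral_mono)
    fix r :: real
    show "ennreal \<mu> * ennreal (survival \<mu> r) * (\<Sum>n. (extend (rate_below \<mu> r) ^^ n) F []) * indicator {0<..} r
      \<le> ennreal ((\<mu> + r) * survival \<mu> r) * indicator {0<..} r * \<Phi> r"
    proof (cases "r > 0")
      case True
      have "ennreal \<mu> * ennreal (survival \<mu> r) = ennreal ((\<mu> + r) * survival \<mu> r) * ennreal (\<mu> / (\<mu> + r))"
        using \<mu> True by (simp add: ennreal_mult[symmetric])
      then have "ennreal \<mu> * ennreal (survival \<mu> r) * (\<Sum>n. (extend (rate_below \<mu> r) ^^ n) F [])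
        = ennreal ((\<mu> + r) * survival \<mu> r) * (ennreal (\<mu> / (\<mu> + r)) * (\<Sum>n. (extend (rate_below \<mu> r) ^^ n) F []))"
        by (simp add: mult.assoc)
      also have "\<dots> \<le> ennreal ((\<mu> + r) * survival \<mu> r) * \<Phi> r"
        unfolding \<Phi>_def by (intro mult_left_mono points_lower_bound[OF prob_space_axioms pp \<mu> True F cont bd]) auto
      finally show ?thesis using True by simp
    qed simp
  qed
qed

end

section \<open>Convergence in distribution\<close>

lemma extend_add:
  assumes [measurable]: "\<rho> \<in> borel_measurable borel" "F \<in> borel_measurable list_borel" "G \<in> borel_measurable list_borel"
  shows "extend \<rho> (\<lambda>l. F l + G l) l = extend \<rho> F l + extend \<rho> G l"
  unfolding extend_def
  by (subst nn_integral_add[symmetric]) (auto simp: algebra_simps intro!: nn_integral_cong)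

lemma extend_power_add:
  assumes [measurable]: "\<rho> \<in> borel_measurable borel" "F \<in> borel_measurable list_borel" "G \<in> borel_measurable list_borel"
  shows "(extend \<rho> ^^ n) (\<lambda>l. F l + G l) = (\<lambda>l. (extend \<rho> ^^ n) F l + (extend \<rho> ^^ n) G l)"
proof (induction n)
  case (Suc n)
  show ?case unfolding funpow.simps o_def Suc.IH by (intro ext extend_add) measurable
qed simp

lemma ladder_law_add:
  assumes [measurable]: "F \<in> borel_measurable list_borel" "G \<in> borel_measurable list_borel"
  shows "ladder_law \<mu> (\<lambda>l. F l + G l) = ladder_law \<mu> F + ladder_law \<mu> G"
proof -
  let ?E = "extend (\<lambda>_. ennreal \<mu>)" and ?w = "\<lambda>l. ennreal (survival \<mu> (upper l))"
  have "?E (\<lambda>l. ?w l * (F l + G l)) = (\<lambda>l. ?E (\<lambda>l. ?w l * F l) l + ?E (\<lambda>l. ?w l * G l) l)"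
    unfolding distrib_left by (intro ext extend_add) measurable
  then show ?thesis
    unfolding ladder_law_def by (simp add: extend_power_add suminf_add)
qed

lemma ladder_law_const:
  "ladder_law \<mu> (\<lambda>_. c) = c * ladder_law \<mu> (\<lambda>_. 1)"
proof -
  let ?E = "extend (\<lambda>_. ennreal \<mu>)" and ?w = "\<lambda>l. ennreal (survival \<mu> (upper l))"
  have "?E (\<lambda>l. ?w l * c) = (\<lambda>l. c * ?E (\<lambda>l. ?w l * 1) l)"
    by (intro ext, subst extend_cmult[symmetric]) (simp_all add: mult.commute)
  then show ?thesis
    unfolding ladder_law_def by (simp add: extend_power_cmult)
qed

lemma eventually_gt_of_ennreal_liminf:
  fixes y :: "nat \<Rightarrow> real"
  assumes y: "\<forall>\<^sub>F N in sequentially. 0 \<le> y N" and q: "ennreal q \<le> liminf (\<lambda>N. ennreal (y N))" "a < q"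
  shows "\<forall>\<^sub>F N in sequentially. a < y N"
proof (cases "a < 0")
  case True
  show ?thesis using y by eventually_elim (use True in simp)
next
  case False
  then have "ennreal a < ennreal q" using q(2) by (intro ennreal_lessI) auto
  also note q(1)
  finally have "\<forall>\<^sub>F N in sequentially. ennreal a < ennreal (y N)" by (rule less_LiminfD)
  then show ?thesis using y by eventually_elim (use False in \<open>simp add: ennreal_less_iff\<close>)
qed

text \<open>The first bound on the limit inferior is a lower bound for \<open>x\<close>, the second an upper bound.\<close>

lemma liminf_pinch:
  fixes x :: "nat \<Rightarrow> real"
  assumes x: "\<forall>\<^sub>F N in sequentially. 0 \<le> x N \<and> x N \<le> c"
    and l: "ennreal p \<le> liminf (\<lambda>N. ennreal (x N))" and u: "ennreal (c - p) \<le> liminf (\<lambda>N. ennreal (c - x N))"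
  shows "x \<longlonglongrightarrow> p"
proof (rule order_tendstoI)
  fix a assume "a < p"
  then show "\<forall>\<^sub>F N in sequentially. a < x N"
    by (rule eventually_gt_of_ennreal_liminf[OF _ l, rotated]) (use x in \<open>auto elim: eventually_mono\<close>)
next
  fix a assume "p < a"
  then have "c - a < c - p" by simp
  then have "\<forall>\<^sub>F N in sequentially. c - a < c - x N"
    by (rule eventually_gt_of_ennreal_liminf[OF _ u, rotated]) (use x in \<open>auto elim: eventually_mono\<close>)
  then show "\<forall>\<^sub>F N in sequentially. x N < a" by eventually_elim simp
qed

text \<open>Continuity on the sum topology amounts to continuity on each summand, and there to convergence of
  the coordinates.\<close>

lemma finite_seq_continuous:
  assumes f: "continuous_map finite_seqs euclideanreal f" and lim: "\<And>i. i < n \<Longrightarrow> (\<lambda>N. x N i) \<longlonglongrightarrow> y i"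
  shows "(\<lambda>N. f (finite_seq n (x N))) \<longlonglongrightarrow> f (finite_seq n y)"
proof -
  define g where "g x i = (if i < n then x i else 0)" for x :: "nat \<Rightarrow> real" and i
  have fs: "finite_seq n x = (n, g x)" for x by (simp add: finite_seq_def g_def fun_eq_iff)
  have "continuous_map (Euclidean_space n) finite_seqs (\<lambda>y. (n, y))"
    unfolding finite_seqs_def by (rule continuous_map_component_injection) simp
  from continuous_map_compose[OF this f]
  have c: "continuous_map (Euclidean_space n) euclideanreal (\<lambda>y. f (n, y))" by (simp add: o_def)
  have "limitin (Euclidean_space n) (\<lambda>N. g (x N)) (g y) sequentially"
    unfolding Euclidean_space_def limitin_subtopology
  proof (intro conjI)
    have "limitin euclideanreal (\<lambda>N. g (x N) i) (g y i) sequentially" for i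
      using lim[of i] by (cases "i < n") (auto simp: g_def)
    then show "limitin (powertop_real UNIV) (\<lambda>N. g (x N)) (g y) sequentially"
      by (subst limitin_componentwise) auto
  qed (auto simp: g_def)
  from continuous_map_limit[OF c this]
  show ?thesis unfolding fs by (simp add: o_def)
qed

lemma seq_of_list_continuous:
  assumes "continuous_map finite_seqs euclideanreal f"
    and "\<And>N. length (L N) = length l" "\<And>i. i < length l \<Longrightarrow> (\<lambda>N. L N ! i) \<longlonglongrightarrow> l ! i"
  shows "(\<lambda>N. f (seq_of_list (L N))) \<longlonglongrightarrow> f (seq_of_list l)"
  unfolding seq_of_list_def assms(2) by (rule finite_seq_continuous[OF assms(1)]) (rule assms(3))

lemma measurable_seq_of_list:
  assumes f: "continuous_map finite_seqs euclideanreal f"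
  shows "(\<lambda>l. f (seq_of_list l)) \<in> borel_measurable list_borel"
proof (rule measurable_from_list_borelI)
  have "(\<lambda>s. f (finite_seq n s)) \<in> borel_measurable (PiM UNIV (\<lambda>_. borel))" for n
  proof -
    have "continuous_on UNIV (\<lambda>s. f (finite_seq n s))"
    proof (rule continuous_on_sequentiallyI)
      fix u :: "nat \<Rightarrow> nat \<Rightarrow> real" and a assume "u \<longlonglongrightarrow> a"
      then have "(\<lambda>N. u N i) \<longlonglongrightarrow> a i" for i
        by (intro continuous_on_tendsto_compose[OF continuous_on_product_coordinates \<open>u \<longlonglongrightarrow> a\<close>]) auto
      then show "(\<lambda>N. f (finite_seq n (u N))) \<longlonglongrightarrow> f (finite_seq n a)"
        by (intro finite_seq_continuous[OF f])
    qed
    then have "(\<lambda>s. f (finite_seq n s)) \<in> borel_measurable borel"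
      by (rule borel_measurable_continuous_onI)
    then show ?thesis
      by (subst measurable_cong_sets[OF sets_PiM_equal_borel refl])
  qed
  then have "(\<lambda>z. f (finite_seq (fst z) (snd z))) \<in> borel_measurable (count_space UNIV \<Otimes>\<^sub>M PiM UNIV (\<lambda>_. borel))"
    by (intro measurable_pair_measure_countable1) auto
  moreover have "seq_of_list (map s [0..<n]) = finite_seq n s" for n s
    by (simp add: seq_of_list_def finite_seq_def fun_eq_iff)
  ultimately show "(\<lambda>(n, s). f (seq_of_list (map s [0..<n]))) \<in> borel_measurable (count_space UNIV \<Otimes>\<^sub>M PiM UNIV (\<lambda>_. borel))"
    by (simp add: case_prod_unfold)
qed

lemma seq_of_list_in_topspace: "seq_of_list l \<in> topspace finite_seqs"
  by (auto simp: seq_of_list_def finite_seq_def finite_seqs_def topspace_Euclidean_space)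

context stopped_walk
begin

lemma measurable_scaled_color_changes:
  "(\<lambda>\<omega>. scaled_color_changes N k (\<lambda>t. X t \<omega>)) \<in> M \<rightarrow>\<^sub>M count_space UNIV"
  unfolding scaled_color_changes_def Let_def num_colors_def color_changes_def edge_color_def lew_length_def
  by (rule measurable_stopped[where g = "\<lambda>n s. finite_seq (card ((\<lambda>i. fst (snd s) ! (i - 1)) ` {1..length (fst s) - 1}) - 1)
    (\<lambda>i. real (sorted_list_of_set {i \<in> {1..length (fst s) - 1 - 1}. fst (snd s) ! (i - 1) \<noteq> fst (snd s) ! (i + 1 - 1)} ! i) / sqrt (real N))"])

lemma AE_scaled_color_changes:
  "AE \<omega> in M. scaled_color_changes N k (\<lambda>t. X t \<omega>) = seq_of_list (map (\<lambda>j. real j / sqrt (real N)) (sorted_list_of_set (changes \<omega>)))"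
  using AE_changes
proof eventually_elim
  case (elim \<omega>)
  have fin: "finite (changes \<omega>)" by (simp add: changes_def color_changes_def)
  from elim show ?case
    unfolding scaled_color_changes_def Let_def changes_def[symmetric] seq_of_list_def finite_seq_def
    using fin by (auto simp: fun_eq_iff)
qed

end

theorem proposition2:
  fixes \<mu> :: real
    and M :: "nat \<Rightarrow> 'a measure" and X :: "nat \<Rightarrow> nat \<Rightarrow> 'a \<Rightarrow> nat"
    and \<Omega> :: "'b measure" and P Q D :: "nat \<Rightarrow> 'b \<Rightarrow> real" and X\<^sub>\<mu> :: "'b \<Rightarrow> real"
  assumes "\<mu> > 0"
    and "\<And>N. N \<ge> 2 \<Longrightarrow> uniform_walk (M N) N (X N)"
    and "prob_space \<Omega>"
    and "rayleigh_process \<Omega> P Q"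
    and "distributed \<Omega> lborel X\<^sub>\<mu> (exponential_density \<mu>)"
    and "independent_elements \<Omega> pair_seq_algebra (\<lambda>\<omega> i. (P i \<omega>, Q i \<omega>)) borel X\<^sub>\<mu>"
    and "poisson_points \<Omega> (\<lambda>t. 1 / (\<mu> + t)) D"
    and "independent_elements \<Omega> (pair_seq_algebra \<Otimes>\<^sub>M borel) (\<lambda>\<omega>. (\<lambda>i. (P i \<omega>, Q i \<omega>), X\<^sub>\<mu> \<omega>))
           (PiM {1..} (\<lambda>_. borel)) (\<lambda>\<omega>. \<lambda>i\<in>{1..}. D i \<omega>)"
  defines "C \<equiv> \<lambda>N \<omega>. scaled_color_changes N (nat \<lfloor>\<mu> * sqrt (real N)\<rfloor>) (\<lambda>t. X N t \<omega>)"
    and "R \<equiv> \<lambda>t \<omega>. rayleigh_path (\<lambda>i. P i \<omega>) (\<lambda>i. Q i \<omega>) t"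
  shows "converges_in_distribution finite_seqs M C \<Omega>
           (\<lambda>\<omega>. points_below (\<lambda>i. D i \<omega>) (R (X\<^sub>\<mu> \<omega>) \<omega>)) \<and>
         converges_in_distribution finite_seqs M C \<Omega>
           (\<lambda>\<omega>. ladder_indices (\<lambda>i. P i \<omega>) (\<lambda>i. Q i \<omega>) (X\<^sub>\<mu> \<omega>))"
proof -
  interpret killed_rayleigh \<Omega> P Q X\<^sub>\<mu> \<mu>
    using assms(1,3-6) by (simp add: killed_rayleigh_def killed_rayleigh_axioms_def)
  define k where "k N = nat \<lfloor>\<mu> * sqrt (real N)\<rfloor>" for N
  have k_ev: "\<forall>\<^sub>F N in sequentially. 1 \<le> k N \<and> k N < N \<and> N \<ge> 2" unfolding k_def by (rule eventually_floor_sqrt[OF assms(1)])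
  have walk: "stopped_walk (M N) (X N) N (k N)" if "1 \<le> k N" "k N < N" "N \<ge> 2" for N
    using that assms(2)[of N] by (simp add: stopped_walk_def stopped_walk_axioms_def uniform_walk_def)
  define LD where "LD \<omega> = map (\<lambda>i. Q i \<omega>) (sorted_list_of_set (ladder_jumps (\<lambda>i. P i \<omega>) (\<lambda>i. Q i \<omega>) (X\<^sub>\<mu> \<omega>)))" for \<omega>
  define PT where "PT \<omega> = points_list (\<lambda>i. D i \<omega>) (R (X\<^sub>\<mu> \<omega>) \<omega>)" for \<omega>
  have LD_meas[measurable]: "LD \<in> \<Omega> \<rightarrow>\<^sub>M list_borel" unfolding LD_def by (rule measurable_ladder_jumps_list)
  have PT_meas[measurable]: "PT \<in> \<Omega> \<rightarrow>\<^sub>M list_borel"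
    unfolding PT_def R_def by (rule measurable_points_list) (use assms(7) in \<open>auto simp: poisson_points_def\<close>)
  have key: "(\<forall>\<^sub>F N in sequentially. (\<lambda>\<omega>. f (C N \<omega>)) \<in> borel_measurable (M N)) \<and>
     (\<lambda>N. \<integral>\<omega>. f (C N \<omega>) \<partial>M N) \<longlonglongrightarrow> (\<integral>\<omega>. f (seq_of_list (PT \<omega>)) \<partial>\<Omega>) \<and>
     (\<lambda>N. \<integral>\<omega>. f (C N \<omega>) \<partial>M N) \<longlonglongrightarrow> (\<integral>\<omega>. f (seq_of_list (LD \<omega>)) \<partial>\<Omega>)"
    if f: "continuous_map finite_seqs euclideanreal f" and bdd: "bounded (f ` topspace finite_seqs)" for f
  proof -
    obtain B where B: "\<And>z. z \<in> topspace finite_seqs \<Longrightarrow> \<bar>f z\<bar> \<le> B" using bdd by (auto simp: bounded_iff)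
    define \<phi> where "\<phi> l = f (seq_of_list l)" for l
    have \<phi>: "\<bar>\<phi> l\<bar> \<le> B" for l unfolding \<phi>_def by (rule B[OF seq_of_list_in_topspace])
    have \<phi>': "0 \<le> \<phi> l + B" "0 \<le> B - \<phi> l" for l using \<phi>[of l] by auto
    have \<phi>_meas[measurable]: "\<phi> \<in> borel_measurable list_borel"
      unfolding \<phi>_def[abs_def] by (rule measurable_seq_of_list[OF f])
    have \<phi>_cont: "(\<lambda>N. \<phi> (L N)) \<longlonglongrightarrow> \<phi> l"
      if "\<And>N. length (L N) = length l" "\<And>i. i < length l \<Longrightarrow> (\<lambda>N. L N ! i) \<longlonglongrightarrow> l ! i" for L l
      unfolding \<phi>_def using f that by (rule seq_of_list_continuous)
    \<comment> \<open>Two nonnegative continuous functions with constant sum, so that lower bounds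
      for both determine the integrals.\<close>
    define F G where "F l = ennreal (\<phi> l + B)" and "G l = ennreal (B - \<phi> l)" for l
    have FG_meas[measurable]: "F \<in> borel_measurable list_borel" "G \<in> borel_measurable list_borel"
      unfolding F_def[abs_def] G_def[abs_def] by measurable
    have FG_cont: "list_continuous F" "list_continuous G"
      unfolding list_continuous_def F_def G_def
      by (auto intro!: tendsto_ennrealI tendsto_add tendsto_diff tendsto_const \<phi>_cont)
    have FG_bd: "F l \<le> ennreal (2 * B)" "G l \<le> ennreal (2 * B)" for l
      unfolding F_def G_def using \<phi>[of l] by (auto intro!: ennreal_leI simp: abs_le_iff)
    have FG: "F l + G l = ennreal (2 * B)" for l
      unfolding F_def G_def using \<phi>[of l] by (subst ennreal_plus[symmetric]) (auto simp: abs_le_iff)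
    define \<pi>F \<pi>G where "\<pi>F = ladder_law \<mu> (\<lambda>l. F (butlast l))" and "\<pi>G = ladder_law \<mu> (\<lambda>l. G (butlast l))"
    have "\<pi>F + \<pi>G = ladder_law \<mu> (\<lambda>l. F (butlast l) + G (butlast l))"
      unfolding \<pi>F_def \<pi>G_def by (rule ladder_law_add[symmetric]) measurable
    also have "\<dots> = ennreal (2 * B) * ladder_law \<mu> (\<lambda>_. 1)" unfolding FG by (rule ladder_law_const)
    also have "\<dots> \<le> ennreal (2 * B) * 1" by (intro mult_left_mono ladder_law_1_le assms(1)) auto
    finally have \<pi>_sum: "\<pi>F + \<pi>G \<le> ennreal (2 * B)" by simp
    \<comment> \<open>The nonnegative integrals of \<open>F\<close> and \<open>G\<close> are shifted integrals of \<open>\<phi>\<close>, so a bound on one of them from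
      either side is a bound on the expectation of \<open>\<phi>\<close>.\<close>
    have int: "(\<integral>\<^sup>+\<omega>. F (Y \<omega>) \<partial>K) = ennreal ((\<integral>\<omega>. \<phi> (Y \<omega>) \<partial>K) + B) \<and> (\<integral>\<^sup>+\<omega>. G (Y \<omega>) \<partial>K) = ennreal (B - (\<integral>\<omega>. \<phi> (Y \<omega>) \<partial>K))
        \<and> \<bar>\<integral>\<omega>. \<phi> (Y \<omega>) \<partial>K\<bar> \<le> B"
      if "prob_space K" and m: "(\<lambda>\<omega>. \<phi> (Y \<omega>)) \<in> borel_measurable K" for K :: "'z measure" and Y
    proof -
      interpret K: prob_space K by fact
      have i: "integrable K (\<lambda>\<omega>. \<phi> (Y \<omega>))"
        by (rule K.integrable_const_bound[of _ B]) (use m \<phi> in auto)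
      have 1: "(\<integral>\<^sup>+\<omega>. F (Y \<omega>) \<partial>K) = ennreal (\<integral>\<omega>. \<phi> (Y \<omega>) + B \<partial>K)"
        unfolding F_def using i \<phi>' by (intro nn_integral_eq_integral) auto
      have 2: "(\<integral>\<^sup>+\<omega>. G (Y \<omega>) \<partial>K) = ennreal (\<integral>\<omega>. B - \<phi> (Y \<omega>) \<partial>K)"
        unfolding G_def using i \<phi>' by (intro nn_integral_eq_integral) auto
      have "\<bar>\<integral>\<omega>. \<phi> (Y \<omega>) \<partial>K\<bar> \<le> (\<integral>\<omega>. \<bar>\<phi> (Y \<omega>)\<bar> \<partial>K)" by (rule integral_abs_bound)
      also have "\<dots> \<le> (\<integral>\<omega>. B \<partial>K)" using i \<phi> by (intro integral_mono) auto
      finally have 3: "\<bar>\<integral>\<omega>. \<phi> (Y \<omega>) \<partial>K\<bar> \<le> B" by (simp add: K.prob_space)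
      show ?thesis using 1 2 3 i by (simp add: K.prob_space)
    qed
    define a where "a = (\<integral>\<omega>. \<phi> (LD \<omega>) \<partial>\<Omega>)"
    define b where "b = (\<integral>\<omega>. \<phi> (PT \<omega>) \<partial>\<Omega>)"
    have ia: "(\<integral>\<^sup>+\<omega>. F (LD \<omega>) \<partial>\<Omega>) = ennreal (a + B)" "(\<integral>\<^sup>+\<omega>. G (LD \<omega>) \<partial>\<Omega>) = ennreal (B - a)" "\<bar>a\<bar> \<le> B"
      using int[OF assms(3), of LD] unfolding a_def by auto
    have ib: "(\<integral>\<^sup>+\<omega>. F (PT \<omega>) \<partial>\<Omega>) = ennreal (b + B)" "(\<integral>\<^sup>+\<omega>. G (PT \<omega>) \<partial>\<Omega>) = ennreal (B - b)" "\<bar>b\<bar> \<le> B"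
      using int[OF assms(3), of PT] unfolding b_def by auto
    \<comment> \<open>Upper bounds for the ladder indices, whose sum is the total mass, so they are equalities.\<close>
    have aF: "ennreal (a + B) \<le> \<pi>F" and aG: "ennreal (B - a) \<le> \<pi>G"
      unfolding ia(1,2)[symmetric] \<pi>F_def \<pi>G_def LD_def by (rule nn_integral_ladder_le, measurable)+
    have "\<pi>F \<noteq> \<infinity>" "\<pi>G \<noteq> \<infinity>" using \<pi>_sum by (auto simp: top_unique)
    then obtain p q where pq: "\<pi>F = ennreal p" "\<pi>G = ennreal q" "p \<ge> 0" "q \<ge> 0"
      by (metis ennreal_cases infinity_ennreal_def)
    have "a + B \<le> p" "B - a \<le> q" using aF aG pq ia(3) by (auto simp: ennreal_le_iff)
    moreover have "p + q \<le> 2 * B" using \<pi>_sum pq \<phi>[of "[]"] by (simp add: ennreal_plus[symmetric] ennreal_le_iff del: ennreal_plus)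
    ultimately have p: "p = a + B" and q: "q = B - a" by auto
    \<comment> \<open>For the Poisson points the bounds go in the opposite direction.\<close>
    have bF: "\<pi>F \<le> ennreal (b + B)" and bG: "\<pi>G \<le> ennreal (B - b)"
      unfolding ib(1,2)[symmetric] \<pi>F_def \<pi>G_def PT_def R_def
      by (rule ladder_law_le_points[OF assms(7,8) _ _ FG_bd(1)] ladder_law_le_points[OF assms(7,8) _ _ FG_bd(2)]; (rule FG_meas FG_cont))+
    have "a + B \<le> b + B" "B - a \<le> B - b"
      using bF bG ib(3) unfolding pq p q by (auto simp: ennreal_le_iff abs_le_iff)
    then have ab: "a = b" by simp
    define L where "L N \<omega> = map (\<lambda>j. real j / sqrt (real N)) (sorted_list_of_set (color_changes (\<lambda>t. X N t \<omega>) (hitting_time (k N) (\<lambda>t. X N t \<omega>))))" for N \<omega>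
    have meas_ev: "\<forall>\<^sub>F N in sequentially. (\<lambda>\<omega>. f (C N \<omega>)) \<in> borel_measurable (M N) \<and> prob_space (M N) \<and>
        (\<lambda>\<omega>. \<phi> (L N \<omega>)) \<in> borel_measurable (M N) \<and> (\<integral>\<omega>. f (C N \<omega>) \<partial>M N) = (\<integral>\<omega>. \<phi> (L N \<omega>) \<partial>M N)"
      using k_ev
    proof eventually_elim
      case (elim N)
      interpret W: stopped_walk "M N" "X N" N "k N" using walk elim by simp
      have 1: "(\<lambda>\<omega>. f (C N \<omega>)) \<in> borel_measurable (M N)"
        unfolding C_def k_def[symmetric] by (rule measurable_compose[OF W.measurable_scaled_color_changes]) simp
      have 2: "(\<lambda>\<omega>. \<phi> (L N \<omega>)) \<in> borel_measurable (M N)"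
        unfolding L_def W.changes_def[symmetric] by (rule measurable_compose[OF W.measurable_changes]) simp
      have "(\<integral>\<omega>. f (C N \<omega>) \<partial>M N) = (\<integral>\<omega>. \<phi> (L N \<omega>) \<partial>M N)"
      proof (rule integral_cong_AE[OF 1 2])
        show "AE \<omega> in M N. f (C N \<omega>) = \<phi> (L N \<omega>)"
          using W.AE_scaled_color_changes
          unfolding C_def L_def \<phi>_def k_def[symmetric] W.changes_def by eventually_elim simp
      qed
      then show ?case using 1 2 W.prob_space_axioms by simp
    qed
    define x where "x N = (\<integral>\<omega>. f (C N \<omega>) \<partial>M N) + B" for N
    have x_ev: "\<forall>\<^sub>F N in sequentially. 0 \<le> x N \<and> x N \<le> 2 * B \<and>
       (\<integral>\<^sup>+\<omega>. F (L N \<omega>) \<partial>M N) = ennreal (x N) \<and> (\<integral>\<^sup>+\<omega>. G (L N \<omega>) \<partial>M N) = ennreal (2 * B - x N)"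
      using meas_ev
    proof eventually_elim
      case (elim N)
      then show ?case using int[of "M N" "L N"] unfolding x_def by (auto simp: abs_le_iff algebra_simps)
    qed
    have "x \<longlonglongrightarrow> a + B"
    proof (rule liminf_pinch[of x "2 * B"])
      have "\<pi>F \<le> liminf (\<lambda>N. \<integral>\<^sup>+\<omega>. F (L N \<omega>) \<partial>M N)"
        unfolding \<pi>F_def L_def k_def by (rule walk_lower_bound[OF assms(1,2) FG_cont(1)])
      also have "\<dots> \<le> liminf (\<lambda>N. ennreal (x N))"
        by (rule Liminf_mono) (use x_ev in \<open>eventually_elim, simp\<close>)
      finally show "ennreal (a + B) \<le> liminf (\<lambda>N. ennreal (x N))" unfolding pq p .
      have "\<pi>G \<le> liminf (\<lambda>N. \<integral>\<^sup>+\<omega>. G (L N \<omega>) \<partial>M N)"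
        unfolding \<pi>G_def L_def k_def by (rule walk_lower_bound[OF assms(1,2) FG_cont(2)])
      also have "\<dots> \<le> liminf (\<lambda>N. ennreal (2 * B - x N))"
        by (rule Liminf_mono) (use x_ev in \<open>eventually_elim, simp\<close>)
      finally show "ennreal (2 * B - (a + B)) \<le> liminf (\<lambda>N. ennreal (2 * B - x N))"
        unfolding pq q by (simp add: algebra_simps)
      show "\<forall>\<^sub>F N in sequentially. 0 \<le> x N \<and> x N \<le> 2 * B" using x_ev by eventually_elim simp
    qed
    then have "(\<lambda>N. x N - B) \<longlonglongrightarrow> a + B - B" by (intro tendsto_diff tendsto_const)
    then have "(\<lambda>N. \<integral>\<omega>. f (C N \<omega>) \<partial>M N) \<longlonglongrightarrow> a" by (simp add: x_def)
    moreover have "\<forall>\<^sub>F N in sequentially. (\<lambda>\<omega>. f (C N \<omega>)) \<in> borel_measurable (M N)"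
      using meas_ev by eventually_elim simp
    ultimately show ?thesis using ab unfolding a_def b_def \<phi>_def by simp
  qed
  have PT_eq: "points_below (\<lambda>i. D i \<omega>) (R (X\<^sub>\<mu> \<omega>) \<omega>) = seq_of_list (PT \<omega>)" for \<omega>
    unfolding PT_def by (rule points_below_eq)
  have LD_eq: "ladder_indices (\<lambda>i. P i \<omega>) (\<lambda>i. Q i \<omega>) (X\<^sub>\<mu> \<omega>) = seq_of_list (LD \<omega>)" for \<omega>
    unfolding LD_def by (rule ladder_indices_eq)
  have meas: "(\<lambda>\<omega>. f (seq_of_list (Y \<omega>))) \<in> borel_measurable \<Omega>"
    if "continuous_map finite_seqs euclideanreal f" "Y \<in> \<Omega> \<rightarrow>\<^sub>M list_borel" for f Y
    by (rule measurable_compose[OF that(2) measurable_seq_of_list[OF that(1)]])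
  show ?thesis
    unfolding converges_in_distribution_def PT_eq LD_eq
    using key meas[OF _ PT_meas] meas[OF _ LD_meas] by blast
qed

end
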